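(* For every integer $n\ge 3$, the Bergman kernel $K_{\mathbb G_n}$ of the symmetrized polydisc $\mathbb G_n$ has zeros, i.e. there exist points $z,w\in\mathbb G_n$ with $K_{\mathbb G_n}(z,w)=0$.
   Context: Let $\mathbb D$ be the unit disc in $\mathbb C$. For $\lambda=(\lambda_1,\dots,\lambda_n)\in\mathbb C^n$ define $\pi_n=(\pi_{n,1},\dots,\pi_{n,n}):\mathbb C^n\to\mathbb C^n$ by $\pi_{n,k}(\lambda)=\sum_{1\le j_1<\dots<j_k\le n}\lambda_{j_1}\cdots\lambda_{j_k}$, $1\le k\le n$ (the elementary symmetric polynomials). The symmetrized polydisc is the domain $\mathbb G_n=\pi_n(\mathbb D^n)\subset\mathbb C^n$. $K_{\mathbb G_n}$ denotes its Bergman kernel, a function on $\mathbb G_n\times\mathbb G_n$. *)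

theory Defs
  imports "HOL-Analysis.Analysis"
begin

text \<open>Points of C^n are modelled as extensional functions on the index set {..<n}
  (coordinate j, 0 <= j < n); C^n carries the product topology and the
  Lebesgue measure (product of Lebesgue measure on C = R^2).\<close>

definition Cn :: "nat \<Rightarrow> (nat \<Rightarrow> complex) set" where
  "Cn n = PiE {..<n} (\<lambda>_. UNIV)"

definition lebesgue_Cn :: "nat \<Rightarrow> (nat \<Rightarrow> complex) measure" where
  "lebesgue_Cn n = PiM {..<n} (\<lambda>_. (lborel :: complex measure))"

definition unit_polydisc :: "nat \<Rightarrow> (nat \<Rightarrow> complex) set" where
  "unit_polydisc n = {l \<in> Cn n. \<forall>j<n. cmod (l j) < 1}"

definition elem_sym :: "nat \<Rightarrow> nat \<Rightarrow> (nat \<Rightarrow> complex) \<Rightarrow> complex" where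
  "elem_sym n k l = (\<Sum>S\<in>{S. S \<subseteq> {..<n} \<and> card S = k}. \<Prod>j\<in>S. l j)"

definition sym_map :: "nat \<Rightarrow> (nat \<Rightarrow> complex) \<Rightarrow> (nat \<Rightarrow> complex)" where
  "sym_map n l = restrict (\<lambda>i. elem_sym n (Suc i) l) {..<n}"

definition symmetrized_polydisc :: "nat \<Rightarrow> (nat \<Rightarrow> complex) set" where
  "symmetrized_polydisc n = sym_map n ` unit_polydisc n"

text \<open>Holomorphic functions of several variables on a domain D of C^n
  (Osgood: continuous and holomorphic in each variable separately).\<close>
definition holomorphic_n :: "nat \<Rightarrow> ((nat \<Rightarrow> complex) \<Rightarrow> complex) \<Rightarrow> (nat \<Rightarrow> complex) set \<Rightarrow> bool" where
  "holomorphic_n n f D \<longleftrightarrow> continuous_on D f \<and>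
     (\<forall>z\<in>D. \<forall>j<n. (\<lambda>t. f (z(j := t))) holomorphic_on {t. z(j := t) \<in> D})"

definition bergman_space :: "nat \<Rightarrow> (nat \<Rightarrow> complex) set \<Rightarrow> ((nat \<Rightarrow> complex) \<Rightarrow> complex) set" where
  "bergman_space n D = {f. holomorphic_n n f D \<and>
     set_integrable (lebesgue_Cn n) D (\<lambda>z. (cmod (f z))\<^sup>2)}"

definition is_bergman_kernel :: "nat \<Rightarrow> (nat \<Rightarrow> complex) set \<Rightarrow>
    ((nat \<Rightarrow> complex) \<Rightarrow> (nat \<Rightarrow> complex) \<Rightarrow> complex) \<Rightarrow> bool" where
  "is_bergman_kernel n D K \<longleftrightarrow>
     (\<forall>w\<in>D. (\<lambda>z. K z w) \<in> bergman_space n D \<and>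
        (\<forall>f\<in>bergman_space n D.
           f w = set_lebesgue_integral (lebesgue_Cn n) D (\<lambda>z. f z * cnj (K z w))))"

end

theory Submission
  imports
    Defs
    "HOL-Complex_Analysis.Complex_Analysis"
    "HOL-Computational_Algebra.Fundamental_Theorem_Algebra"
    "Jordan_Normal_Form.Determinant"
begin

text \<open>
  Write \<open>\<pi>\<close> for the map given by the elementary symmetric polynomials and \<open>V\<close> for the Vandermonde
  product, which is the Jacobian determinant of \<open>\<pi>\<close> up to sign. Pulling back along \<open>\<pi>\<close> turns the
  Bergman space of the symmetrized polydisc into antisymmetric functions \<open>(f \<circ> \<pi>) V\<close> on the polydisc,
  whose Bergman kernel is a product. Antisymmetrizing that product gives
  \<open>K(\<pi>(l), \<pi>(m)) V(l) cnj(V(m)) = det [1 / (1 - l\<^sub>j cnj m\<^sub>k)\<^sup>2] / pi\<^sup>n\<close>.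
  For \<open>l\<^sub>j = a \<omega>\<^sup>j\<close> and \<open>cnj m\<^sub>k = a \<omega>\<^sup>k\<close> with \<open>\<omega>\<close> a primitive \<open>n\<close>-th root of unity, every row of this matrix
  sums to \<open>n (1 + (n - 1) u) / (1 - u)\<^sup>2\<close> with \<open>u = a\<^sup>2\<^sup>n\<close>. So the kernel vanishes once
  \<open>u = -1 / (n - 1)\<close>, and this has modulus less than 1 exactly because \<open>n \<ge> 3\<close>.
\<close>

section \<open>Holomorphic change of variables in the plane\<close>

text \<open>Two steps named in the overview shape the development. The substitution formula for the
  map of degree n! is obtained without an n-dimensional Jacobian: roots are adjoined one at a time,
  and after a measure-preserving triangular change of the coefficients each step is a substitution
  by a polynomial in one complex variable. Only planar change of variables and the counting of
  preimages enter. The determinant formula, on the other hand, determines the kernel only where both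
  Vandermonde products are nonzero, whereas the kernel has to be holomorphic on the whole domain.
  The division is therefore carried out algebraically: a rescaled matrix factors through two
  Vandermonde matrices, which leaves a polynomial in the symmetrized variables over a denominator
  without zeros. The reproducing formula is proved at tuples with distinct coordinates and extended
  by continuity. The coefficient n - 1 in the row sum counts the pairs of exponents
  \<open>(m, m')\<close>, both below n, with \<open>m + m' = n\<close>; the pair (0, 0) gives the
  summand 1.\<close>

definition vec_complex :: "real^2 \<Rightarrow> complex" where "vec_complex v = Complex (v $ 1) (v $ 2)"
definition complex_vec :: "complex \<Rightarrow> real^2" where "complex_vec z = vector [Re z, Im z]"

lemma vec_complex_inverse [simp]: "complex_vec (vec_complex v) = v"
  by (simp add: complex_vec_def vec_complex_def Finite_Cartesian_Product.vec_eq_iff forall_2)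

lemma complex_vec_inverse [simp]: "vec_complex (complex_vec z) = z"
  by (simp add: complex_vec_def vec_complex_def)

lemma bounded_linear_vec_complex: "bounded_linear vec_complex"
  by (rule linear_conv_bounded_linear[THEN iffD1])
     (auto intro!: linearI simp: vec_complex_def complex_eq_iff)

lemma bounded_linear_complex_vec: "bounded_linear complex_vec"
  by (rule linear_conv_bounded_linear[THEN iffD1])
     (auto intro!: linearI simp: complex_vec_def Finite_Cartesian_Product.vec_eq_iff forall_2)

lemma borel_measurable_vec_complex [measurable]: "vec_complex \<in> borel_measurable borel"
  by (intro borel_measurable_continuous_onI linear_continuous_on bounded_linear_vec_complex)

lemma Basis_complex_prod: "(\<Prod>b\<in>Basis. f b) = f 1 * f \<i>" for f :: "complex \<Rightarrow> real"
  by (simp add: Basis_complex_def)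

text \<open>Transports planar Lebesgue measure to \<open>real^2\<close>, the kind of space for which
  the change of variables theorem \<open>has_measure_differentiable_image\<close> is stated.\<close>

lemma lborel_complex_eq_distr: "(lborel :: complex measure) = distr lborel borel vec_complex"
proof (rule lborel_eqI)
  fix l u :: complex
  assume le: "\<And>b. b \<in> Basis \<Longrightarrow> l \<bullet> b \<le> u \<bullet> b"
  then have le': "Re l \<le> Re u" "Im l \<le> Im u"
    using le[of 1] le[of \<i>] by (simp_all add: Basis_complex_def)
  have "emeasure (distr lborel borel vec_complex) (box l u)
      = emeasure lborel (vec_complex -` box l u)"
    by (subst emeasure_distr) auto
  also have "vec_complex -` box l u = box (complex_vec l) (complex_vec u)"
    by (auto simp: mem_box Basis_complex_def vec_complex_def complex_vec_def Basis_vec_def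
        inner_axis forall_2 mem_box_cart)
  also have "emeasure lborel \<dots> = (\<Prod>b\<in>Basis. (complex_vec u - complex_vec l) \<bullet> b)"
    using le' by (subst emeasure_lborel_box)
      (auto simp: Basis_vec_def inner_axis complex_vec_def exhaust_2 UNIV_2)
  also have "\<dots> = (\<Prod>b\<in>Basis. (u - l) \<bullet> b)"
  proof -
    have "(\<Prod>b\<in>Basis. (complex_vec u - complex_vec l) \<bullet> b)
        = (\<Prod>b\<in>{axis 1 1, axis 2 1 :: real^2}. (complex_vec u - complex_vec l) \<bullet> b)"
      by (intro prod.cong) (auto simp: Basis_vec_def UNIV_2)
    also have "\<dots> = Re (u - l) * Im (u - l)"
      by (subst prod.insert) (auto simp: axis_eq_axis inner_axis complex_vec_def)
    finally show ?thesis by (simp add: Basis_complex_prod)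
  qed
  finally show "emeasure (distr lborel borel vec_complex) (box l u) = (\<Prod>b\<in>Basis. (u - l) \<bullet> b)" .
qed simp

text \<open>The matrix has the Cauchy-Riemann form with rows (a, -b) and (b, a), so its determinant
  is a^2 + b^2.\<close>

lemma det_matrix_complex_mult:
  "Determinants.det (matrix (\<lambda>v. complex_vec (c * vec_complex v))) = (cmod c)\<^sup>2"
  unfolding det_2 matrix_def
  by (simp add: complex_vec_def vec_complex_def axis_def cmod_power2 flip: power2_eq_square)

lemma
  assumes "open S" "f holomorphic_on S" "inj_on f S" "A \<in> sets borel" "A \<subseteq> S"
  shows sets_borel_holomorphic_inj_image: "f ` A \<in> sets borel"
    and emeasure_holomorphic_inj_image:
      "emeasure lborel (f ` A) = (\<integral>\<^sup>+t\<in>A. ennreal ((cmod (deriv f t))\<^sup>2) \<partial>lborel)"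
proof -
  obtain g where g: "g holomorphic_on (f ` S)" "\<And>z. z \<in> S \<Longrightarrow> g (f z) = z"
    using holomorphic_has_inverse[OF assms(2,1,3)] by metis
  have opn: "open (f ` S)"
    using open_mapping_thm3[OF assms(2,1,3)] .
  have meq: "f ` A = {y \<in> f ` S. g y \<in> A}"
    using assms(5) g(2) by force
  have "continuous_on (f ` S) g"
    using g(1) by (rule holomorphic_on_imp_continuous_on)
  then have "g \<in> borel_measurable (restrict_space borel (f ` S))"
    by (rule borel_measurable_continuous_on_restrict)
  then have "g -` A \<inter> space (restrict_space borel (f ` S)) \<in> sets (restrict_space borel (f ` S))"
    using assms(4) by (rule measurable_sets)
  then have "g -` A \<inter> f ` S \<in> sets borel"
    using opn by (simp add: sets_restrict_space_iff space_restrict_space)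
  moreover have "g -` A \<inter> f ` S = f ` A"
    using meq by auto
  ultimately show fA: "f ` A \<in> sets borel" by simp
  define B where "B = vec_complex -` A"
  define F where "F = (\<lambda>v. complex_vec (f (vec_complex v)))"
  have Bb: "B \<in> sets borel"
    unfolding B_def using measurable_sets[OF borel_measurable_vec_complex assms(4)] by simp
  have FB: "F ` B = vec_complex -` (f ` A)"
  proof -
    have "v \<in> F ` B" if "vec_complex v \<in> f ` A" for v
    proof -
      from that obtain a where "a \<in> A" "vec_complex v = f a" by auto
      then have "F (complex_vec a) = v" "complex_vec a \<in> B"
        by (auto simp: F_def B_def) (metis vec_complex_inverse)
      then show ?thesis by blast
    qed
    then show ?thesis by (auto simp: F_def B_def)
  qed
  have em: "emeasure lborel (f ` A) = emeasure lborel (F ` B)"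
    using fA unfolding FB by (subst lborel_complex_eq_distr) (simp add: emeasure_distr)
  have FBb: "F ` B \<in> sets borel"
    unfolding FB using measurable_sets[OF borel_measurable_vec_complex fA] by simp
  have md: "(\<lambda>t. indicator A t * ennreal ((cmod (deriv f t))\<^sup>2)) \<in> borel_measurable borel"
  proof -
    have "continuous_on S (deriv f)"
      using assms by (intro holomorphic_on_imp_continuous_on holomorphic_deriv)
    then have "(\<lambda>t. indicator S t *\<^sub>R deriv f t) \<in> borel_measurable borel"
      using assms by (intro borel_measurable_continuous_on_indicator) auto
    then have "(\<lambda>t. indicator A t * ennreal ((cmod (indicator S t *\<^sub>R deriv f t))\<^sup>2)) \<in> borel_measurable borel"
      using assms(4) by measurable
    moreover have "(\<lambda>t. indicator A t * ennreal ((cmod (indicator S t *\<^sub>R deriv f t))\<^sup>2))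
        = (\<lambda>t. indicator A t * ennreal ((cmod (deriv f t))\<^sup>2))"
      using assms(5) by (auto simp: fun_eq_iff split: split_indicator)
    ultimately show ?thesis by simp
  qed
  have intg: "(\<integral>\<^sup>+t\<in>A. ennreal ((cmod (deriv f t))\<^sup>2) \<partial>lborel)
      = (\<integral>\<^sup>+v\<in>B. ennreal ((cmod (deriv f (vec_complex v)))\<^sup>2) \<partial>lborel)"
    using md by (subst lborel_complex_eq_distr)
      (simp add: nn_integral_distr B_def indicator_def mult.commute if_distrib)
  define J where "J = (\<lambda>v. (cmod (deriv f (vec_complex v)))\<^sup>2)"
  have der: "(F has_derivative (\<lambda>h. complex_vec (deriv f (vec_complex v) * vec_complex h))) (at v within B)"
    if "v \<in> B" for v
  proof -
    have "vec_complex v \<in> S" using that assms(5) by (auto simp: B_def)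
    then have "(f has_field_derivative deriv f (vec_complex v)) (at (vec_complex v))"
      using assms holomorphic_derivI by blast
    then have 1: "(f has_derivative (*) (deriv f (vec_complex v))) (at (vec_complex v))"
      by (simp add: has_field_derivative_def)
    have 2: "(vec_complex has_derivative vec_complex) (at v within B)"
      using bounded_linear_vec_complex by (rule bounded_linear_imp_has_derivative)
    have "((\<lambda>v. f (vec_complex v)) has_derivative (\<lambda>h. deriv f (vec_complex v) * vec_complex h)) (at v within B)"
      using has_derivative_compose[OF 2 1] by simp
    then show ?thesis
      unfolding F_def using bounded_linear.has_derivative[OF bounded_linear_complex_vec] by blast
  qed
  have injF: "inj_on F B"
    using assms(3,5) unfolding F_def B_def inj_on_def
    by (metis (no_types, lifting) complex_vec_inverse subsetD vec_complex_inverse vimageE)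
  \<comment> \<open>\<open>key\<close> and \<open>nn\<close> characterize the same finite number
    \<open>m\<close>, once as a measure and once as a nonnegative integral, both through the gauge
    integral of \<open>J\<close>.\<close>
  have key: "F ` B \<in> lmeasurable \<and> measure lebesgue (F ` B) = m \<longleftrightarrow> (J has_integral m) B" for m
    using has_measure_differentiable_image[OF _ der injF, of m] Bb
    by (simp add: det_matrix_complex_mult J_def)
  have Jm: "(\<lambda>v. indicator B v * ennreal (J v)) \<in> borel_measurable borel"
    using measurable_compose[OF borel_measurable_vec_complex md]
    by (simp add: J_def B_def indicator_def)
  have JmR: "(\<lambda>v. indicator B v * J v) \<in> borel_measurable borel"
  proof -
    have "(\<lambda>v. enn2real (indicator B v * ennreal (J v))) \<in> borel_measurable borel"
      using Jm by measurable
    moreover have "(\<lambda>v. enn2real (indicator B v * ennreal (J v))) = (\<lambda>v. indicator B v * J v)"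
      by (auto simp: J_def split: split_indicator)
    ultimately show ?thesis by simp
  qed
  have nn: "(\<integral>\<^sup>+v\<in>B. ennreal (J v) \<partial>lborel) = ennreal m \<longleftrightarrow> (J has_integral m) B" if "0 \<le> m" for m
  proof -
    have "(\<integral>\<^sup>+v\<in>B. ennreal (J v) \<partial>lborel) = (\<integral>\<^sup>+v. ennreal (indicator B v * J v) \<partial>lebesgue)"
      using JmR by (subst nn_integral_completion) (auto intro!: nn_integral_cong split: split_indicator)
    moreover have "((\<lambda>v. indicator B v * J v) has_integral m) UNIV \<longleftrightarrow>
        (\<integral>\<^sup>+v. ennreal (indicator B v * J v) \<partial>lebesgue) = ennreal m"
      using that JmR by (subst has_integral_iff_nn_integral_lebesgue)
        (auto simp: J_def measurable_completion)
    moreover have "((\<lambda>v. indicator B v * J v) has_integral m) UNIV \<longleftrightarrow> (J has_integral m) B"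
    proof -
      have "(\<lambda>v. indicator B v * J v) = (\<lambda>v. if v \<in> B then J v else 0)"
        by auto
      then show ?thesis by (simp add: has_integral_restrict_UNIV)
    qed
    ultimately show ?thesis by simp
  qed
  \<comment> \<open>Both characterizations concern finite values only. If the integral is infinite,
    a finite measure of the image would make it finite through \<open>key\<close> and
    \<open>nn\<close>.\<close>
  have "emeasure lborel (F ` B) = (\<integral>\<^sup>+v\<in>B. ennreal (J v) \<partial>lborel)"
  proof (cases "(\<integral>\<^sup>+v\<in>B. ennreal (J v) \<partial>lborel) = \<infinity>")
    case False
    then obtain m where m: "m \<ge> 0" "(\<integral>\<^sup>+v\<in>B. ennreal (J v) \<partial>lborel) = ennreal m"
      by (metis ennreal_cases infinity_ennreal_def)
    then have "F ` B \<in> lmeasurable \<and> measure lebesgue (F ` B) = m"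
      using key nn by blast
    then have "emeasure lebesgue (F ` B) = ennreal m"
      using emeasure_eq_measure2[of "F ` B" lebesgue] by metis
    moreover have "emeasure lebesgue (F ` B) = emeasure lborel (F ` B)"
      using FBb by (simp add: emeasure_completion main_part_sets sets_completionI_sets)
    ultimately show ?thesis
      using m(2) by simp
  next
    case True
    have "emeasure lborel (F ` B) = \<infinity>"
    proof (rule ccontr)
      assume "emeasure lborel (F ` B) \<noteq> \<infinity>"
      then have "F ` B \<in> lmeasurable"
        using FBb by (intro fmeasurableI) (auto simp: less_top)
      then have "(J has_integral measure lebesgue (F ` B)) B" using key by blast
      then show False using nn[of "measure lebesgue (F ` B)"] True by simp
    qed
    then show ?thesis using True by simp
  qed
  then show "emeasure lborel (f ` A) = (\<integral>\<^sup>+t\<in>A. ennreal ((cmod (deriv f t))\<^sup>2) \<partial>lborel)"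
    using em intg by (simp add: J_def)
qed

lemma borel_measurable_deriv_indicator:
  assumes "open S" "f holomorphic_on S"
  shows "(\<lambda>t. indicator S t *\<^sub>R deriv f t) \<in> borel_measurable borel"
  using assms
  by (intro borel_measurable_continuous_on_indicator holomorphic_on_imp_continuous_on holomorphic_deriv) auto

text \<open>The substitution as an identity of measures, from which the versions for nonnegative and
  for complex integrands both follow. Extending \<open>f\<close> by 0 outside \<open>S\<close> makes
  it Borel on the whole plane; the density lives on \<open>A\<close>, so the extension carries no
  mass.\<close>

lemma distr_density_holomorphic_inj:
  assumes S: "open S" and f: "f holomorphic_on S" "inj_on f S" and A: "A \<in> sets borel" "A \<subseteq> S"
  shows "distr (density lborel (\<lambda>t. ennreal (indicator A t * (cmod (deriv f t))\<^sup>2))) borel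
           (\<lambda>t. indicator S t *\<^sub>R f t)
       = density lborel (indicator (f ` A))"
    and "(\<lambda>t. indicator A t * (cmod (deriv f t))\<^sup>2) \<in> borel_measurable borel"
    and "(\<lambda>t. indicator S t *\<^sub>R f t) \<in> borel_measurable borel"
proof -
  have fA: "f ` A \<in> sets borel"
    using sets_borel_holomorphic_inj_image[OF S f A] .
  show mf [measurable]: "(\<lambda>t. indicator S t *\<^sub>R f t) \<in> borel_measurable borel"
    using S f(1) by (intro borel_measurable_continuous_on_indicator holomorphic_on_imp_continuous_on) auto
  have "(\<lambda>t. indicator A t * (cmod (indicator S t *\<^sub>R deriv f t))\<^sup>2) \<in> borel_measurable borel"
    using borel_measurable_deriv_indicator[OF S f(1)] A(1) by measurable
  also have "(\<lambda>t. indicator A t * (cmod (indicator S t *\<^sub>R deriv f t))\<^sup>2)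
      = (\<lambda>t. indicator A t * (cmod (deriv f t))\<^sup>2)"
    using A(2) by (auto simp: fun_eq_iff split: split_indicator)
  finally show mJ [measurable]: "(\<lambda>t. indicator A t * (cmod (deriv f t))\<^sup>2) \<in> borel_measurable borel" .
  show "distr (density lborel (\<lambda>t. ennreal (indicator A t * (cmod (deriv f t))\<^sup>2))) borel
           (\<lambda>t. indicator S t *\<^sub>R f t)
       = density lborel (indicator (f ` A))" (is "?M = ?N")
  proof (rule measure_eqI)
    fix B assume "B \<in> sets ?M"
    then have B: "B \<in> sets borel" by simp
    define C where "C = A \<inter> (\<lambda>t. indicator S t *\<^sub>R f t) -` B"
    have "(\<lambda>t. indicator S t *\<^sub>R f t) -` B \<in> sets borel"
      using measurable_sets[OF mf B] by simp
    then have C: "C \<in> sets borel" "C \<subseteq> S"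
      using A by (auto simp: C_def)
    have im: "f ` C = f ` A \<inter> B"
      using A(2) by (auto simp: C_def indicator_def subset_iff)
    have "emeasure ?M B = (\<integral>\<^sup>+t\<in>(\<lambda>t. indicator S t *\<^sub>R f t) -` B.
        ennreal (indicator A t * (cmod (deriv f t))\<^sup>2) \<partial>lborel)"
      using B measurable_sets[OF mf B] by (simp add: emeasure_distr emeasure_density)
    also have "\<dots> = (\<integral>\<^sup>+t\<in>C. ennreal ((cmod (deriv f t))\<^sup>2) \<partial>lborel)"
      by (intro nn_integral_cong) (auto simp: C_def split: split_indicator)
    also have "\<dots> = emeasure lborel (f ` A \<inter> B)"
      using emeasure_holomorphic_inj_image[OF S f C] im by simp
    also have "\<dots> = emeasure ?N B"
      using B fA by (simp add: emeasure_density nn_integral_indicator flip: indicator_inter_arith)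
    finally show "emeasure ?M B = emeasure ?N B" .
  qed simp
qed

lemma nn_integral_holomorphic_inj:
  assumes S: "open S" and f: "f holomorphic_on S" "inj_on f S" and A: "A \<in> sets borel" "A \<subseteq> S"
    and h [measurable]: "h \<in> borel_measurable borel"
  shows "(\<integral>\<^sup>+t\<in>A. h (f t) * ennreal ((cmod (deriv f t))\<^sup>2) \<partial>lborel) = (\<integral>\<^sup>+y\<in>f ` A. h y \<partial>lborel)"
proof -
  note D = distr_density_holomorphic_inj[OF S f A]
  note [measurable] = D(2,3) sets_borel_holomorphic_inj_image[OF S f A]
  have "(\<integral>\<^sup>+y\<in>f ` A. h y \<partial>lborel) = nn_integral (density lborel (indicator (f ` A))) h"
    by (subst nn_integral_density) (auto simp: mult.commute)
  also have "\<dots> = (\<integral>\<^sup>+t. ennreal (indicator A t * (cmod (deriv f t))\<^sup>2) * h (indicator S t *\<^sub>R f t) \<partial>lborel)"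
    by (simp add: D(1)[symmetric] nn_integral_distr nn_integral_density)
  also have "\<dots> = (\<integral>\<^sup>+t\<in>A. h (f t) * ennreal ((cmod (deriv f t))\<^sup>2) \<partial>lborel)"
    using A(2) by (intro nn_integral_cong) (auto simp: mult.commute split: split_indicator)
  finally show ?thesis by simp
qed

lemma set_integral_holomorphic_inj:
  fixes g :: "complex \<Rightarrow> complex"
  assumes S: "open S" and f: "f holomorphic_on S" "inj_on f S"
    and g: "set_integrable lborel (f ` S) g"
  shows "set_integrable lborel S (\<lambda>t. (cmod (deriv f t))\<^sup>2 *\<^sub>R g (f t))"
    and "(LINT t:S|lborel. (cmod (deriv f t))\<^sup>2 *\<^sub>R g (f t)) = (LINT y:f ` S|lborel. g y)"
proof -
  have A: "S \<in> sets borel" "S \<subseteq> S" using S by auto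
  note D = distr_density_holomorphic_inj[OF S f A]
  note [measurable] = D(2,3) sets_borel_holomorphic_inj_image[OF S f A]
  define G where "G = (\<lambda>y. indicator (f ` S) y *\<^sub>R g y)"
  have Gi: "integrable lborel G"
    using g by (simp add: G_def set_integrable_def)
  then have [measurable]: "G \<in> borel_measurable borel"
    by auto
  have IG: "(\<lambda>y. indicator (f ` S) y *\<^sub>R G y) = G"
    by (auto simp: G_def fun_eq_iff split: split_indicator)
  have eq: "(\<lambda>t. (indicator S t * (cmod (deriv f t))\<^sup>2) *\<^sub>R G (indicator S t *\<^sub>R f t))
      = (\<lambda>t. indicator S t *\<^sub>R ((cmod (deriv f t))\<^sup>2 *\<^sub>R g (f t)))"
    by (auto simp: fun_eq_iff G_def split: split_indicator)
  have "integrable (density lborel (\<lambda>y. ennreal (indicator (f ` S) y))) G"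
    by (subst integrable_density) (auto simp: IG Gi)
  then have 1: "integrable (density lborel (indicator (f ` S))) G"
    by (simp add: ennreal_indicator)
  have "integral\<^sup>L (density lborel (\<lambda>y. ennreal (indicator (f ` S) y))) G = integral\<^sup>L lborel G"
    by (subst integral_density) (auto simp: IG)
  then have 2: "integral\<^sup>L (density lborel (indicator (f ` S))) G = integral\<^sup>L lborel G"
    by (simp add: ennreal_indicator)
  show "set_integrable lborel S (\<lambda>t. (cmod (deriv f t))\<^sup>2 *\<^sub>R g (f t))"
    using 1 unfolding D(1)[symmetric] set_integrable_def eq[symmetric]
    by (subst (asm) integrable_distr_eq; simp?) (subst (asm) integrable_density; simp)
  have "integral\<^sup>L (density lborel (indicator (f ` S))) G
     = (LINT t|lborel. (indicator S t * (cmod (deriv f t))\<^sup>2) *\<^sub>R G (indicator S t *\<^sub>R f t))"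
    unfolding D(1)[symmetric]
    by (subst integral_distr; simp?) (subst integral_density; simp)
  then show "(LINT t:S|lborel. (cmod (deriv f t))\<^sup>2 *\<^sub>R g (f t)) = (LINT y:f ` S|lborel. g y)"
    unfolding eq using 2 by (simp add: set_lebesgue_integral_def G_def)
qed

section \<open>Substitution by a polynomial in one complex variable\<close>

lemma card_roots_rsquarefree:
  fixes p :: "complex poly"
  assumes "rsquarefree p"
  shows "card {t. poly p t = 0} = degree p"
proof -
  have "p \<noteq> 0" using assms by (auto simp: rsquarefree_def)
  have "degree p = degree (Polynomial.smult (lead_coeff p) (\<Prod>z|poly p z = 0. [:- z, 1:]))"
    using complex_poly_decompose_rsquarefree[OF assms] by simp
  also have "\<dots> = (\<Sum>z|poly p z = 0. degree [:- z, 1:])"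
    using \<open>p \<noteq> 0\<close> by (simp add: degree_prod_eq_sum_degree)
  finally show ?thesis by simp
qed

text \<open>Away from finitely many points \<open>p\<close> is locally injective, so the plane is
  cut into countably many disjoint Borel pieces on which the injective substitution applies. Almost
  every value is taken exactly \<open>degree p\<close> times, and summing over the pieces counts
  these preimages.\<close>

lemma nn_integral_poly_substitution:
  fixes p :: "complex poly" and h :: "complex \<Rightarrow> ennreal"
  assumes deg: "degree p > 0" and h [measurable]: "h \<in> borel_measurable borel"
  shows "(\<integral>\<^sup>+t. h (poly p t) * ennreal ((cmod (poly (pderiv p) t))\<^sup>2) \<partial>lborel)
    = of_nat (degree p) * (\<integral>\<^sup>+y. h y \<partial>lborel)"
proof -
  \<comment> \<open>\<open>V\<close> is the set of critical values. Its full preimage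
    \<open>Z\<close> is removed, not only the critical points, so that every preimage of a value
    outside \<open>V\<close> lies in \<open>U\<close>.\<close>
  define V where "V = poly p ` {t. poly (pderiv p) t = 0}"
  define Z where "Z = {t. poly p t \<in> V}"
  have "pderiv p \<noteq> 0" using deg by (simp add: pderiv_eq_0_iff)
  then have finV: "finite V" unfolding V_def by (intro finite_imageI poly_roots_finite)
  have fr: "finite {t. poly p t = y}" for y
  proof -
    have "p - [:y:] \<noteq> 0" using deg by auto
    from poly_roots_finite[OF this] show ?thesis by simp
  qed
  have "Z = (\<Union>y\<in>V. {t. poly p t = y})" by (auto simp: Z_def)
  then have finZ: "finite Z" using finV fr by simp
  define U where "U = - Z"
  have U: "open U" unfolding U_def using finZ by (simp add: open_Compl finite_imp_closed)
  have der: "deriv (poly p) = poly (pderiv p)"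
    by (rule ext, rule DERIV_imp_deriv) (rule poly_DERIV)
  have hol: "poly p holomorphic_on S" for S
    by (intro holomorphic_intros)
  have loc: "\<exists>r>0. inj_on (poly p) (ball t r)" if "t \<in> U" for t
  proof -
    have "deriv (poly p) t \<noteq> 0" using that by (auto simp: U_def Z_def V_def der)
    then show ?thesis
      using has_complex_derivative_locally_injective[OF hol UNIV_I open_UNIV] by blast
  qed
  define \<F> where "\<F> = {B. open B \<and> B \<subseteq> U \<and> inj_on (poly p) B}"
  have "\<Union>\<F> = U"
  proof -
    have "t \<in> \<Union>\<F>" if t: "t \<in> U" for t
    proof -
      obtain r where "r > 0" "inj_on (poly p) (ball t r)" using loc[OF t] by auto
      then have "ball t r \<inter> U \<in> \<F>"
        using U by (auto simp: \<F>_def intro: inj_on_subset)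
      then show ?thesis using t \<open>r > 0\<close> by (intro UnionI[of "ball t r \<inter> U"]) auto
    qed
    then show ?thesis by (auto simp: \<F>_def)
  qed
  then obtain \<F>' where F': "\<F>' \<subseteq> \<F>" "countable \<F>'" "\<Union>\<F>' = U"
    using Lindelof[of \<F>] unfolding \<F>_def by (metis (no_types, lifting) mem_Collect_eq)
  \<comment> \<open>Adding the empty set guarantees a nonempty countable family, which
    \<open>from_nat_into\<close> can enumerate.\<close>
  define W where "W = from_nat_into (insert {} \<F>')"
  have rW: "range W = insert {} \<F>'"
    using F'(2) unfolding W_def by (intro range_from_nat_into) auto
  have W: "open (W i)" "W i \<subseteq> U" "inj_on (poly p) (W i)" for i
  proof -
    have "W i \<in> insert {} \<F>'" using rW by blast
    then show "open (W i)" "W i \<subseteq> U" "inj_on (poly p) (W i)"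
      using F'(1) by (auto simp: \<F>_def)
  qed
  have UW: "(\<Union>i. W i) = U"
    using rW F'(3) by (metis Union_insert Un_empty_left)
  define A where "A = disjointed W"
  have AW: "A i \<subseteq> W i" for i unfolding A_def by (rule disjointed_subset)
  have Ab [measurable]: "A i \<in> sets borel" for i
  proof -
    have "range W \<subseteq> sets borel" using W(1) by auto
    from sets.range_disjointed_sets[OF this] show ?thesis by (auto simp: A_def)
  qed
  have dA: "disjoint_family A" unfolding A_def by (rule disjoint_family_disjointed)
  have UA: "(\<Union>i. A i) = U" unfolding A_def UN_disjointed_eq UW ..
  have pA [measurable]: "poly p ` A i \<in> sets borel" for i
    using sets_borel_holomorphic_inj_image[OF W(1) hol W(3) Ab AW] .
  have mp: "poly q \<in> borel_measurable borel" for q :: "complex poly"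
    by (intro borel_measurable_continuous_onI continuous_intros)
  note [measurable] = mp[of p] mp[of "pderiv p"]
  define H where "H = (\<lambda>t. h (poly p t) * ennreal ((cmod (poly (pderiv p) t))\<^sup>2))"
  have Hm [measurable]: "H \<in> borel_measurable borel"
    unfolding H_def by measurable
  have "AE t in lborel. t \<notin> Z"
    using finZ by (intro AE_not_in) (simp add: null_sets_def emeasure_lborel_countable countable_finite borel_closed finite_imp_closed)
  then have "(\<integral>\<^sup>+t. H t \<partial>lborel) = (\<integral>\<^sup>+t\<in>(\<Union>i. A i). H t \<partial>lborel)"
    unfolding UA by (intro nn_integral_cong_AE) (auto simp: U_def split: split_indicator)
  also have "\<dots> = (\<Sum>i. \<integral>\<^sup>+t\<in>A i. H t \<partial>lborel)"
    by (intro nn_integral_disjoint_family dA) auto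
  also have "\<dots> = (\<Sum>i. \<integral>\<^sup>+y\<in>poly p ` A i. h y \<partial>lborel)"
    using nn_integral_holomorphic_inj[OF W(1) hol W(3) Ab AW h]
    by (simp add: H_def der)
  also have "\<dots> = (\<integral>\<^sup>+y. (\<Sum>i. h y * indicator (poly p ` A i) y) \<partial>lborel)"
    by (subst nn_integral_suminf) auto
  also have "\<dots> = (\<integral>\<^sup>+y. of_nat (degree p) * h y \<partial>lborel)"
  proof (rule nn_integral_cong_AE)
    have "AE y in lborel. y \<notin> V"
      using finV by (intro AE_not_in) (simp add: null_sets_def emeasure_lborel_countable countable_finite borel_closed finite_imp_closed)
    then show "AE y in lborel. (\<Sum>i. h y * indicator (poly p ` A i) y) = of_nat (degree p) * h y"
    proof eventually_elim
      case (elim y)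
      define R where "R = {t. poly p t = y}"
      have finR: "finite R" using fr by (simp add: R_def)
      have RU: "R \<subseteq> U" using elim by (auto simp: R_def U_def Z_def)
      \<comment> \<open>A noncritical value \<open>y\<close> is one for which \<open>p - y\<close>
        and \<open>p'\<close> have no common root.\<close>
      have "rsquarefree (p - [:y:])"
        using elim by (auto simp: rsquarefree_roots pderiv_diff pderiv_pCons V_def)
      then have "card {t. poly (p - [:y:]) t = 0} = degree (p - [:y:])"
        by (rule card_roots_rsquarefree)
      moreover have "degree (p - [:y:]) = degree p"
        proof -
        have "p - [:y:] = p + [:- y:]" by simp
        show ?thesis
          unfolding \<open>p - [:y:] = p + [:- y:]\<close> using deg by (intro degree_add_eq_left) simp
      qed
      ultimately have cR: "card R = degree p" by (simp add: R_def)
      \<comment> \<open>By injectivity a piece contains at most one preimage of \<open>y\<close>, so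
        the indicator of its image counts the preimages lying in it.\<close>
      have ind: "indicator (poly p ` A i) y = (\<Sum>t\<in>R. indicator (A i) t :: ennreal)" for i
      proof (cases "y \<in> poly p ` A i")
        case True
        then obtain t where t: "t \<in> A i" "poly p t = y" by auto
        have "R \<inter> A i = {t}"
          using t W(3)[of i] AW[of i] by (auto simp: R_def inj_on_def)
        then show ?thesis using True finR
          by (simp add: indicator_def sum.If_cases)
      next
        case False
        then have "R \<inter> A i = {}" by (auto simp: R_def)
        then show ?thesis using False finR by (simp add: indicator_def sum.If_cases)
      qed
      have "(\<Sum>i. h y * indicator (poly p ` A i) y) = h y * (\<Sum>i. \<Sum>t\<in>R. indicator (A i) t)"
        unfolding ind by (rule ennreal_suminf_cmult)
      also have "(\<Sum>i. \<Sum>t\<in>R. indicator (A i) t :: ennreal) = (\<Sum>t\<in>R. \<Sum>i. indicator (A i) t)"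
        by (rule suminf_sum) auto
      also have "\<dots> = (\<Sum>t\<in>R. 1)"
        using RU by (intro sum.cong refl) (auto simp: suminf_indicator[OF dA] UA)
      finally show ?case using cR by (simp add: mult.commute)
    qed
  qed
  also have "\<dots> = of_nat (degree p) * (\<integral>\<^sup>+y. h y \<partial>lborel)"
    by (rule nn_integral_cmult) simp
  finally show ?thesis by (simp add: H_def)
qed

section \<open>The Bergman kernel of the disc\<close>

text \<open>Cauchy's formula at 0 for \<open>u\<close> mapped to \<open>g (u * t)\<close>, which is
  holomorphic on the closed unit disc because \<open>t\<close> lies strictly inside.\<close>

lemma circle_mean_value:
  assumes g: "g holomorphic_on ball 0 1" and t: "cmod t < 1"
  shows "set_integrable lborel {0..1::real} (\<lambda>x. g (exp (2 * pi * \<i> * x) * t))"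
    and "(LINT x:{0..1::real}|lborel. g (exp (2 * pi * \<i> * x) * t)) = g 0"
proof -
  have lt: "cmod (u * t) < 1" if "cmod u \<le> 1" for u
    using that t by (metis mult_left_le_one_le norm_ge_zero norm_mult order_le_less_trans)
  have cont: "continuous_on {0..1::real} (\<lambda>x. g (exp (2 * pi * \<i> * x) * t))"
    by (intro continuous_on_compose2[OF holomorphic_on_imp_continuous_on[OF g]] continuous_intros)
       (auto intro!: lt)
  show int: "set_integrable lborel {0..1::real} (\<lambda>x. g (exp (2 * pi * \<i> * x) * t))"
    using borel_integrable_atLeastAtMost'[OF cont] .
  have "(\<lambda>u. g (u * t)) holomorphic_on cball 0 1"
    by (intro holomorphic_on_compose_gen[OF _ g, unfolded o_def] holomorphic_intros) (auto intro!: lt)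
  then have "((\<lambda>u. g (u * t) / (u - 0)) has_contour_integral 2 * of_real pi * \<i> * g (0 * t)) (circlepath 0 1)"
    by (rule Cauchy_integral_circlepath_simple) auto
  then have "((\<lambda>x. g (circlepath 0 1 x * t) / circlepath 0 1 x *
      vector_derivative (circlepath 0 1) (at x within {0..1})) has_integral 2 * of_real pi * \<i> * g 0) {0..1}"
    by (simp add: has_contour_integral_def)
  then have "((\<lambda>x::real. 2 * of_real pi * \<i> * g (exp (2 * pi * \<i> * x) * t)) has_integral 2 * of_real pi * \<i> * g 0) {0..1}"
  proof (rule has_integral_eq[rotated])
    fix x :: real assume "x \<in> {0..1}"
    then have "vector_derivative (circlepath 0 1) (at x within {0..1}) = 2 * pi * \<i> * exp (2 * pi * \<i> * x)"
      by (subst vector_derivative_circlepath01) (auto simp: mult_ac)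
    moreover have "circlepath 0 1 x = exp (2 * pi * \<i> * x)"
      by (simp add: circlepath mult_ac)
    ultimately show "g (circlepath 0 1 x * t) / circlepath 0 1 x *
      vector_derivative (circlepath 0 1) (at x within {0..1}) = 2 * of_real pi * \<i> * g (exp (2 * pi * \<i> * x) * t)"
      by simp
  qed
  then have "((\<lambda>x::real. g (exp (2 * pi * \<i> * x) * t)) has_integral g 0) {0..1}"
    by (subst (asm) has_integral_mult_right_iff) auto
  then show "(LINT x:{0..1::real}|lborel. g (exp (2 * pi * \<i> * x) * t)) = g 0"
    using set_borel_integral_eq_integral(2)[OF int] by (simp add: integral_unique)
qed

text \<open>Averaging over rotations takes the place of polar coordinates: the integral over the
  disc is rotation invariant, hence equals its average over all angles. After Fubini the inner
  integral is the mean over a circle, which is \<open>g 0\<close>, and the disc has area pi.\<close>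

lemma disc_mean_value:
  assumes g: "g holomorphic_on ball 0 1" and gi: "set_integrable lborel (ball 0 1) g"
  shows "(LINT t:ball 0 1|lborel. g t) = of_real pi * g 0"
proof -
  let ?D = "ball 0 1 :: complex set"
  define e where "e = (\<lambda>x::real. exp (2 * pi * \<i> * x))"
  have ne: "cmod (e x) = 1" for x by (simp add: e_def)
  have e0: "e x \<noteq> 0" for x by (simp add: e_def)
  define G where "G = (\<lambda>y. indicator ?D y *\<^sub>R g y)"
  have Gi: "integrable lborel G" using gi by (simp add: G_def set_integrable_def)
  then have Gm [measurable]: "G \<in> borel_measurable borel" by auto
  have em [measurable]: "e \<in> borel_measurable borel"
    unfolding e_def by (intro borel_measurable_continuous_onI continuous_intros)
  have img: "(*) (e x) ` ?D = ?D" for x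
  proof -
    have "y \<in> (*) (e x) ` ?D" if "cmod y < 1" for y
      using that ne[of x] e0[of x] by (intro image_eqI[of _ _ "y / e x"]) (auto simp: norm_divide)
    then show ?thesis by (auto simp: norm_mult ne)
  qed
  have dr: "deriv ((*) (e x)) t = e x" for x t
    by (rule DERIV_imp_deriv) (auto intro!: derivative_eq_intros)
  have rot: "set_integrable lborel ?D (\<lambda>t. g (e x * t))"
    "(LINT t:?D|lborel. g (e x * t)) = (LINT t:?D|lborel. g t)" for x
    using set_integral_holomorphic_inj[of ?D "(*) (e x)" g] gi e0[of x]
    by (auto simp: img dr ne inj_on_def intro!: holomorphic_intros)
  have rotG: "indicator ?D t *\<^sub>R g (e x * t) = G (e x * t)" for x t
    by (simp add: G_def indicator_def norm_mult ne)
  \<comment> \<open>The norm integral does not depend on the angle, which bounds the double integral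
    and justifies Fubini.\<close>
  have rotn: "(\<integral>\<^sup>+t. norm (G (e x * t)) \<partial>lborel) = (\<integral>\<^sup>+t. norm (G t) \<partial>lborel)" for x
  proof -
    have 1: "range ((*) (e x)) = UNIV"
      by (rule surjI[of _ "\<lambda>y. y / e x"]) (simp add: e0)
    have 2: "(*) (e x) holomorphic_on UNIV" by (intro holomorphic_intros)
    have 3: "inj ((*) (e x))" by (simp add: inj_on_def e0)
    show ?thesis
      using nn_integral_holomorphic_inj[OF open_UNIV 2 3, of UNIV "\<lambda>t. ennreal (norm (G t))"]
      by (simp add: dr ne 1)
  qed
  define H where "H = (\<lambda>x t. indicator {0..1::real} x *\<^sub>R G (e x * t))"
  have Hm: "case_prod H \<in> borel_measurable (lborel \<Otimes>\<^sub>M lborel)"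
    unfolding H_def case_prod_beta' by measurable
  have Hi: "integrable (lborel \<Otimes>\<^sub>M lborel) (case_prod H)"
  proof (rule integrableI_bounded[OF Hm])
    have "(\<integral>\<^sup>+z. norm (case_prod H z) \<partial>(lborel \<Otimes>\<^sub>M lborel)) = (\<integral>\<^sup>+x. \<integral>\<^sup>+t. norm (H x t) \<partial>lborel \<partial>lborel)"
      using Hm by (subst lborel.nn_integral_fst[symmetric]) auto
    also have "\<dots> = (\<integral>\<^sup>+x. indicator {0..1::real} x * (\<integral>\<^sup>+t. norm (G t) \<partial>lborel) \<partial>lborel)"
    proof (intro nn_integral_cong)
      fix x :: real
      show "(\<integral>\<^sup>+t. norm (H x t) \<partial>lborel) = indicator {0..1::real} x * (\<integral>\<^sup>+t. norm (G t) \<partial>lborel)"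
        by (cases "x \<in> {0..1}") (simp_all add: H_def rotn)
    qed
    also have "\<dots> = (\<integral>\<^sup>+t. norm (G t) \<partial>lborel)"
      by (subst nn_integral_multc) auto
    also have "\<dots> < \<infinity>" using Gi by (simp add: integrable_iff_bounded)
    finally show "(\<integral>\<^sup>+z. norm (case_prod H z) \<partial>(lborel \<Otimes>\<^sub>M lborel)) < \<infinity>" .
  qed
  have inner: "(LINT t|lborel. G (e x * t)) = (LINT t:?D|lborel. g t)" for x
    unfolding rot(2)[of x, symmetric] by (simp add: set_lebesgue_integral_def rotG)
  have "(LINT x|lborel. LINT t|lborel. H x t) = (LINT x:{0..1::real}|lborel. (LINT t:?D|lborel. g t))"
    unfolding set_lebesgue_integral_def[of _ "{0..1}"]
    by (intro Bochner_Integration.integral_cong refl)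
       (auto simp: H_def inner split: split_indicator)
  also have "\<dots> = (LINT t:?D|lborel. g t)"
    by (simp add: set_lebesgue_integral_def)
  finally have 1: "(LINT x|lborel. LINT t|lborel. H x t) = (LINT t:?D|lborel. g t)" .
  have "(LINT t|lborel. LINT x|lborel. H x t) = (LINT t:?D|lborel. g 0)"
    unfolding set_lebesgue_integral_def[of _ ?D]
  proof (intro Bochner_Integration.integral_cong refl)
    fix t
    show "(LINT x|lborel. H x t) = indicator ?D t *\<^sub>R g 0"
    proof (cases "t \<in> ?D")
      case True
      have "(LINT x|lborel. H x t) = (LINT x:{0..1::real}|lborel. g (e x * t))"
        unfolding set_lebesgue_integral_def using True
        by (intro Bochner_Integration.integral_cong refl) (simp add: H_def rotG[symmetric])
      then show ?thesis using circle_mean_value(2)[OF g, of t] True by (simp add: e_def)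
    next
      case False
      then show ?thesis by (simp add: H_def rotG[symmetric])
    qed
  qed
  also have "\<dots> = of_real pi * g 0"
  proof -
    have "measure lborel ?D = pi" by (simp add: content_ball unit_ball_vol_2)
    moreover have "emeasure lborel ?D < \<infinity>" by (rule emeasure_lborel_ball_finite)
    ultimately show ?thesis
      by (subst set_integral_const) (auto simp: scaleR_conv_of_real)
  qed
  finally show ?thesis using 1 lborel_pair.Fubini_integral[OF Hi] by simp
qed

lemma one_minus_mult_nonzero:
  fixes a b :: complex
  assumes "cmod a < 1" "cmod b < 1"
  shows "1 - a * b \<noteq> 0"
proof
  assume "1 - a * b = 0"
  then have "cmod (a * b) = 1" by (metis eq_iff_diff_eq_0 norm_one)
  moreover have "cmod (a * b) < 1" using norm_mult_less[OF assms] by simp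
  ultimately show False by simp
qed

text \<open>Substitute the Moebius involution that exchanges 0 and \<open>b\<close>. The Jacobian
  cancels the antiholomorphic part of the kernel and leaves a holomorphic integrand whose value at 0
  is \<open>g b\<close>, so the mean value property finishes. Integrability is the right hypothesis
  for later use, since Fubini passes it to almost every slice of a function of several
  variables.\<close>

lemma disc_reproducing:
  assumes g: "g holomorphic_on ball 0 1" and gi: "set_integrable lborel (ball 0 1) g"
    and b: "cmod b < 1"
  shows "(LINT t:ball 0 1|lborel. g t / (1 - b * cnj t)\<^sup>2) = of_real pi * g b"
proof -
  let ?D = "ball 0 1 :: complex set"
  define \<phi> where "\<phi> s = (b - s) / (1 - cnj b * s)" for s
  have b': "cmod (cnj b) < 1" using b by simp
  have nz: "1 - cnj b * s \<noteq> 0" if "s \<in> ?D" for s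
    using one_minus_mult_nonzero[OF b', of s] that by simp
  have nz': "1 - b * cnj s \<noteq> 0" if "s \<in> ?D" for s
    using one_minus_mult_nonzero[OF b, of "cnj s"] that by simp
  have nb: "1 - b * cnj b \<noteq> 0" using one_minus_mult_nonzero[OF b b'] .
  have phi_M: "\<phi> s = - Moebius_function 0 b s" for s
    by (simp add: \<phi>_def Moebius_function_simple minus_divide_left)
  have phi_D: "\<phi> s \<in> ?D" if "s \<in> ?D" for s
    using Moebius_function_norm_lt_1[OF b, where z = s and t = 0] that by (simp add: phi_M)
  have hol: "\<phi> holomorphic_on ?D"
    using nz unfolding \<phi>_def[abs_def] by (intro holomorphic_intros) auto
  have invol: "\<phi> (\<phi> s) = s" if "s \<in> ?D" for s
  proof -
    have "1 - cnj b * \<phi> s = (1 - b * cnj b) / (1 - cnj b * s)" "b - \<phi> s = s * (1 - b * cnj b) / (1 - cnj b * s)"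
      using nz[OF that] by (simp_all add: \<phi>_def field_simps)
    then show ?thesis using nb nz[OF that] unfolding \<phi>_def[of "\<phi> s"] by simp
  qed
  have inj: "inj_on \<phi> ?D" by (rule inj_on_inverseI[of _ \<phi>]) (rule invol)
  have img: "\<phi> ` ?D = ?D" using phi_D invol by (auto simp: image_iff) (metis mem_ball_0)
  have dphi: "deriv \<phi> s = (b * cnj b - 1) / (1 - cnj b * s)\<^sup>2" if "s \<in> ?D" for s
    using nz[OF that] unfolding \<phi>_def[abs_def]
    by (intro DERIV_imp_deriv) (auto intro!: derivative_eq_intros simp: power2_eq_square field_simps)
  define G where "G = (\<lambda>t. g t / (1 - b * cnj t)\<^sup>2)"
  \<comment> \<open>With \<open>u = 1 - cnj b * s\<close> and \<open>N = 1 - b * cnj b\<close>, the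
    derivative is \<open>- N / u^2\<close> and the kernel denominator becomes
    \<open>(N / cnj u)^2\<close>; the powers of \<open>N\<close> and of \<open>cnj u\<close>
    cancel.\<close>
  have key: "(cmod (deriv \<phi> s))\<^sup>2 *\<^sub>R G (\<phi> s) = g (\<phi> s) / (1 - cnj b * s)\<^sup>2" if s: "s \<in> ?D" for s
  proof -
    define u where "u = 1 - cnj b * s"
    define N where "N = 1 - b * cnj b"
    have "u \<noteq> 0" using nz[OF s] by (simp add: u_def)
    then have u: "u \<noteq> 0" "cnj u \<noteq> 0" by simp_all
    have N: "N \<noteq> 0" "cnj N = N" using nb by (auto simp: N_def)
    have "1 - b * cnj (\<phi> s) = N / cnj u"
    proof -
      have "cnj (\<phi> s) = (cnj b - cnj s) / cnj u" by (simp add: \<phi>_def u_def)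
      then have "cnj (\<phi> s) * cnj u = cnj b - cnj s"
        using u by simp
      then have "(1 - b * cnj (\<phi> s)) * cnj u = cnj u - b * (cnj b - cnj s)"
        by (simp add: left_diff_distrib mult.assoc)
      also have "\<dots> = N" by (simp add: u_def N_def algebra_simps)
      finally show ?thesis using u by (simp add: field_simps)
    qed
    moreover have "complex_of_real ((cmod (deriv \<phi> s))\<^sup>2) = N\<^sup>2 / (u\<^sup>2 * (cnj u)\<^sup>2)"
    proof -
      have "deriv \<phi> s = - N / u\<^sup>2" using dphi[OF s] by (simp add: N_def u_def)
      moreover have "complex_of_real ((cmod (deriv \<phi> s))\<^sup>2) = deriv \<phi> s * cnj (deriv \<phi> s)"
        by (rule complex_norm_square)
      ultimately show ?thesis
        using N by (simp add: power2_eq_square)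
    qed
    ultimately have "(cmod (deriv \<phi> s))\<^sup>2 *\<^sub>R G (\<phi> s) = N\<^sup>2 / (u\<^sup>2 * (cnj u)\<^sup>2) * (g (\<phi> s) / (N / cnj u)\<^sup>2)"
      by (simp add: scaleR_conv_of_real G_def)
    also have "\<dots> = g (\<phi> s) / u\<^sup>2"
      using u N(1) by (simp add: power_divide)
    finally show ?thesis by (simp add: u_def)
  qed
  \<comment> \<open>For fixed \<open>b\<close> the kernel is bounded on the disc, by
    \<open>1 / (1 - cmod b)^2\<close>.\<close>
  have Gi: "set_integrable lborel ?D G"
  proof -
    define C where "C = 1 / (1 - cmod b)\<^sup>2"
    have C: "cmod (G t) \<le> C * cmod (g t)" if "t \<in> ?D" for t
    proof -
      have "cmod (b * cnj t) \<le> cmod b"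
        using that by (simp add: norm_mult mult_left_le)
      then have "1 - cmod b \<le> cmod (1 - b * cnj t)"
        using norm_triangle_ineq2[of 1 "b * cnj t"] by simp
      then have "(1 - cmod b)\<^sup>2 \<le> (cmod (1 - b * cnj t))\<^sup>2"
        using b by (intro power_mono) auto
      then have "cmod (g t) / (cmod (1 - b * cnj t))\<^sup>2 \<le> cmod (g t) / (1 - cmod b)\<^sup>2"
        using b by (intro divide_left_mono) (auto intro!: mult_pos_pos simp: nz'[OF that])
      then show ?thesis by (simp add: G_def C_def norm_divide norm_power)
    qed
    have "set_integrable lborel ?D (\<lambda>t. C *\<^sub>R g t)" using gi by (intro set_integrable_scaleR_right) auto
    moreover have "set_borel_measurable lborel ?D G"
    proof -
      have "continuous_on ?D G"
        unfolding G_def using nz' holomorphic_on_imp_continuous_on[OF g]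
        by (intro continuous_intros) auto
      then show ?thesis
        unfolding set_borel_measurable_def
        by (auto intro!: borel_measurable_continuous_on_indicator)
    qed
    ultimately show ?thesis
    proof (rule set_integrable_bound)
      show "AE t in lborel. t \<in> ?D \<longrightarrow> norm (G t) \<le> norm (C *\<^sub>R g t)"
        using C by (intro AE_I2) (simp add: C_def)
    qed
  qed
  note T = set_integral_holomorphic_inj[OF open_ball hol inj, unfolded img, OF Gi]
  have "set_integrable lborel ?D (\<lambda>s. g (\<phi> s) / (1 - cnj b * s)\<^sup>2)"
    using T(1) by (rule set_integrable_cong[THEN iffD1, rotated -1]) (auto simp: key)
  moreover have "(\<lambda>s. g (\<phi> s) / (1 - cnj b * s)\<^sup>2) holomorphic_on ?D"
    using nz phi_D
    by (intro holomorphic_on_divide holomorphic_on_compose_gen[OF hol g, unfolded o_def] holomorphic_intros) auto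
  ultimately have "(LINT s:?D|lborel. g (\<phi> s) / (1 - cnj b * s)\<^sup>2) = of_real pi * g b"
    by (subst disc_mean_value) (auto simp: \<phi>_def)
  moreover have "(LINT s:?D|lborel. g (\<phi> s) / (1 - cnj b * s)\<^sup>2) = (LINT t:?D|lborel. G t)"
    unfolding T(2)[symmetric] by (intro set_lebesgue_integral_cong) (auto simp: key)
  ultimately show ?thesis by (simp add: G_def)
qed

section \<open>Change of variables for the symmetrization map\<close>

lemma elem_sym_0 [simp]: "elem_sym n 0 l = 1"
proof -
  have "{S. S \<subseteq> {..<n} \<and> card S = 0} = {{}}"
    using finite_subset[of _ "{..<n}"] by auto
  then show ?thesis by (simp add: elem_sym_def)
qed

lemma elem_sym_eq_0:
  assumes "n < k"
  shows "elem_sym n k l = 0"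
proof -
  have e: "{S. S \<subseteq> {..<n} \<and> card S = k} = {}"
  proof -
    have "\<not> (S \<subseteq> {..<n} \<and> card S = k)" for S
      using card_mono[of "{..<n}" S] assms by auto
    then show ?thesis by blast
  qed
  show ?thesis unfolding elem_sym_def e by simp
qed

lemma elem_sym_cong:
  assumes "\<And>j. j < n \<Longrightarrow> l j = l' j"
  shows "elem_sym n k l = elem_sym n k l'"
  unfolding elem_sym_def using assms by (intro sum.cong prod.cong) auto

lemma elem_sym_Suc:
  "elem_sym (Suc n) (Suc k) l = elem_sym n (Suc k) l + l n * elem_sym n k l"
proof -
  let ?A = "{S. S \<subseteq> {..<n} \<and> card S = Suc k}" and ?B = "{S. S \<subseteq> {..<n} \<and> card S = k}"
  have split: "{S. S \<subseteq> {..<Suc n} \<and> card S = Suc k} = ?A \<union> insert n ` ?B"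
  proof (intro equalityI subsetI)
    fix S assume S: "S \<in> {S. S \<subseteq> {..<Suc n} \<and> card S = Suc k}"
    then have fin: "finite S" by (auto intro: finite_subset)
    show "S \<in> ?A \<union> insert n ` ?B"
    proof (cases "n \<in> S")
      case True
      then have "S = insert n (S - {n})" "S - {n} \<in> ?B"
        using S fin by (auto simp: lessThan_Suc)
      then show ?thesis by blast
    next
      case False
      then show ?thesis using S by (auto simp: lessThan_Suc)
    qed
  next
    fix S assume "S \<in> ?A \<union> insert n ` ?B"
    then show "S \<in> {S. S \<subseteq> {..<Suc n} \<and> card S = Suc k}"
    proof
      assume "S \<in> insert n ` ?B"
      then obtain T where T: "T \<subseteq> {..<n}" "card T = k" "S = insert n T" by auto
      then have "finite T" "n \<notin> T" by (auto intro: finite_subset)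
      then show ?thesis using T by (auto simp: lessThan_Suc)
    qed (auto simp: lessThan_Suc)
  qed
  have inj: "inj_on (insert n) ?B"
  proof (rule inj_onI)
    fix S T assume "S \<in> ?B" "T \<in> ?B" and eq: "insert n S = insert n T"
    then have "n \<notin> S" "n \<notin> T" by auto
    then show "S = T" using eq by (simp add: insert_ident)
  qed
  have "elem_sym (Suc n) (Suc k) l = (\<Sum>S\<in>?A. \<Prod>j\<in>S. l j) + (\<Sum>S\<in>insert n ` ?B. \<Prod>j\<in>S. l j)"
    unfolding elem_sym_def split by (intro sum.union_disjoint) auto
  also have "(\<Sum>S\<in>insert n ` ?B. \<Prod>j\<in>S. l j) = (\<Sum>S\<in>?B. \<Prod>j\<in>insert n S. l j)"
    by (subst sum.reindex[OF inj]) simp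
  also have "\<dots> = (\<Sum>S\<in>?B. l n * (\<Prod>j\<in>S. l j))"
    by (intro sum.cong refl prod.insert) (auto intro: finite_subset)
  finally show ?thesis by (simp add: elem_sym_def sum_distrib_left)
qed

text \<open>The homogeneous form of Vieta's formulas serves two purposes: \<open>y = 1\<close> gives
  the monic polynomial with roots \<open>l\<close>, and \<open>x = 1\<close> gives the reversed
  polynomial that later becomes a common denominator.\<close>

lemma prod_diff_eq_sum_elem_sym:
  "(\<Prod>j<n. x - l j * y) = (\<Sum>k\<le>n. (- 1) ^ k * elem_sym n k l * y ^ k * x ^ (n - k))"
proof (induction n)
  case (Suc n)
  let ?e = "\<lambda>k. elem_sym n k l"
  have "(\<Sum>k\<le>Suc n. (- 1) ^ k * elem_sym (Suc n) k l * y ^ k * x ^ (Suc n - k))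
      = x ^ Suc n + (\<Sum>k\<le>n. (- 1) ^ Suc k * (?e (Suc k) + l n * ?e k) * y ^ Suc k * x ^ (n - k))"
    by (subst sum.atMost_Suc_shift) (simp add: elem_sym_Suc)
  also have "\<dots> = (x ^ Suc n + (\<Sum>k\<le>n. (- 1) ^ Suc k * ?e (Suc k) * y ^ Suc k * x ^ (n - k)))
      - l n * y * (\<Sum>k\<le>n. (- 1) ^ k * ?e k * y ^ k * x ^ (n - k))"
    by (simp add: sum_distrib_left algebra_simps flip: sum.distrib sum_subtractf)
  also have "x ^ Suc n + (\<Sum>k\<le>n. (- 1) ^ Suc k * ?e (Suc k) * y ^ Suc k * x ^ (n - k))
      = (\<Sum>k\<le>Suc n. (- 1) ^ k * ?e k * y ^ k * x ^ (Suc n - k))"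
    by (subst sum.atMost_Suc_shift) simp
  also have "\<dots> = x * (\<Sum>k\<le>n. (- 1) ^ k * ?e k * y ^ k * x ^ (n - k))"
    by (simp add: elem_sym_eq_0 sum_distrib_left Suc_diff_le mult_ac)
  finally show ?case
    using Suc.IH by (simp add: algebra_simps)
qed simp

definition vandermonde :: "nat \<Rightarrow> (nat \<Rightarrow> complex) \<Rightarrow> complex" where
  "vandermonde n l = (\<Prod>j<n. \<Prod>i<j. l j - l i)"

lemma vandermonde_Suc: "vandermonde (Suc n) l = vandermonde n l * (\<Prod>i<n. l n - l i)"
  by (simp add: vandermonde_def)

lemma vandermonde_cong:
  assumes "\<And>j. j < n \<Longrightarrow> l j = l' j"
  shows "vandermonde n l = vandermonde n l'"
  unfolding vandermonde_def using assms by (intro prod.cong) auto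

text \<open>Index shift: coordinate \<open>i\<close> of a point of the image of \<^const>\<open>sym_map\<close> is the elementary symmetric
  polynomial of degree \<open>i + 1\<close>, while \<open>esc s k\<close> is the one of degree \<open>k\<close>.\<close>

definition esc :: "(nat \<Rightarrow> complex) \<Rightarrow> nat \<Rightarrow> complex" where
  "esc s k = (case k of 0 \<Rightarrow> 1 | Suc i \<Rightarrow> s i)"

lemma esc_simps [simp]: "esc s 0 = 1" "esc s (Suc i) = s i"
  by (simp_all add: esc_def)

definition char_poly :: "nat \<Rightarrow> complex \<Rightarrow> (nat \<Rightarrow> complex) \<Rightarrow> complex" where
  "char_poly n t s = (\<Sum>k\<le>n. (- 1) ^ k * esc s k * t ^ (n - k))"

text \<open>This is Horner's scheme: for fixed \<open>s\<close>, the values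
  \<open>char_poly m t s\<close> with \<open>m < n\<close> are the partial results on the way to
  \<open>char_poly n t s\<close>, a fact that returns in \<open>root_prod_eq\<close>.\<close>

lemma char_poly_Suc: "char_poly (Suc n) t s = t * char_poly n t s + (- 1) ^ Suc n * s n"
  by (simp add: char_poly_def sum_distrib_left Suc_diff_le mult_ac)

lemma char_poly_cong: "(\<And>i. i < n \<Longrightarrow> s i = s' i) \<Longrightarrow> char_poly n t s = char_poly n t s'"
  unfolding char_poly_def esc_def by (intro sum.cong) (auto split: nat.split)

lemma esc_sym_map: "k \<le> n \<Longrightarrow> esc (sym_map n l) k = elem_sym n k l"
  by (cases k) (auto simp: sym_map_def)

lemma char_poly_sym_map: "char_poly n t (sym_map n l) = (\<Prod>j<n. t - l j)"
  using prod_diff_eq_sum_elem_sym[of t l 1 n] by (simp add: char_poly_def esc_sym_map)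

text \<open>Coefficients after multiplication by one more linear factor. The \<open>if\<close>
  treats the last coordinate, where the elementary symmetric polynomial of degree n + 1 in n
  variables vanishes.\<close>

definition adjoin_root :: "nat \<Rightarrow> complex \<Rightarrow> (nat \<Rightarrow> complex) \<Rightarrow> nat \<Rightarrow> complex" where
  "adjoin_root n t s = restrict (\<lambda>i. (if i < n then s i else 0) + t * esc s i) {..<Suc n}"

lemma sym_map_Suc: "sym_map (Suc n) (l(n := t)) = adjoin_root n t (sym_map n l)"
proof
  fix i
  have "elem_sym (Suc n) (Suc i) (l(n := t)) = elem_sym n (Suc i) l + t * elem_sym n i l"
    using elem_sym_cong[of n "l(n := t)" l] by (simp add: elem_sym_Suc)
  then show "sym_map (Suc n) (l(n := t)) i = adjoin_root n t (sym_map n l) i"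
    by (auto simp: adjoin_root_def sym_map_def[of "Suc n"] esc_sym_map less_Suc_eq_le
        elem_sym_eq_0) (auto simp: sym_map_def)
qed

text \<open>\<open>shear n t\<close> solves the triangular system \<open>e\<^sub>i = s\<^sub>i + t s\<^sub>i\<^sub>-\<^sub>1\<close> (\<open>s\<^sub>-\<^sub>1 = 1\<close>), \<open>i < n\<close>, for \<open>s\<close>. In these
  coordinates adjoining the root \<open>t\<close> changes only the last symmetric function, which becomes the
  polynomial \<open>shear_poly e n\<close> in \<open>t\<close> of degree \<open>n + 1\<close>; this reduces the change of variables to one dimension.\<close>

primrec shear_poly :: "(nat \<Rightarrow> complex) \<Rightarrow> nat \<Rightarrow> complex poly" where
  "shear_poly e 0 = [:0, 1:]"
| "shear_poly e (Suc m) = [:0, 1:] * ([:e m:] - shear_poly e m)"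

definition shear :: "nat \<Rightarrow> complex \<Rightarrow> (nat \<Rightarrow> complex) \<Rightarrow> nat \<Rightarrow> complex" where
  "shear n t e = restrict (\<lambda>i. e i - poly (shear_poly e i) t) {..<n}"

lemma shear_poly_cong: "(\<And>i. i < m \<Longrightarrow> e i = e' i) \<Longrightarrow> shear_poly e m = shear_poly e' m"
  by (induction m) auto

lemma degree_shear_poly: "degree (shear_poly e m) = Suc m"
proof (induction m)
  case (Suc m)
  have "degree ([:e m:] - shear_poly e m) = degree (shear_poly e m - [:e m:])"
    by (metis degree_minus minus_diff_eq)
  also have "shear_poly e m - [:e m:] = shear_poly e m + [:- e m:]" by simp
  also have "degree \<dots> = Suc m"
    using Suc by (subst degree_add_eq_left) auto
  finally have "degree ([:e m:] - shear_poly e m) = Suc m" .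
  moreover from this have "[:e m:] - shear_poly e m \<noteq> 0" by auto
  ultimately show ?case by (simp add: degree_mult_eq)
qed simp

lemma poly_shear_poly: "poly (shear_poly e m) t = t * esc (\<lambda>i. e i - poly (shear_poly e i) t) m"
  by (cases m) auto

lemma adjoin_root_shear:
  assumes "e \<in> extensional {..<n}"
  shows "adjoin_root n t (shear n t e) = e(n := poly (shear_poly e n) t)"
proof
  fix i
  have "esc (shear n t e) i = esc (\<lambda>i. e i - poly (shear_poly e i) t) i" if "i \<le> n"
    using that by (cases i) (auto simp: shear_def)
  then show "adjoin_root n t (shear n t e) i = (e(n := poly (shear_poly e n) t)) i"
    using assms poly_shear_poly[of e i t]
    by (auto simp: adjoin_root_def shear_def extensional_def less_Suc_eq_le)
qed

text \<open>With \<open>e\<close> held fixed, the derivative of the new last coordinate in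
  \<open>t\<close> is, up to sign, the product of the differences between \<open>t\<close> and the
  other roots. This is exactly the factor by which the Vandermonde product grows, which is why a
  one-dimensional Jacobian suffices.\<close>

lemma pderiv_shear_poly:
  "poly (pderiv (shear_poly e n)) t = (- 1) ^ n * char_poly n t (shear n t e)"
proof (induction n)
  case (Suc n)
  have "char_poly n t (shear (Suc n) t e) = char_poly n t (shear n t e)"
    by (rule char_poly_cong) (simp add: shear_def)
  then have "char_poly (Suc n) t (shear (Suc n) t e)
      = t * char_poly n t (shear n t e) + (- 1) ^ Suc n * (e n - poly (shear_poly e n) t)"
    by (simp add: char_poly_Suc shear_def)
  moreover have "poly (pderiv (shear_poly e (Suc n))) t
      = e n - poly (shear_poly e n) t - t * poly (pderiv (shear_poly e n)) t"
    by (simp add: pderiv_mult pderiv_diff pderiv_pCons)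
  moreover have "(- 1) ^ Suc n * ((- 1) ^ Suc n * (e n - poly (shear_poly e n) t)) = e n - poly (shear_poly e n) t"
    by (simp flip: mult.assoc power_add)
  moreover have "(- 1) ^ Suc n * (t * char_poly n t (shear n t e)) = - (t * poly (pderiv (shear_poly e n)) t)"
    by (simp add: Suc)
  ultimately show ?case
    by (simp only: distrib_left) simp
qed (simp add: char_poly_def pderiv_pCons)

section \<open>Lebesgue measure on C^n by iterated integration, and the substitution formula\<close>

interpretation Cn_product: product_sigma_finite "\<lambda>_::nat. lborel :: complex measure" ..

lemma sigma_finite_lebesgue_Cn: "sigma_finite_measure (lebesgue_Cn n)"
  unfolding lebesgue_Cn_def by (rule Cn_product.sigma_finite) simp

lemma space_lebesgue_Cn: "space (lebesgue_Cn n) = extensional {..<n}"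
  by (simp add: lebesgue_Cn_def space_PiM PiE_UNIV_domain PiE_def)

lemma measurable_lebesgue_Cn_component:
  "i < n \<Longrightarrow> (\<lambda>x. x i) \<in> borel_measurable (lebesgue_Cn n)"
  unfolding lebesgue_Cn_def
  using measurable_component_singleton[of i "{..<n}" "\<lambda>_. lborel :: complex measure"] by simp

lemma measurable_lebesgue_Cn_restrict:
  assumes "\<And>i. i < n \<Longrightarrow> f i \<in> borel_measurable M"
  shows "(\<lambda>\<omega>. restrict (\<lambda>i. f i \<omega>) {..<n}) \<in> measurable M (lebesgue_Cn n)"
  unfolding lebesgue_Cn_def using assms by (intro measurable_restrict) auto

lemma measurable_lebesgue_Cn_upd:
  "(\<lambda>(x, y). x(n := y)) \<in> measurable (lebesgue_Cn n \<Otimes>\<^sub>M lborel) (lebesgue_Cn (Suc n))"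
  unfolding lebesgue_Cn_def lessThan_Suc
  using measurable_add_dim[of n "{..<n}" "\<lambda>_. lborel :: complex measure"] by simp

lemma nn_integral_lebesgue_Cn_Suc:
  assumes "f \<in> borel_measurable (lebesgue_Cn (Suc n))"
  shows "(\<integral>\<^sup>+x. f x \<partial>lebesgue_Cn (Suc n)) = (\<integral>\<^sup>+x. \<integral>\<^sup>+y. f (x(n := y)) \<partial>lborel \<partial>lebesgue_Cn n)"
    and "(\<integral>\<^sup>+x. f x \<partial>lebesgue_Cn (Suc n)) = (\<integral>\<^sup>+y. \<integral>\<^sup>+x. f (x(n := y)) \<partial>lebesgue_Cn n \<partial>lborel)"
  using assms Cn_product.product_nn_integral_insert[of "{..<n}" n f]
    Cn_product.product_nn_integral_insert_rev[of "{..<n}" n f]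
  unfolding lebesgue_Cn_def lessThan_Suc by simp_all

lemma borel_measurable_shear_poly:
  assumes "T \<in> borel_measurable M" "\<And>k. k < i \<Longrightarrow> (\<lambda>\<omega>. E \<omega> k) \<in> borel_measurable M"
  shows "(\<lambda>\<omega>. poly (shear_poly (E \<omega>) i) (T \<omega>)) \<in> borel_measurable M"
  using assms by (induction i) auto

lemma measurable_shear:
  "(\<lambda>(t, e). shear n t e) \<in> measurable (lborel \<Otimes>\<^sub>M lebesgue_Cn n) (lebesgue_Cn n)"
  unfolding shear_def case_prod_beta'
  by (intro measurable_lebesgue_Cn_restrict borel_measurable_diff borel_measurable_shear_poly
        measurable_compose[OF measurable_snd measurable_lebesgue_Cn_component] measurable_fst'') auto

lemma measurable_elem_sym: "elem_sym n k \<in> borel_measurable (lebesgue_Cn n)"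
  unfolding elem_sym_def
  by (intro borel_measurable_sum borel_measurable_prod measurable_lebesgue_Cn_component) auto

lemma measurable_sym_map: "sym_map n \<in> measurable (lebesgue_Cn n) (lebesgue_Cn n)"
  unfolding sym_map_def[abs_def]
  by (intro measurable_lebesgue_Cn_restrict measurable_elem_sym)

lemma measurable_vandermonde: "vandermonde n \<in> borel_measurable (lebesgue_Cn n)"
  unfolding vandermonde_def
  by (intro borel_measurable_prod borel_measurable_diff measurable_lebesgue_Cn_component) auto

lemma shear_Suc: "shear (Suc n) t (e(n := x)) = (shear n t e)(n := x - poly (shear_poly e n) t)"
proof
  fix i
  have "shear_poly (e(n := x)) i = shear_poly e i" if "i \<le> n"
    using that by (intro shear_poly_cong) auto
  then show "shear (Suc n) t (e(n := x)) i = ((shear n t e)(n := x - poly (shear_poly e n) t)) i"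
    by (auto simp: shear_def less_Suc_eq_le)
qed

text \<open>For fixed \<open>t\<close> the map is unit triangular: coordinate \<open>i\<close> is
  translated by a function of the earlier coordinates. Translation invariance removes the last shift
  and induction the others.\<close>

lemma nn_integral_shear:
  assumes "H \<in> borel_measurable (lebesgue_Cn n)"
  shows "(\<integral>\<^sup>+e. H (shear n t e) \<partial>lebesgue_Cn n) = (\<integral>\<^sup>+e. H e \<partial>lebesgue_Cn n)"
  using assms
proof (induction n arbitrary: H)
  case 0
  show ?case
    by (rule nn_integral_cong) (auto simp: shear_def space_lebesgue_Cn extensional_def restrict_def
        intro!: arg_cong[of _ _ H])
next
  case (Suc n)
  note H = Suc.prems
  have Hs: "(\<lambda>e. H (shear (Suc n) t e)) \<in> borel_measurable (lebesgue_Cn (Suc n))"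
    using measurable_compose[OF measurable_Pair1'[of t lborel] measurable_compose[OF measurable_shear H]]
    by simp
  have H2: "(\<lambda>(s, x). H (s(n := x))) \<in> borel_measurable (lebesgue_Cn n \<Otimes>\<^sub>M lborel)"
    using measurable_compose[OF measurable_lebesgue_Cn_upd H] by (simp add: case_prod_beta' fun_upd_def)
  have H1: "(\<lambda>s. \<integral>\<^sup>+x. H (s(n := x)) \<partial>lborel) \<in> borel_measurable (lebesgue_Cn n)"
    using lborel.borel_measurable_nn_integral_fst[OF H2] by simp
  have "(\<integral>\<^sup>+e. H (shear (Suc n) t e) \<partial>lebesgue_Cn (Suc n))
      = (\<integral>\<^sup>+e. \<integral>\<^sup>+x. H ((shear n t e)(n := x - poly (shear_poly e n) t)) \<partial>lborel \<partial>lebesgue_Cn n)"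
    by (subst nn_integral_lebesgue_Cn_Suc(1)[OF Hs]) (simp add: shear_Suc)
  also have "\<dots> = (\<integral>\<^sup>+e. \<integral>\<^sup>+x. H ((shear n t e)(n := x)) \<partial>lborel \<partial>lebesgue_Cn n)"
  proof (rule nn_integral_cong)
    fix e assume "e \<in> space (lebesgue_Cn n)"
    let ?c = "poly (shear_poly e n) t"
    have "shear n t e \<in> space (lebesgue_Cn n)" by (simp add: space_lebesgue_Cn shear_def)
    from measurable_compose[OF measurable_Pair1'[OF this] H2]
    have m: "(\<lambda>x. H ((shear n t e)(n := x))) \<in> borel_measurable borel" by (simp add: fun_upd_def)
    have "(\<integral>\<^sup>+x. H ((shear n t e)(n := x)) \<partial>distr lborel borel ((+) (- ?c)))
        = (\<integral>\<^sup>+x. H ((shear n t e)(n := x - ?c)) \<partial>lborel)"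
      using m by (subst nn_integral_distr) auto
    then show "(\<integral>\<^sup>+x. H ((shear n t e)(n := x - ?c)) \<partial>lborel) = (\<integral>\<^sup>+x. H ((shear n t e)(n := x)) \<partial>lborel)"
      by (simp add: lborel_distr_plus)
  qed
  also have "\<dots> = (\<integral>\<^sup>+e. \<integral>\<^sup>+x. H (e(n := x)) \<partial>lborel \<partial>lebesgue_Cn n)"
    by (rule Suc.IH[OF H1])
  also have "\<dots> = (\<integral>\<^sup>+e. H e \<partial>lebesgue_Cn (Suc n))"
    by (rule nn_integral_lebesgue_Cn_Suc(1)[OF H, symmetric])
  finally show ?case .
qed

text \<open>Induction on the number of roots. For a fixed new root \<open>t\<close>, the induction
  hypothesis turns the old roots into their coefficients \<open>s\<close>, and the shear replaces
  \<open>s\<close> by the first \<open>n\<close> new coefficients \<open>e\<close>. After exchanging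
  the integrals, \<open>t\<close> alone has to be traded for the last coefficient, which is a
  polynomial in \<open>t\<close>.\<close>

theorem nn_integral_sym_map:
  assumes "g \<in> borel_measurable (lebesgue_Cn n)"
  shows "(\<integral>\<^sup>+l. g (sym_map n l) * ennreal ((cmod (vandermonde n l))\<^sup>2) \<partial>lebesgue_Cn n)
    = fact n * (\<integral>\<^sup>+z. g z \<partial>lebesgue_Cn n)"
  using assms
proof (induction n arbitrary: g)
  case 0
  have "(\<integral>\<^sup>+l. g (sym_map 0 l) * ennreal ((cmod (vandermonde 0 l))\<^sup>2) \<partial>lebesgue_Cn 0)
      = (\<integral>\<^sup>+z. g z \<partial>lebesgue_Cn 0)"
    by (rule nn_integral_cong) (auto simp: sym_map_def space_lebesgue_Cn extensional_def restrict_def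
        vandermonde_def intro!: arg_cong[of _ _ g])
  then show ?case by simp
next
  case (Suc n)
  note g = Suc.prems
  let ?L = "lebesgue_Cn n"
  interpret L: sigma_finite_measure ?L by (rule sigma_finite_lebesgue_Cn)
  interpret P: pair_sigma_finite "lborel :: complex measure" ?L ..
  define H where "H = (\<lambda>t s. g (adjoin_root n t s) * ennreal ((cmod (char_poly n t s))\<^sup>2))"
  have esc_m: "(\<lambda>z. esc (snd z) i) \<in> borel_measurable (lborel \<Otimes>\<^sub>M ?L)" if "i \<le> n" for i
    using that by (cases i) (auto intro!: measurable_compose[OF measurable_snd measurable_lebesgue_Cn_component])
  have cm: "(\<lambda>(t, s). char_poly n t s) \<in> borel_measurable (lborel \<Otimes>\<^sub>M ?L)"
    unfolding char_poly_def case_prod_beta'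
    by (intro borel_measurable_sum borel_measurable_times esc_m borel_measurable_power measurable_fst'') auto
  have am: "(\<lambda>(t, s). adjoin_root n t s) \<in> measurable (lborel \<Otimes>\<^sub>M ?L) (lebesgue_Cn (Suc n))"
    unfolding adjoin_root_def case_prod_beta'
  proof (intro measurable_lebesgue_Cn_restrict borel_measurable_add borel_measurable_times esc_m measurable_fst'')
    fix i
    show "(\<lambda>z. if i < n then snd z i else 0) \<in> borel_measurable (lborel \<Otimes>\<^sub>M ?L)"
      by (cases "i < n") (auto intro!: measurable_compose[OF measurable_snd measurable_lebesgue_Cn_component])
  qed auto
  have Hm: "(\<lambda>(t, s). H t s) \<in> borel_measurable (lborel \<Otimes>\<^sub>M ?L)"
    using measurable_compose[OF am g] cm unfolding H_def case_prod_beta' by measurable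
  have Hm': "H t \<in> borel_measurable ?L" for t
    using measurable_compose[OF measurable_Pair1'[of t lborel] Hm] by simp
  have fm: "(\<lambda>l. g (sym_map (Suc n) l) * ennreal ((cmod (vandermonde (Suc n) l))\<^sup>2)) \<in> borel_measurable (lebesgue_Cn (Suc n))"
    using measurable_compose[OF measurable_sym_map g] measurable_vandermonde by measurable
  have vm: "(\<lambda>l. ennreal ((cmod (vandermonde n l))\<^sup>2)) \<in> borel_measurable ?L"
    using measurable_vandermonde by measurable
  have Sm: "(\<lambda>(t, e). H t (shear n t e)) \<in> borel_measurable (lborel \<Otimes>\<^sub>M ?L)"
    using measurable_compose[OF measurable_Pair[OF measurable_fst measurable_shear] Hm]
    by (simp add: case_prod_beta')
  have "(\<integral>\<^sup>+l. g (sym_map (Suc n) l) * ennreal ((cmod (vandermonde (Suc n) l))\<^sup>2) \<partial>lebesgue_Cn (Suc n))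
      = (\<integral>\<^sup>+t. \<integral>\<^sup>+l. H t (sym_map n l) * ennreal ((cmod (vandermonde n l))\<^sup>2) \<partial>?L \<partial>lborel)"
  proof (subst nn_integral_lebesgue_Cn_Suc(2)[OF fm], intro nn_integral_cong)
    fix t l
    have "vandermonde (Suc n) (l(n := t)) = vandermonde n l * char_poly n t (sym_map n l)"
      using vandermonde_cong[of n "l(n := t)" l]
      by (simp add: vandermonde_Suc char_poly_sym_map)
    then have "(cmod (vandermonde (Suc n) (l(n := t))))\<^sup>2
        = (cmod (char_poly n t (sym_map n l)))\<^sup>2 * (cmod (vandermonde n l))\<^sup>2"
      by (simp add: norm_mult power_mult_distrib mult.commute)
    then show "g (sym_map (Suc n) (l(n := t))) * ennreal ((cmod (vandermonde (Suc n) (l(n := t))))\<^sup>2)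
        = H t (sym_map n l) * ennreal ((cmod (vandermonde n l))\<^sup>2)"
      by (simp add: H_def sym_map_Suc ennreal_mult mult.assoc)
  qed
  also have "\<dots> = (\<integral>\<^sup>+t. fact n * (\<integral>\<^sup>+s. H t s \<partial>?L) \<partial>lborel)"
    using Suc.IH[OF Hm'] by simp
  also have "\<dots> = (\<integral>\<^sup>+t. fact n * (\<integral>\<^sup>+e. H t (shear n t e) \<partial>?L) \<partial>lborel)"
    using nn_integral_shear[OF Hm'] by simp
  also have "\<dots> = fact n * (\<integral>\<^sup>+t. (\<integral>\<^sup>+e. H t (shear n t e) \<partial>?L) \<partial>lborel)"
    using L.borel_measurable_nn_integral_fst[OF Sm] by (intro nn_integral_cmult) simp
  also have "(\<integral>\<^sup>+t. (\<integral>\<^sup>+e. H t (shear n t e) \<partial>?L) \<partial>lborel)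
      = (\<integral>\<^sup>+e. (\<integral>\<^sup>+t. H t (shear n t e) \<partial>lborel) \<partial>?L)"
    using P.Fubini'[OF Sm] by simp
  also have "\<dots> = (\<integral>\<^sup>+e. of_nat (Suc n) * (\<integral>\<^sup>+y. g (e(n := y)) \<partial>lborel) \<partial>?L)"
  proof (rule nn_integral_cong)
    fix e assume e: "e \<in> space ?L"
    then have ext: "e \<in> extensional {..<n}" by (simp add: space_lebesgue_Cn)
    have m: "(\<lambda>y. g (e(n := y))) \<in> borel_measurable borel"
      using measurable_compose[OF measurable_Pair1'[OF e] measurable_compose[OF measurable_lebesgue_Cn_upd g]]
      by (simp add: fun_upd_def)
    have "(\<integral>\<^sup>+t. H t (shear n t e) \<partial>lborel)
        = (\<integral>\<^sup>+t. g (e(n := poly (shear_poly e n) t)) * ennreal ((cmod (poly (pderiv (shear_poly e n)) t))\<^sup>2) \<partial>lborel)"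
      by (simp add: H_def adjoin_root_shear[OF ext] pderiv_shear_poly norm_mult norm_power)
    \<comment> \<open>The polynomial has degree n + 1, which supplies the factor that turns n! into
      (n + 1)!.\<close>
    also have "\<dots> = of_nat (Suc n) * (\<integral>\<^sup>+y. g (e(n := y)) \<partial>lborel)"
      using nn_integral_poly_substitution[OF _ m, of "shear_poly e n"] by (simp add: degree_shear_poly)
    finally show "(\<integral>\<^sup>+t. H t (shear n t e) \<partial>lborel) = of_nat (Suc n) * (\<integral>\<^sup>+y. g (e(n := y)) \<partial>lborel)" .
  qed
  also have "\<dots> = of_nat (Suc n) * (\<integral>\<^sup>+e. (\<integral>\<^sup>+y. g (e(n := y)) \<partial>lborel) \<partial>?L)"
    using lborel.borel_measurable_nn_integral_fst[OF measurable_compose[OF measurable_lebesgue_Cn_upd g]]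
    by (intro nn_integral_cmult) (simp add: fun_upd_def)
  also have "(\<integral>\<^sup>+e. (\<integral>\<^sup>+y. g (e(n := y)) \<partial>lborel) \<partial>?L) = (\<integral>\<^sup>+z. g z \<partial>lebesgue_Cn (Suc n))"
    by (rule nn_integral_lebesgue_Cn_Suc(1)[OF g, symmetric])
  finally show ?case
    by (simp only: fact_Suc mult.assoc mult.left_commute[of "of_nat (Suc n)" "fact n"])
qed

section \<open>The Bergman kernel of the polydisc\<close>

text \<open>Links the topology of the full function space, in which continuity is expressed, with
  the finite product measure: on extensional functions all coordinates from \<open>n\<close> on are
  constant, hence measurable.\<close>

lemma measurable_lebesgue_Cn_borel: "(\<lambda>x. x) \<in> measurable (lebesgue_Cn n) (borel :: (nat \<Rightarrow> complex) measure)"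
proof -
  have "(\<lambda>x i. x i) \<in> measurable (lebesgue_Cn n) (\<Pi>\<^sub>M i\<in>UNIV. (borel :: complex measure))"
  proof (rule measurable_PiM_single')
    fix i
    show "(\<lambda>x. x i) \<in> borel_measurable (lebesgue_Cn n)"
    proof (cases "i < n")
      case False
      have "(\<lambda>x. undefined) \<in> borel_measurable (lebesgue_Cn n)" by simp
      then show ?thesis
        by (rule measurable_cong[THEN iffD1, rotated])
           (use False in \<open>simp add: space_lebesgue_Cn extensional_def\<close>)
    qed (rule measurable_lebesgue_Cn_component)
  qed (auto simp: PiE_def)
  then show ?thesis
    using measurable_cong_sets[OF refl sets_PiM_equal_borel] by blast
qed

lemma Cn_eq_space: "Cn n = space (lebesgue_Cn n)"
  by (simp add: Cn_def space_lebesgue_Cn PiE_UNIV_domain PiE_def)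

lemma Cn_eq_extensional: "Cn n = extensional {..<n}"
  by (simp add: Cn_eq_space space_lebesgue_Cn)

lemma sets_lebesgue_Cn_open:
  assumes "open U"
  shows "U \<inter> Cn n \<in> sets (lebesgue_Cn n)"
  using measurable_sets[OF measurable_lebesgue_Cn_borel, of U n] assms
  by (simp add: Cn_eq_space)

lemma set_borel_measurable_continuous_on:
  fixes f :: "(nat \<Rightarrow> complex) \<Rightarrow> 'b::{real_normed_vector}"
  assumes "D \<in> sets (lebesgue_Cn n)" "continuous_on D f"
  shows "set_borel_measurable (lebesgue_Cn n) D f"
proof -
  have "f \<in> borel_measurable (restrict_space borel D)"
    using assms(2) by (rule borel_measurable_continuous_on_restrict)
  moreover have "(\<lambda>x. x) \<in> measurable (restrict_space (lebesgue_Cn n) D) (restrict_space borel D)"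
    by (rule measurable_restrict_space3[OF measurable_lebesgue_Cn_borel]) auto
  ultimately have "f \<in> borel_measurable (restrict_space (lebesgue_Cn n) D)"
    using measurable_compose by fastforce
  then show ?thesis
    using assms(1) by (simp add: set_borel_measurable_def borel_measurable_restrict_space_iff)
qed

lemma unit_polydisc_eq: "unit_polydisc n = {l. \<forall>j<n. cmod (l j) < 1} \<inter> Cn n"
  by (auto simp: unit_polydisc_def)

lemma open_polydisc: "open {l :: nat \<Rightarrow> complex. \<forall>j<n. cmod (l j) < 1}"
proof -
  have "open (\<Inter>j\<in>{..<n}. {l :: nat \<Rightarrow> complex. cmod (l j) < 1})"
    by (intro open_INT ballI open_Collect_less continuous_intros) auto
  also have "(\<Inter>j\<in>{..<n}. {l :: nat \<Rightarrow> complex. cmod (l j) < 1}) = {l. \<forall>j<n. cmod (l j) < 1}"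
    by auto
  finally show ?thesis .
qed

lemma sets_unit_polydisc: "unit_polydisc n \<in> sets (lebesgue_Cn n)"
  unfolding unit_polydisc_eq by (intro sets_lebesgue_Cn_open open_polydisc)

lemma unit_polydisc_upd:
  assumes "x \<in> Cn n"
  shows "x(n := y) \<in> unit_polydisc (Suc n) \<longleftrightarrow> x \<in> unit_polydisc n \<and> cmod y < 1"
  using assms by (auto simp: unit_polydisc_def Cn_eq_extensional extensional_def less_Suc_eq)

text \<open>Presenting the measure as an image of a binary product makes Fubini for complex-valued
  integrals available.\<close>

lemma lebesgue_Cn_Suc_eq_distr:
  "lebesgue_Cn (Suc n) = distr (lebesgue_Cn n \<Otimes>\<^sub>M lborel) (lebesgue_Cn (Suc n)) (\<lambda>(x, y). x(n := y))"
    (is "_ = ?R")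
proof (rule measure_eqI)
  fix A assume A: "A \<in> sets (lebesgue_Cn (Suc n))"
  then have ind: "indicator A \<in> borel_measurable (lebesgue_Cn (Suc n))" by simp
  have m: "(\<lambda>z. indicator A ((\<lambda>(x, y). x(n := y)) z) :: ennreal) \<in> borel_measurable (lebesgue_Cn n \<Otimes>\<^sub>M lborel)"
    by (rule measurable_compose[OF measurable_lebesgue_Cn_upd ind])
  have "emeasure (lebesgue_Cn (Suc n)) A = (\<integral>\<^sup>+x. \<integral>\<^sup>+y. indicator A (x(n := y)) \<partial>lborel \<partial>lebesgue_Cn n)"
    using nn_integral_lebesgue_Cn_Suc(1)[OF ind] A by simp
  also have "\<dots> = (\<integral>\<^sup>+z. indicator A ((\<lambda>(x, y). x(n := y)) z) \<partial>(lebesgue_Cn n \<Otimes>\<^sub>M lborel))"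
    using lborel.nn_integral_fst[OF m] by simp
  also have "\<dots> = (\<integral>\<^sup>+z. indicator A z \<partial>?R)"
    by (rule nn_integral_distr[OF measurable_lebesgue_Cn_upd, symmetric]) (use ind in simp)
  also have "\<dots> = emeasure ?R A"
    using A by simp
  finally show "emeasure (lebesgue_Cn (Suc n)) A = emeasure ?R A" .
qed simp

lemma integral_lebesgue_Cn_Suc:
  fixes f :: "(nat \<Rightarrow> complex) \<Rightarrow> complex"
  assumes f: "integrable (lebesgue_Cn (Suc n)) f"
  shows "AE x in lebesgue_Cn n. integrable lborel (\<lambda>y. f (x(n := y)))"
    and "integrable (lebesgue_Cn n) (\<lambda>x. LINT y|lborel. f (x(n := y)))"
    and "integral\<^sup>L (lebesgue_Cn (Suc n)) f = (LINT x|lebesgue_Cn n. LINT y|lborel. f (x(n := y)))"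
proof -
  interpret L: sigma_finite_measure "lebesgue_Cn n" by (rule sigma_finite_lebesgue_Cn)
  interpret P: pair_sigma_finite "lebesgue_Cn n" "lborel :: complex measure" ..
  have fm: "f \<in> borel_measurable (lebesgue_Cn (Suc n))" using f by simp
  have i: "integrable (lebesgue_Cn n \<Otimes>\<^sub>M lborel) (\<lambda>(x, y). f (x(n := y)))"
    using integrable_distr[OF measurable_lebesgue_Cn_upd, where f = f] f
    unfolding lebesgue_Cn_Suc_eq_distr[symmetric] by (simp add: case_prod_beta')
  show "AE x in lebesgue_Cn n. integrable lborel (\<lambda>y. f (x(n := y)))"
    using P.AE_integrable_fst[OF i] .
  show "integrable (lebesgue_Cn n) (\<lambda>x. LINT y|lborel. f (x(n := y)))"
    using P.integrable_fst[OF i] .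
  have "integral\<^sup>L (lebesgue_Cn (Suc n)) f
      = integral\<^sup>L (distr (lebesgue_Cn n \<Otimes>\<^sub>M lborel) (lebesgue_Cn (Suc n)) (\<lambda>(x, y). x(n := y))) f"
    using lebesgue_Cn_Suc_eq_distr by metis
  also have "\<dots> = (LINT z|(lebesgue_Cn n \<Otimes>\<^sub>M lborel). f ((\<lambda>(x, y). x(n := y)) z))"
    by (rule integral_distr[OF measurable_lebesgue_Cn_upd fm])
  also have "\<dots> = (LINT x|lebesgue_Cn n. LINT y|lborel. f (x(n := y)))"
    using P.integral_fst'[of "\<lambda>z. f ((\<lambda>(x, y). x(n := y)) z)"] i by (simp add: case_prod_beta')
  finally show "integral\<^sup>L (lebesgue_Cn (Suc n)) f = (LINT x|lebesgue_Cn n. LINT y|lborel. f (x(n := y)))" .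
qed

text \<open>Up to the factor pi^n, the complex conjugate of the polydisc's Bergman kernel at
  \<open>(l, m)\<close>, in the form in which it stands under the integral sign.\<close>

definition bergman_prod :: "nat \<Rightarrow> (nat \<Rightarrow> complex) \<Rightarrow> (nat \<Rightarrow> complex) \<Rightarrow> complex" where
  "bergman_prod n m l = (\<Prod>j<n. 1 / (1 - m j * cnj (l j))\<^sup>2)"

lemma continuous_on_bergman_prod:
  assumes "m \<in> unit_polydisc n"
  shows "continuous_on (unit_polydisc n) (bergman_prod n m)"
  unfolding bergman_prod_def
proof (intro continuous_on_prod continuous_on_divide continuous_on_power continuous_on_diff
    continuous_on_mult continuous_on_const continuous_on_cnj ballI)
  fix j l assume "j \<in> {..<n}" "l \<in> unit_polydisc n"
  then show "(1 - m j * cnj (l j))\<^sup>2 \<noteq> 0"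
    using assms one_minus_mult_nonzero[of "m j" "cnj (l j)"] by (simp add: unit_polydisc_def)
qed (auto intro: continuous_on_subset[OF continuous_on_product_coordinates])

lemma norm_bergman_prod_le:
  assumes "m \<in> unit_polydisc n" "l \<in> unit_polydisc n"
  shows "cmod (bergman_prod n m l) \<le> (\<Prod>j<n. 1 / (1 - cmod (m j))\<^sup>2)"
  unfolding bergman_prod_def prod_norm[symmetric]
proof (intro prod_mono conjI norm_ge_zero)
  fix j assume "j \<in> {..<n}"
  then have j: "cmod (m j) < 1" "cmod (l j) < 1" using assms by (auto simp: unit_polydisc_def)
  then have "cmod (m j * cnj (l j)) \<le> cmod (m j)"
    by (simp add: norm_mult mult_left_le)
  then have "1 - cmod (m j) \<le> cmod (1 - m j * cnj (l j))"
    using norm_triangle_ineq2[of 1 "m j * cnj (l j)"] by simp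
  then show "cmod (1 / (1 - m j * cnj (l j))\<^sup>2) \<le> 1 / (1 - cmod (m j))\<^sup>2"
    using j by (auto simp: norm_divide norm_power intro!: divide_left_mono power_mono mult_pos_pos)
qed

lemma set_integrable_mult_bergman_prod:
  assumes "continuous_on (unit_polydisc n) F" "set_integrable (lebesgue_Cn n) (unit_polydisc n) F"
    and m: "m \<in> unit_polydisc n"
  shows "set_integrable (lebesgue_Cn n) (unit_polydisc n) (\<lambda>l. F l * bergman_prod n m l)"
proof -
  define C where "C = (\<Prod>j<n. 1 / (1 - cmod (m j))\<^sup>2)"
  have "0 \<le> C" unfolding C_def by (intro prod_nonneg) auto
  have "set_integrable (lebesgue_Cn n) (unit_polydisc n) (\<lambda>l. C *\<^sub>R F l)"
    using assms(2) by (intro set_integrable_scaleR_right) auto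
  then show ?thesis
  proof (rule set_integrable_bound)
    show "set_borel_measurable (lebesgue_Cn n) (unit_polydisc n) (\<lambda>l. F l * bergman_prod n m l)"
      by (intro set_borel_measurable_continuous_on sets_unit_polydisc continuous_on_mult assms
          continuous_on_bergman_prod)
    show "AE l in lebesgue_Cn n. l \<in> unit_polydisc n \<longrightarrow> norm (F l * bergman_prod n m l) \<le> norm (C *\<^sub>R F l)"
      using norm_bergman_prod_le[OF m] \<open>0 \<le> C\<close>
      by (intro AE_I2) (auto simp: norm_mult C_def[symmetric] mult.commute[of _ "cmod (bergman_prod n m _)"]
          intro!: mult_right_mono)
  qed
qed

lemma bergman_prod_restrict: "bergman_prod n (restrict m {..<n}) = bergman_prod n m"
  by (auto simp: bergman_prod_def fun_eq_iff intro!: prod.cong)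

lemma continuous_on_upd:
  fixes f :: "'a::topological_space \<Rightarrow> nat \<Rightarrow> complex"
  assumes "continuous_on S f" "continuous_on S g"
  shows "continuous_on S (\<lambda>x. (f x)(j := g x))"
proof (rule continuous_on_coordinatewise_then_product)
  fix i show "continuous_on S (\<lambda>x. ((f x)(j := g x)) i)"
    using assms continuous_on_product_then_coordinatewise[OF assms(1)] by (cases "i = j") auto
qed

text \<open>The last variable is integrated by the disc formula, which replaces it by
  \<open>m n\<close>, and induction handles the restriction \<open>F'\<close>. The delicate point is
  the integrability of \<open>F'\<close>: Fubini gives it for almost every value of the last
  variable, but \<open>m n\<close> is prescribed.\<close>

theorem polydisc_reproducing:
  assumes "holomorphic_n n F (unit_polydisc n)"
    and "set_integrable (lebesgue_Cn n) (unit_polydisc n) F"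
    and "m \<in> unit_polydisc n"
  shows "(LINT l:unit_polydisc n|lebesgue_Cn n. F l * bergman_prod n m l) = of_real pi ^ n * F m"
  using assms
proof (induction n arbitrary: F m)
  case 0
  have e: "lebesgue_Cn 0 = count_space {\<lambda>k. undefined}" by (simp add: lebesgue_Cn_def PiM_empty)
  have U: "unit_polydisc 0 = {\<lambda>k. undefined}" by (simp add: unit_polydisc_def Cn_def)
  have "m = (\<lambda>k. undefined)" using 0(3) U by simp
  then show ?case
    by (simp add: set_lebesgue_integral_def e lebesgue_integral_count_space_finite bergman_prod_def U)
next
  case (Suc n)
  let ?D = "unit_polydisc n" and ?D' = "unit_polydisc (Suc n)" and ?B = "ball 0 1 :: complex set"
  let ?m = "restrict m {..<n}"
  have contF: "continuous_on ?D' F" using Suc.prems(1) by (simp add: holomorphic_n_def)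
  have m: "?m \<in> ?D" "cmod (m n) < 1" "?m(n := m n) = m" "m \<in> extensional {..<Suc n}"
    using Suc.prems(3) by (auto simp: unit_polydisc_def Cn_eq_extensional extensional_def fun_eq_iff less_Suc_eq)
  have updD: "x(n := m n) \<in> ?D'" if "x \<in> ?D" for x
    using that m(2) by (auto simp: unit_polydisc_def Cn_eq_extensional extensional_def less_Suc_eq)
  define F' where "F' = (\<lambda>x. F (x(n := m n)))"
  have holF': "holomorphic_n n F' ?D"
    unfolding holomorphic_n_def F'_def
  proof (intro conjI ballI allI impI)
    show "continuous_on ?D (\<lambda>x. F (x(n := m n)))"
    proof (rule continuous_on_compose2[OF contF])
      show "continuous_on ?D (\<lambda>x. x(n := m n))"
        by (intro continuous_on_upd continuous_on_id continuous_on_const)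
      show "(\<lambda>x. x(n := m n)) ` ?D \<subseteq> ?D'"
        using updD by auto
    qed
  next
    fix z j assume z: "z \<in> ?D" and j: "j < n"
    have "z(n := m n) \<in> ?D'" by (rule updD[OF z])
    then have "(\<lambda>t. F ((z(n := m n))(j := t))) holomorphic_on {t. (z(n := m n))(j := t) \<in> ?D'}"
      using Suc.prems(1) j by (simp add: holomorphic_n_def)
    moreover have "{t. z(j := t) \<in> ?D} \<subseteq> {t. (z(n := m n))(j := t) \<in> ?D'}"
    proof safe
      fix t assume "z(j := t) \<in> ?D"
      then have "(z(j := t))(n := m n) \<in> ?D'" by (rule updD)
      then show "(z(n := m n))(j := t) \<in> ?D'" using j by (simp add: fun_upd_twist)
    qed
    ultimately show "(\<lambda>t. F ((z(j := t))(n := m n))) holomorphic_on {t. z(j := t) \<in> ?D}"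
      using j by (simp add: fun_upd_twist holomorphic_on_subset)
  qed
  have slice: "(LINT y:?B|lborel. F (x(n := y)) / (1 - m n * cnj y)\<^sup>2) = of_real pi * F' x"
    if x: "x \<in> ?D" and int: "integrable lborel (\<lambda>y. indicator ?D' (x(n := y)) *\<^sub>R F (x(n := y)))" for x
  proof -
    have xC: "x \<in> Cn n" using x by (simp add: unit_polydisc_def)
    have x0: "x(n := 0) \<in> ?D'" using x xC by (simp add: unit_polydisc_upd)
    have "(\<lambda>y. F ((x(n := 0))(n := y))) holomorphic_on {t. (x(n := 0))(n := t) \<in> ?D'}"
      using Suc.prems(1) x0 unfolding holomorphic_n_def by blast
    moreover have "{t. (x(n := 0))(n := t) \<in> ?D'} = ?B"
      using x xC by (auto simp: unit_polydisc_upd)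
    ultimately have "(\<lambda>y. F (x(n := y))) holomorphic_on ?B"
      by (simp only: fun_upd_upd)
    moreover have "(\<lambda>y. indicator ?D' (x(n := y)) *\<^sub>R F (x(n := y))) = (\<lambda>y. indicator ?B y *\<^sub>R F (x(n := y)))"
      using x xC by (auto simp: unit_polydisc_upd indicator_def fun_eq_iff)
    then have "set_integrable lborel ?B (\<lambda>y. F (x(n := y)))"
      using int by (simp add: set_integrable_def)
    ultimately show ?thesis
      using disc_reproducing[of "\<lambda>y. F (x(n := y))" "m n"] m(2) by (simp add: F'_def)
  qed
  have intF: "integrable (lebesgue_Cn (Suc n)) (\<lambda>l. indicator ?D' l *\<^sub>R F l)"
    using Suc.prems(2) by (simp add: set_integrable_def)
  have bp: "bergman_prod (Suc n) p (x(n := y)) = bergman_prod n p x * (1 / (1 - p n * cnj y)\<^sup>2)" for p x y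
    by (simp add: bergman_prod_def)
  \<comment> \<open>Stated for every point with last coordinate \<open>m n\<close>, because it is
    applied both to \<open>m\<close> and to an auxiliary point.\<close>
  have inner: "AE x in lebesgue_Cn n. (LINT y|lborel. indicator ?D' (x(n := y)) *\<^sub>R
      (F (x(n := y)) * bergman_prod (Suc n) p (x(n := y))))
      = indicator ?D x *\<^sub>R (of_real pi * (F' x * bergman_prod n p x))"
    if p: "p n = m n" for p
    using integral_lebesgue_Cn_Suc(1)[OF intF] AE_space
  proof eventually_elim
    case (elim x)
    have xC: "x \<in> Cn n" using elim(2) by (simp add: Cn_eq_space)
    show ?case
    proof (cases "x \<in> ?D")
      case True
      have "(LINT y|lborel. indicator ?D' (x(n := y)) *\<^sub>R (F (x(n := y)) * bergman_prod (Suc n) p (x(n := y))))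
          = (LINT y|lborel. bergman_prod n p x * (indicator ?B y *\<^sub>R (F (x(n := y)) / (1 - m n * cnj y)\<^sup>2)))"
        using True xC
        by (intro Bochner_Integration.integral_cong refl) (auto simp: unit_polydisc_upd indicator_def bp p)
      also have "\<dots> = bergman_prod n p x * (of_real pi * F' x)"
        unfolding integral_mult_right_zero using slice[OF True elim(1)]
        by (simp only: set_lebesgue_integral_def)
      finally show ?thesis using True by simp
    next
      case False
      then have "indicator ?D' (x(n := y)) = (0 :: real)" for y
        using xC by (auto simp: unit_polydisc_upd)
      then show ?thesis using False by simp
    qed
  qed
  \<comment> \<open>With zeros in the first \<open>n\<close> coordinates the kernel depends on the
    last variable only. Integrating that variable out of the integrable product of \<open>F\<close>
    and this kernel leaves \<open>pi * F'\<close>, so \<open>F'\<close> is integrable.\<close>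
  define p where "p = restrict (\<lambda>j. if j = n then m n else 0) {..<Suc n}"
  have p: "p \<in> ?D'" "p n = m n" "bergman_prod n p = (\<lambda>_. 1)"
    using m(2) by (auto simp: p_def unit_polydisc_def Cn_eq_extensional bergman_prod_def fun_eq_iff)
  have "integrable (lebesgue_Cn n) (\<lambda>x. indicator ?D x *\<^sub>R (of_real pi * F' x))"
  proof (rule integrable_cong_AE_imp)
    show "integrable (lebesgue_Cn n) (\<lambda>x. LINT y|lborel. indicator ?D' (x(n := y)) *\<^sub>R
      (F (x(n := y)) * bergman_prod (Suc n) p (x(n := y))))"
      using set_integrable_mult_bergman_prod[OF contF Suc.prems(2) p(1)]
      unfolding set_integrable_def by (rule integral_lebesgue_Cn_Suc(2))
    show "(\<lambda>x. indicator ?D x *\<^sub>R (of_real pi * F' x)) \<in> borel_measurable (lebesgue_Cn n)"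
      using set_borel_measurable_continuous_on[OF sets_unit_polydisc, of n "\<lambda>x. of_real pi * F' x"] holF'
      by (simp add: set_borel_measurable_def holomorphic_n_def continuous_on_mult_left)
    show "AE x in lebesgue_Cn n. (LINT y|lborel. indicator ?D' (x(n := y)) *\<^sub>R
      (F (x(n := y)) * bergman_prod (Suc n) p (x(n := y)))) = indicator ?D x *\<^sub>R (of_real pi * F' x)"
      using inner[of p, OF p(2)] by eventually_elim (simp add: p(3))
  qed
  then have "set_integrable (lebesgue_Cn n) ?D (\<lambda>x. of_real pi * F' x)"
    by (simp add: set_integrable_def)
  then have intF': "set_integrable (lebesgue_Cn n) ?D F'"
    by (simp add: set_integrable_mult_right_iff)
  have "(LINT l:?D'|lebesgue_Cn (Suc n). F l * bergman_prod (Suc n) m l)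
      = (LINT x|lebesgue_Cn n. LINT y|lborel. indicator ?D' (x(n := y)) *\<^sub>R
      (F (x(n := y)) * bergman_prod (Suc n) m (x(n := y))))"
    using set_integrable_mult_bergman_prod[OF contF Suc.prems(2,3)]
    unfolding set_integrable_def set_lebesgue_integral_def by (rule integral_lebesgue_Cn_Suc(3))
  also have "\<dots> = (LINT x|lebesgue_Cn n. indicator ?D x *\<^sub>R (of_real pi * (F' x * bergman_prod n m x)))"
  proof (rule integral_cong_AE)
    show "(\<lambda>x. LINT y|lborel. indicator ?D' (x(n := y)) *\<^sub>R
      (F (x(n := y)) * bergman_prod (Suc n) m (x(n := y)))) \<in> borel_measurable (lebesgue_Cn n)"
      using set_integrable_mult_bergman_prod[OF contF Suc.prems(2,3)]
      unfolding set_integrable_def by (intro borel_measurable_integrable integral_lebesgue_Cn_Suc(2))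
    have "continuous_on ?D (bergman_prod n m)"
      using continuous_on_bergman_prod[OF m(1)] by (simp add: bergman_prod_restrict)
    then show "(\<lambda>x. indicator ?D x *\<^sub>R (of_real pi * (F' x * bergman_prod n m x))) \<in> borel_measurable (lebesgue_Cn n)"
      using set_borel_measurable_continuous_on[OF sets_unit_polydisc, of n "\<lambda>x. of_real pi * (F' x * bergman_prod n m x)"] holF'
      by (simp add: set_borel_measurable_def holomorphic_n_def continuous_on_mult continuous_on_mult_left)
  qed (rule inner[of m, OF refl])
  also have "\<dots> = (LINT x:?D|lebesgue_Cn n. of_real pi * (F' x * bergman_prod n ?m x))"
    unfolding set_lebesgue_integral_def bergman_prod_restrict ..
  also have "\<dots> = of_real pi * (LINT x:?D|lebesgue_Cn n. F' x * bergman_prod n ?m x)"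
    by (rule set_integral_mult_right)
  also have "\<dots> = of_real pi * (of_real pi ^ n * F' ?m)"
    unfolding Suc.IH[OF holF' intF' m(1)] ..
  also have "F' ?m = F m" using m(3) by (simp add: F'_def)
  finally show ?case by simp
qed

section \<open>Separately holomorphic functions and the symmetrized polydisc\<close>

text \<open>Split \<open>F t t - F a a\<close> at \<open>F a t\<close>. The part with first argument
  \<open>a\<close> has a derivative in \<open>t\<close>; the other part is
  \<open>(t - a) * Q (t, t)\<close> for a Cauchy integral \<open>Q\<close> that is jointly
  continuous. This is the portion of Osgood's theorem needed to restrict separately holomorphic
  functions to lines.\<close>

lemma field_differentiable_diagonal:
  fixes F :: "complex \<Rightarrow> complex \<Rightarrow> complex"
  assumes r: "0 < r"
    and cont: "continuous_on (cball a r \<times> cball a r) (\<lambda>(s, t). F s t)"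
    and hol1: "\<And>t. t \<in> cball a r \<Longrightarrow> (\<lambda>s. F s t) holomorphic_on cball a r"
    and hol2: "F a holomorphic_on cball a r"
  shows "(\<lambda>t. F t t) field_differentiable (at a)"
proof -
  define \<gamma> where "\<gamma> = (\<lambda>x::real. a + r * exp (2 * pi * \<i> * x))"
  have g: "cmod (\<gamma> x - a) = r" for x using r by (simp add: \<gamma>_def norm_mult)
  have g_in: "\<gamma> x \<in> cball a r" for x using g[of x] by (simp add: dist_norm norm_minus_commute)
  have g_ne: "\<gamma> x \<noteq> s" if "s \<in> ball a r" for x s
    using g[of x] that by (auto simp: dist_norm norm_minus_commute)
  have g_cont: "continuous_on A \<gamma>" for A unfolding \<gamma>_def by (intro continuous_intros)
  \<comment> \<open>The difference quotient of Cauchy's formula in the first variable, taken between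
    \<open>s\<close> and \<open>a\<close>. It also makes sense at \<open>s = a\<close>, where it
    gives the partial derivative.\<close>
  define Q where "Q = (\<lambda>(s, t). integral (cbox 0 1)
      (\<lambda>x. F (\<gamma> x) t / ((\<gamma> x - s) * (\<gamma> x - a)) * (r * exp (2 * pi * \<i> * x))))"
  have Qcont: "continuous_on (ball a r \<times> cball a r) Q"
    unfolding Q_def case_prod_beta'
  proof (rule integral_continuous_on_param)
    have "continuous_on ((ball a r \<times> cball a r) \<times> cbox 0 1) (\<lambda>z. (\<lambda>(s, t). F s t) (\<gamma> (snd z), snd (fst z)))"
      by (rule continuous_on_compose2[OF cont])
         (auto intro!: continuous_intros continuous_on_compose2[OF g_cont[of UNIV]] simp: g_in[simplified])
    then show "continuous_on ((ball a r \<times> cball a r) \<times> cbox 0 1)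
      (\<lambda>(p, x). F (\<gamma> x) (snd p) / ((\<gamma> x - fst p) * (\<gamma> x - a)) * (r * exp (2 * pi * \<i> * x)))"
      unfolding case_prod_beta'
      using g_ne r by (intro continuous_intros continuous_on_compose2[OF g_cont[of UNIV]])
         (auto simp: case_prod_beta')
  qed
  have cauchy: "((\<lambda>x. F (\<gamma> x) t / (\<gamma> x - s) * (r * exp (2 * pi * \<i> * x))) has_integral F s t) {0..1}"
    if s: "s \<in> ball a r" and t: "t \<in> cball a r" for s t
  proof -
    have "((\<lambda>u. F u t / (u - s)) has_contour_integral 2 * of_real pi * \<i> * F s t) (circlepath a r)"
      using s by (intro Cauchy_integral_circlepath_simple hol1[OF t]) (simp add: dist_norm norm_minus_commute)
    then have *: "((\<lambda>x. F (circlepath a r x) t / (circlepath a r x - s) *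
        vector_derivative (circlepath a r) (at x within {0..1})) has_integral 2 * of_real pi * \<i> * F s t) {0..1}"
      by (simp add: has_contour_integral_def)
    have "((\<lambda>x. 2 * of_real pi * \<i> * (F (\<gamma> x) t / (\<gamma> x - s) * (r * exp (2 * pi * \<i> * x))))
        has_integral 2 * of_real pi * \<i> * F s t) {0..1}"
    proof (rule has_integral_eq[OF _ *])
      fix x :: real assume "x \<in> {0..1}"
      then have "vector_derivative (circlepath a r) (at x within {0..1}) = 2 * pi * \<i> * r * exp (2 * pi * \<i> * x)"
        by (subst vector_derivative_circlepath01) (auto simp: mult_ac)
      moreover have "circlepath a r x = \<gamma> x"
        by (simp add: circlepath \<gamma>_def mult_ac)
      ultimately show "F (circlepath a r x) t / (circlepath a r x - s) *
        vector_derivative (circlepath a r) (at x within {0..1})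
        = 2 * of_real pi * \<i> * (F (\<gamma> x) t / (\<gamma> x - s) * (r * exp (2 * pi * \<i> * x)))"
        by simp
    qed
    then show ?thesis
      by (subst (asm) has_integral_mult_right_iff) auto
  qed
  have quot: "F s t - F a t = (s - a) * Q (s, t)" if s: "s \<in> ball a r" and t: "t \<in> cball a r" for s t
  proof -
    have "a \<in> ball a r" using r by simp
    from has_integral_diff[OF cauchy[OF s t] cauchy[OF this t]]
    have *: "((\<lambda>x. F (\<gamma> x) t / (\<gamma> x - s) * (r * exp (2 * pi * \<i> * x)) - F (\<gamma> x) t / (\<gamma> x - a) * (r * exp (2 * pi * \<i> * x)))
        has_integral F s t - F a t) {0..1}" .
    have "F (\<gamma> x) t / (\<gamma> x - s) * (r * exp (2 * pi * \<i> * x)) - F (\<gamma> x) t / (\<gamma> x - a) * (r * exp (2 * pi * \<i> * x))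
       = (s - a) * (F (\<gamma> x) t / ((\<gamma> x - s) * (\<gamma> x - a)) * (r * exp (2 * pi * \<i> * x)))" for x
    proof -
      have nz: "\<gamma> x - s \<noteq> 0" "\<gamma> x - a \<noteq> 0" using g_ne[OF s] g_ne[OF \<open>a \<in> ball a r\<close>] by auto
      have "1 / (\<gamma> x - s) - 1 / (\<gamma> x - a) = (s - a) / ((\<gamma> x - s) * (\<gamma> x - a))"
        using nz by (simp add: field_simps)
      then have "F (\<gamma> x) t * (r * exp (2 * pi * \<i> * x)) * (1 / (\<gamma> x - s) - 1 / (\<gamma> x - a))
          = F (\<gamma> x) t * (r * exp (2 * pi * \<i> * x)) * ((s - a) / ((\<gamma> x - s) * (\<gamma> x - a)))"
        by (rule arg_cong)
      then show ?thesis by (simp add: right_diff_distrib mult_ac)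
    qed
    then have "F s t - F a t = integral {0..1} (\<lambda>x. (s - a) * (F (\<gamma> x) t / ((\<gamma> x - s) * (\<gamma> x - a)) * (r * exp (2 * pi * \<i> * x))))"
      using integral_unique[OF *] by simp
    also have "\<dots> = (s - a) * integral {0..1} (\<lambda>x. F (\<gamma> x) t / ((\<gamma> x - s) * (\<gamma> x - a)) * (r * exp (2 * pi * \<i> * x)))"
      by (rule integral_mult_right)
    finally show ?thesis by (simp only: Q_def case_prod_conv cbox_interval)
  qed
  have "(F a has_field_derivative deriv (F a) a) (at a)"
    using hol2 r by (intro holomorphic_derivI[of _ "ball a r"]) (auto intro: holomorphic_on_subset)
  then have d: "((\<lambda>t. (F a t - F a a) / (t - a)) \<longlongrightarrow> deriv (F a) a) (at a)"
    by (simp add: has_field_derivative_iff)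
  have "continuous_on (ball a r) (\<lambda>t. Q (t, t))"
    by (rule continuous_on_compose2[OF Qcont]) (auto intro!: continuous_intros)
  then have q: "((\<lambda>t. Q (t, t)) \<longlongrightarrow> Q (a, a)) (at a)"
    using r by (simp add: continuous_on_eq_continuous_at isCont_def)
  have "((\<lambda>t. (F t t - F a a) / (t - a)) \<longlongrightarrow> Q (a, a) + deriv (F a) a) (at a)"
  proof (rule Lim_transform_eventually[OF tendsto_add[OF q d]])
    have "\<forall>\<^sub>F t in at a. t \<in> ball a r - {a}"
      using r by (intro eventually_at_in_open) auto
    then show "\<forall>\<^sub>F t in at a. Q (t, t) + (F a t - F a a) / (t - a) = (F t t - F a a) / (t - a)"
    proof eventually_elim
      case (elim t)
      then have "F t t - F a t = (t - a) * Q (t, t)"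
        using quot[of t t] by simp
      moreover have "F t t - F a a = (F t t - F a t) + (F a t - F a a)" by simp
      ultimately have e: "F t t - F a a = (t - a) * Q (t, t) + (F a t - F a a)"
        by (simp only:)
      have "t - a \<noteq> 0" using elim by auto
      then show ?case unfolding e by (simp add: add_divide_distrib)
    qed
  qed
  then show ?thesis
    unfolding field_differentiable_def has_field_derivative_iff by blast
qed

text \<open>Induction on the number \<open>m\<close> of moving coordinates. Giving the newest
  coordinate its own parameter yields a function of two variables, holomorphic in the first by
  induction and in the second by \<open>holomorphic_n\<close>; the diagonal lemma then identifies
  the parameters.\<close>

lemma holomorphic_n_affine_initial:
  fixes a b :: "nat \<Rightarrow> complex"
  assumes f: "holomorphic_n n f (U \<inter> Cn n)" and U: "open U"
    and "m \<le> n" "a \<in> Cn n"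
    and "(\<lambda>i. if i < m then a i + t * b i else a i) \<in> U"
  shows "(\<lambda>t. f (\<lambda>i. if i < m then a i + t * b i else a i)) field_differentiable (at t)"
  using assms(3-)
proof (induction m arbitrary: a t)
  case 0
  then show ?case by simp
next
  case (Suc m)
  \<comment> \<open>The first \<open>m\<close> coordinates move with \<open>s\<close>, coordinate
    \<open>m\<close> moves with \<open>t\<close>.\<close>
  define P where "P = (\<lambda>s t i. if i < m then a i + s * b i else if i = m then a i + t * b i else a i)"
  have PC: "P s t \<in> Cn n" for s t
    using Suc.prems(1,2) by (auto simp: P_def Cn_eq_extensional extensional_def)
  have Pdiag: "P t t = (\<lambda>i. if i < Suc m then a i + t * b i else a i)" for t
    by (auto simp: P_def fun_eq_iff)
  have Pcont: "continuous_on A (\<lambda>z. P (fst z) (snd z))" for A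
  proof (rule continuous_on_coordinatewise_then_product)
    fix i show "continuous_on A (\<lambda>z. P (fst z) (snd z) i)"
      unfolding P_def by (cases "i < m"; cases "i = m") (auto intro!: continuous_intros)
  qed
  have "open ((\<lambda>z. P (fst z) (snd z)) -` U)"
    using Pcont[of UNIV] U by (simp add: continuous_on_open_vimage)
  moreover have "(t, t) \<in> (\<lambda>z. P (fst z) (snd z)) -` U"
    using Suc.prems(3) by (simp add: Pdiag)
  ultimately obtain A B where AB: "open A" "open B" "t \<in> A" "t \<in> B" "A \<times> B \<subseteq> (\<lambda>z. P (fst z) (snd z)) -` U"
    by (rule open_prod_elim) auto
  then have "open (A \<inter> B)" "t \<in> A \<inter> B" by auto
  then obtain r where r: "0 < r" "cball t r \<subseteq> A \<inter> B"
    using open_contains_cball[of "A \<inter> B"] by metis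
  have PU: "P s u \<in> U \<inter> Cn n" if "s \<in> cball t r" "u \<in> cball t r" for s u
  proof -
    have "(s, u) \<in> A \<times> B" using that r(2) by blast
    then have "P s u \<in> U" using AB(5) by auto
    then show ?thesis using PC by simp
  qed
  have contf: "continuous_on (U \<inter> Cn n) f" using f by (simp add: holomorphic_n_def)
  have "(\<lambda>t. f (P t t)) field_differentiable (at t)"
  proof (rule field_differentiable_diagonal[OF r(1), where F = "\<lambda>s u. f (P s u)"])
    show "continuous_on (cball t r \<times> cball t r) (\<lambda>(s, u). f (P s u))"
      unfolding case_prod_beta'
      by (rule continuous_on_compose2[OF contf Pcont]) (use PU in auto)
  next
    fix u assume u: "u \<in> cball t r"
    define a' where "a' = a(m := a m + u * b m)"
    have a': "a' \<in> Cn n" using Suc.prems(1,2) by (auto simp: a'_def Cn_eq_extensional extensional_def)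
    have Pa: "P s u = (\<lambda>i. if i < m then a' i + s * b i else a' i)" for s
      by (auto simp: P_def a'_def fun_eq_iff)
    show "(\<lambda>s. f (P s u)) holomorphic_on cball t r"
      unfolding holomorphic_on_def
    proof
      fix s assume s: "s \<in> cball t r"
      have "(\<lambda>s. f (P s u)) field_differentiable (at s)"
        unfolding Pa using Suc.prems(1) PU[OF s u] a' by (intro Suc.IH) (auto simp: Pa)
      then show "(\<lambda>s. f (P s u)) field_differentiable (at s within cball t r)"
        by (rule field_differentiable_at_within)
    qed
  next
    have t: "t \<in> cball t r" using r(1) by simp
    have h: "(\<lambda>u. f ((P t t)(m := u))) holomorphic_on {u. (P t t)(m := u) \<in> U \<inter> Cn n}"
      using f PU[OF t t] Suc.prems(1) by (simp add: holomorphic_n_def)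
    have eq: "(P t t)(m := a m + u * b m) = P t u" for u
      by (auto simp: P_def fun_eq_iff)
    have "(\<lambda>u. f ((P t t)(m := a m + u * b m))) holomorphic_on cball t r"
      by (rule holomorphic_on_compose_gen[OF _ h, unfolded o_def])
         (use PU[OF t] in \<open>auto intro!: holomorphic_intros simp del: fun_upd_apply simp: eq\<close>)
    then show "(\<lambda>u. f (P t u)) holomorphic_on cball t r"
      by (simp only: eq)
  qed
  then show ?case by (simp add: Pdiag)
qed

lemma holomorphic_n_affine:
  fixes a b :: "nat \<Rightarrow> complex"
  assumes f: "holomorphic_n n f (U \<inter> Cn n)" and U: "open U"
    and "restrict (\<lambda>i. a i + t * b i) {..<n} \<in> U"
  shows "(\<lambda>t. f (restrict (\<lambda>i. a i + t * b i) {..<n})) field_differentiable (at t)"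
proof -
  have "restrict (\<lambda>i. a i + t * b i) {..<n}
      = (\<lambda>i. if i < n then (restrict a {..<n}) i + t * b i else (restrict a {..<n}) i)" for t
    by (auto simp: fun_eq_iff)
  then show ?thesis
    using holomorphic_n_affine_initial[OF f U order_refl, of "restrict a {..<n}" t b] assms(3)
    by (simp add: Cn_eq_extensional)
qed

text \<open>Every monomial contains a given variable at most once. Hence moving one root moves the
  symmetrization along a complex line.\<close>

lemma elem_sym_upd_affine:
  "elem_sym n k (l(j := t)) = elem_sym n k (l(j := 0)) + t * (elem_sym n k (l(j := 1)) - elem_sym n k (l(j := 0)))"
proof -
  have "(\<Prod>i\<in>S. (l(j := t)) i) = (\<Prod>i\<in>S. (l(j := 0)) i) + t * ((\<Prod>i\<in>S. (l(j := 1)) i) - (\<Prod>i\<in>S. (l(j := 0)) i))"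
    if S: "finite S" for S
  proof (cases "j \<in> S")
    case True
    have "(\<Prod>i\<in>S. (l(j := u)) i) = u * (\<Prod>i\<in>S - {j}. l i)" for u
      using S True by (subst prod.remove[of S j]) (auto intro!: prod.cong)
    then show ?thesis by simp
  next
    case False
    then have "(\<Prod>i\<in>S. (l(j := u)) i) = (\<Prod>i\<in>S. l i)" for u
      by (intro prod.cong) auto
    then show ?thesis by simp
  qed
  then show ?thesis
    unfolding elem_sym_def sum_subtractf[symmetric] sum_distrib_left sum.distrib[symmetric]
    by (intro sum.cong) (auto intro: finite_subset)
qed

section \<open>Topology of the symmetrized polydisc: surjectivity and properness of the
  symmetrization map\<close>

lemma sym_map_in_Cn: "sym_map n l \<in> Cn n"
  by (simp add: sym_map_def Cn_eq_extensional)

lemma symmetrized_polydisc_subset: "symmetrized_polydisc n \<subseteq> Cn n"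
  using sym_map_in_Cn by (auto simp: symmetrized_polydisc_def)

text \<open>The fundamental theorem of algebra supplies one root \<open>t\<close> of the polynomial
  that expresses the last coefficient; dividing it out by \<open>shear\<close> leaves a tuple of one
  coordinate less.\<close>

lemma sym_map_surj:
  assumes "z \<in> Cn n"
  obtains l where "l \<in> Cn n" "sym_map n l = z"
proof -
  have "\<exists>l\<in>Cn n. sym_map n l = z"
    using assms
  proof (induction n arbitrary: z)
    case 0
    then show ?case by (auto simp: sym_map_def Cn_eq_extensional fun_eq_iff extensional_def)
  next
    case (Suc n)
    let ?z = "restrict z {..<n}"
    have "degree (shear_poly z n - [:z n:]) = Suc n"
    proof -
      have e: "shear_poly z n - [:z n:] = shear_poly z n + [:- z n:]" by simp
      show ?thesis
        unfolding e by (subst degree_add_eq_left) (auto simp: degree_shear_poly)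
    qed
    then have "\<not> constant (poly (shear_poly z n - [:z n:]))"
      by (simp add: constant_degree)
    then obtain t where "poly (shear_poly z n - [:z n:]) t = 0"
      using fundamental_theorem_of_algebra by blast
    then have t: "poly (shear_poly z n) t = z n" by simp
    have "shear n t ?z \<in> Cn n" by (simp add: shear_def Cn_eq_extensional)
    from Suc.IH[OF this] obtain l where l: "l \<in> Cn n" "sym_map n l = shear n t ?z"
      by blast
    have "shear_poly ?z n = shear_poly z n" by (rule shear_poly_cong) simp
    then have "sym_map (Suc n) (l(n := t)) = ?z(n := z n)"
      using t by (simp add: sym_map_Suc l(2) adjoin_root_shear)
    also have "\<dots> = z"
      using Suc.prems by (auto simp: Cn_eq_extensional extensional_def fun_eq_iff less_Suc_eq)
    finally have "sym_map (Suc n) (l(n := t)) = z" .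
    moreover have "l(n := t) \<in> Cn (Suc n)"
      using l(1) by (auto simp: Cn_eq_extensional extensional_def less_Suc_eq)
    ultimately show ?case by blast
  qed
  then show ?thesis using that by blast
qed

lemma sym_map_eqD:
  assumes "sym_map n l = sym_map n l'" "j < n"
  obtains i where "i < n" "l' j = l i"
proof -
  have "(\<Prod>i<n. l' j - l i) = (\<Prod>i<n. l' j - l' i)"
    using assms(1) by (metis char_poly_sym_map)
  also have "\<dots> = 0" using assms(2) by auto
  finally show ?thesis using that by auto
qed

text \<open>For a root of modulus above 1, the leading power in the characteristic equation is
  bounded by \<open>n\<close> terms, each at most \<open>M\<close> times the next lower power.
  Bounded coefficients thus have bounded roots, which is the properness used for openness.\<close>

lemma norm_root_le:
  assumes M: "\<And>i. i < n \<Longrightarrow> cmod (sym_map n l i) \<le> M" "1 \<le> M" and j: "j < n"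
  shows "cmod (l j) \<le> of_nat n * M"
proof (cases "cmod (l j) \<le> 1")
  case True
  have "1 * 1 \<le> of_nat n * M" using j M(2) by (intro mult_mono) auto
  then show ?thesis using True by simp
next
  case False
  let ?t = "l j"
  obtain m where n: "n = Suc m" using j by (cases n) auto
  define S where "S = (\<Sum>k\<le>m. (- 1) ^ Suc k * sym_map n l k * ?t ^ (m - k))"
  have "char_poly n ?t (sym_map n l) = 0"
    unfolding char_poly_sym_map using j by auto
  moreover have "char_poly n ?t (sym_map n l) = ?t ^ n + S"
    unfolding char_poly_def S_def n by (subst sum.atMost_Suc_shift) simp
  ultimately have e: "?t ^ n = - S" by (simp only: eq_neg_iff_add_eq_0)
  have "cmod ?t ^ n = cmod (?t ^ n)" by (simp add: norm_power)
  also have "\<dots> = cmod S" unfolding e by (rule norm_minus_cancel)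
  also have "\<dots> \<le> (\<Sum>k\<le>m. M * cmod ?t ^ m)"
    unfolding S_def
  proof (rule sum_norm_le)
    fix k assume k: "k \<in> {..m}"
    have "cmod (sym_map n l k) * cmod ?t ^ (m - k) \<le> M * cmod ?t ^ m"
      using M k False by (intro mult_mono power_increasing) (auto simp: n)
    then show "cmod ((- 1) ^ Suc k * sym_map n l k * ?t ^ (m - k)) \<le> M * cmod ?t ^ m"
      by (simp add: norm_mult norm_power)
  qed
  also have "\<dots> = (of_nat n * M) * cmod ?t ^ m" by (simp add: n)
  finally have "cmod ?t * cmod ?t ^ m \<le> (of_nat n * M) * cmod ?t ^ m" by (simp add: n)
  moreover have "0 < cmod ?t ^ m" using False by (intro zero_less_power) auto
  ultimately show ?thesis by (rule mult_right_le_imp_le)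
qed

lemma continuous_on_elem_sym: "continuous_on A (elem_sym n k)"
  unfolding elem_sym_def
  by (intro continuous_on_sum continuous_on_prod) (auto intro: continuous_on_subset[OF continuous_on_product_coordinates])

lemma continuous_on_sym_map: "continuous_on A (sym_map n)"
proof (rule continuous_on_coordinatewise_then_product)
  fix i show "continuous_on A (\<lambda>l. sym_map n l i)"
    by (cases "i < n") (auto simp: sym_map_def continuous_on_elem_sym)
qed

lemma compact_closed_polydisc: "compact {l \<in> Cn n. \<forall>j<n. cmod (l j) \<le> R}"
proof -
  have "compactin (product_topology (\<lambda>_. euclidean) UNIV) (PiE UNIV (\<lambda>i. if i < n then cball (0::complex) R else {undefined}))"
    by (subst compactin_PiE) auto
  then have "compact (PiE UNIV (\<lambda>i. if i < n then cball (0::complex) R else {undefined}))"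
    by (simp add: euclidean_product_topology)
  also have "PiE UNIV (\<lambda>i. if i < n then cball (0::complex) R else {undefined}) = {l \<in> Cn n. \<forall>j<n. cmod (l j) \<le> R}"
    by (auto simp: PiE_def Pi_def Cn_eq_extensional extensional_def split: if_splits)
  finally show ?thesis .
qed

text \<open>Openness is relative to \<open>Cn n\<close>, which is not open in the ambient function
  space. Bounded root tuples with some entry outside the open disc form a compact set, whose image
  is closed and misses \<open>z\<close>, since \<open>z\<close> determines its set of roots. Nearby
  points of \<open>Cn n\<close> have bounded roots, hence roots inside the disc.\<close>

lemma symmetrized_polydisc_open:
  obtains U where "open U" "symmetrized_polydisc n = U \<inter> Cn n"
proof -
  have "\<exists>V. open V \<and> z \<in> V \<and> V \<inter> Cn n \<subseteq> symmetrized_polydisc n" if z: "z \<in> symmetrized_polydisc n" for z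
  proof -
    obtain l where l: "l \<in> unit_polydisc n" "z = sym_map n l"
      using z by (auto simp: symmetrized_polydisc_def)
    \<comment> \<open>Strictly larger than every coordinate of \<open>z\<close>, so that nearby
      points obey the same bound, and at least 1 as \<open>norm_root_le\<close> requires.\<close>
    define M where "M = 1 + (\<Sum>i<n. cmod (z i))"
    have zM: "cmod (z i) < M" if "i < n" for i
      using that member_le_sum[of i "{..<n}" "\<lambda>i. cmod (z i)"] by (simp add: M_def)
    have M1: "1 \<le> M" by (simp add: M_def sum_nonneg)
    define K where "K = {l \<in> Cn n. \<forall>j<n. cmod (l j) \<le> of_nat n * M} \<inter> (\<Union>j<n. {l. 1 \<le> cmod (l j)})"
    have "closed (\<Union>j<n. {l :: nat \<Rightarrow> complex. 1 \<le> cmod (l j)})"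
      by (intro closed_UN ballI closed_Collect_le continuous_intros) auto
    then have "compact K" unfolding K_def by (intro compact_Int_closed compact_closed_polydisc)
    then have "closed (sym_map n ` K)"
      by (intro compact_imp_closed compact_continuous_image continuous_on_sym_map)
    moreover have "open (\<Inter>i<n. {w :: nat \<Rightarrow> complex. cmod (w i) < M})"
      by (intro open_INT ballI open_Collect_less continuous_intros) auto
    ultimately have "open ((\<Inter>i<n. {w. cmod (w i) < M}) - sym_map n ` K)" by (intro open_Diff)
    moreover have "z \<notin> sym_map n ` K"
    proof
      assume "z \<in> sym_map n ` K"
      then obtain l' j where l': "sym_map n l = sym_map n l'" "j < n" "1 \<le> cmod (l' j)"
        using l(2) by (auto simp: K_def)
      then obtain i where "i < n" "l' j = l i" using sym_map_eqD by blast
      then show False using l(1) l'(3) by (auto simp: unit_polydisc_def)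
    qed
    moreover have "w \<in> symmetrized_polydisc n"
      if w: "w \<in> Cn n" "w \<in> (\<Inter>i<n. {w. cmod (w i) < M})" "w \<notin> sym_map n ` K" for w
    proof -
      obtain l where l: "l \<in> Cn n" "sym_map n l = w" using sym_map_surj[OF w(1)] .
      have "cmod (l j) \<le> of_nat n * M" if "j < n" for j
        using w(2) l(2) by (intro norm_root_le[OF _ M1 that]) (auto intro: less_imp_le)
      moreover have "l \<notin> K" using w(3) l(2) by auto
      ultimately have "\<forall>j<n. cmod (l j) < 1" using l(1) by (force simp: K_def)
      then show ?thesis using l by (auto simp: symmetrized_polydisc_def unit_polydisc_def)
    qed
    ultimately show ?thesis
      using zM by (intro exI[of _ "(\<Inter>i<n. {w. cmod (w i) < M}) - sym_map n ` K"]) auto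
  qed
  then obtain V where V: "\<And>z. z \<in> symmetrized_polydisc n \<Longrightarrow> open (V z) \<and> z \<in> V z \<and> V z \<inter> Cn n \<subseteq> symmetrized_polydisc n"
    by metis
  show ?thesis
  proof (rule that)
    show "open (\<Union>z\<in>symmetrized_polydisc n. V z)" using V by (intro open_UN) auto
    show "symmetrized_polydisc n = (\<Union>z\<in>symmetrized_polydisc n. V z) \<inter> Cn n"
      using V symmetrized_polydisc_subset by blast
  qed
qed

lemma sets_symmetrized_polydisc: "symmetrized_polydisc n \<in> sets (lebesgue_Cn n)"
  using symmetrized_polydisc_open[of n] sets_lebesgue_Cn_open by metis

lemma sym_map_mem_iff:
  assumes "l \<in> Cn n"
  shows "sym_map n l \<in> symmetrized_polydisc n \<longleftrightarrow> l \<in> unit_polydisc n"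
proof
  assume "sym_map n l \<in> symmetrized_polydisc n"
  then obtain l' where l': "l' \<in> unit_polydisc n" "sym_map n l' = sym_map n l"
    by (auto simp: symmetrized_polydisc_def)
  have "cmod (l j) < 1" if jn: "j < n" for j
  proof -
    obtain i where "i < n" "l j = l' i" using sym_map_eqD[OF l'(2) jn] .
    then show ?thesis using l'(1) by (simp add: unit_polydisc_def)
  qed
  then show "l \<in> unit_polydisc n" using assms by (simp add: unit_polydisc_def)
qed (simp add: symmetrized_polydisc_def)

text \<open>Each single variable runs along a complex line in the target, so
  \<open>holomorphic_n_affine\<close> applies in place of a general composition theorem in several
  variables.\<close>

lemma holomorphic_n_comp_sym_map:
  assumes f: "holomorphic_n n f (symmetrized_polydisc n)"
  shows "holomorphic_n n (\<lambda>l. f (sym_map n l)) (unit_polydisc n)"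
proof -
  obtain U where U: "open U" "symmetrized_polydisc n = U \<inter> Cn n" by (rule symmetrized_polydisc_open)
  show ?thesis
    unfolding holomorphic_n_def
  proof (intro conjI ballI allI impI)
    have "continuous_on (symmetrized_polydisc n) f" using f by (simp add: holomorphic_n_def)
    then show "continuous_on (unit_polydisc n) (\<lambda>l. f (sym_map n l))"
      by (rule continuous_on_compose2[OF _ continuous_on_sym_map]) (simp add: symmetrized_polydisc_def)
  next
    fix l j assume l: "l \<in> unit_polydisc n" and j: "j < n"
    define a where "a = (\<lambda>i. elem_sym n (Suc i) (l(j := 0)))"
    define b where "b = (\<lambda>i. elem_sym n (Suc i) (l(j := 1)) - elem_sym n (Suc i) (l(j := 0)))"
    have eq: "sym_map n (l(j := t)) = restrict (\<lambda>i. a i + t * b i) {..<n}" for t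
      unfolding sym_map_def a_def b_def by (intro restrict_ext elem_sym_upd_affine)
    show "(\<lambda>t. f (sym_map n (l(j := t)))) holomorphic_on {t. l(j := t) \<in> unit_polydisc n}"
      unfolding holomorphic_on_def
    proof
      fix t assume "t \<in> {t. l(j := t) \<in> unit_polydisc n}"
      then have "sym_map n (l(j := t)) \<in> U" using U(2) by (auto simp: symmetrized_polydisc_def)
      then have "(\<lambda>t. f (sym_map n (l(j := t)))) field_differentiable (at t)"
        unfolding eq using f U by (intro holomorphic_n_affine) auto
      then show "(\<lambda>t. f (sym_map n (l(j := t)))) field_differentiable (at t within {t. l(j := t) \<in> unit_polydisc n})"
        by (rule field_differentiable_at_within)
    qed
  qed
qed

section \<open>Dividing the determinant by the Vandermonde products\<close>

text \<open>Polynomials in the coordinates of two points, kept as functions: closure under ring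
  operations, continuity and holomorphy are all that the quotient of the determinant has to
  provide.\<close>

inductive poly_fun :: "((nat \<Rightarrow> complex) \<times> (nat \<Rightarrow> complex) \<Rightarrow> complex) \<Rightarrow> bool" where
  poly_fun_const: "poly_fun (\<lambda>_. c)"
| poly_fun_fst: "poly_fun (\<lambda>x. fst x i)"
| poly_fun_snd: "poly_fun (\<lambda>x. snd x i)"
| poly_fun_add: "poly_fun f \<Longrightarrow> poly_fun g \<Longrightarrow> poly_fun (\<lambda>x. f x + g x)"
| poly_fun_mult: "poly_fun f \<Longrightarrow> poly_fun g \<Longrightarrow> poly_fun (\<lambda>x. f x * g x)"

lemma poly_fun_sum: "(\<And>i. i \<in> A \<Longrightarrow> poly_fun (f i)) \<Longrightarrow> poly_fun (\<lambda>x. \<Sum>i\<in>A. f i x)"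
  by (induction A rule: infinite_finite_induct) (auto intro: poly_fun.intros)

lemma poly_fun_prod: "(\<And>i. i \<in> A \<Longrightarrow> poly_fun (f i)) \<Longrightarrow> poly_fun (\<lambda>x. \<Prod>i\<in>A. f i x)"
  by (induction A rule: infinite_finite_induct) (auto intro: poly_fun.intros)

lemma poly_fun_esc: "poly_fun (\<lambda>x. esc (fst x) i)" "poly_fun (\<lambda>x. esc (snd x) i)"
  by (cases i; simp add: poly_fun.intros)+

lemma poly_fun_det:
  assumes "\<And>i j. poly_fun (f i j)"
  shows "poly_fun (\<lambda>x. Determinant.det (Matrix.mat n n (\<lambda>(i, j). f i j x)))"
proof -
  have "Determinant.det (Matrix.mat n n (\<lambda>(i, j). f i j x))
      = (\<Sum>p | p permutes {0..<n}. signof p * (\<Prod>i = 0..<n. f i (p i) x))" for x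
    by (subst det_def'[of _ n]) (auto intro!: sum.cong prod.cong simp: permutes_in_image)
  then show ?thesis
    using assms by (simp only:) (intro poly_fun_sum poly_fun_mult poly_fun_prod poly_fun_const)
qed

lemma poly_fun_continuous: "poly_fun f \<Longrightarrow> continuous_on A f"
proof (induction rule: poly_fun.induct)
  case (poly_fun_fst i)
  show ?case
    by (rule continuous_on_product_then_coordinatewise) (intro continuous_intros)
next
  case (poly_fun_snd i)
  show ?case
    by (rule continuous_on_product_then_coordinatewise) (intro continuous_intros)
qed (auto intro: continuous_intros)

lemma poly_fun_holomorphic: "poly_fun f \<Longrightarrow> (\<lambda>t. f (z(j := t), w)) holomorphic_on A"
proof (induction rule: poly_fun.induct)
  case (poly_fun_fst i)
  show ?case by (cases "i = j") (auto intro!: holomorphic_intros)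
qed (auto intro!: holomorphic_intros)

text \<open>Expressions in \<open>l\<^sub>j\<close> and \<open>b\<^sub>k\<close> that reduce, modulo the monic polynomials with roots \<open>l\<close> and \<open>b\<close>, to
  polynomials of degree less than \<open>n\<close> whose coefficients depend only on the symmetrizations.
  A matrix of such entries factors through the Vandermonde matrices of \<open>l\<close> and \<open>b\<close>.\<close>

definition sym_rep :: "nat \<Rightarrow> ((nat \<Rightarrow> complex) \<Rightarrow> (nat \<Rightarrow> complex) \<Rightarrow> nat \<Rightarrow> nat \<Rightarrow> complex) \<Rightarrow> bool" where
  "sym_rep n F \<longleftrightarrow> (\<exists>M. (\<forall>i m. poly_fun (M i m)) \<and>
    (\<forall>l b. \<forall>j<n. \<forall>k<n. F l b j k =
      (\<Sum>i<n. \<Sum>m<n. l j ^ i * M i m (sym_map n l, sym_map n b) * b k ^ m)))"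

lemma sym_repE:
  assumes "sym_rep n F"
  obtains M where "\<And>i m. poly_fun (M i m)" "\<And>l b j k. j < n \<Longrightarrow> k < n \<Longrightarrow> F l b j k =
      (\<Sum>i<n. \<Sum>m<n. l j ^ i * M i m (sym_map n l, sym_map n b) * b k ^ m)"
  using assms unfolding sym_rep_def by blast

lemma sym_rep_cong:
  assumes "sym_rep n F" "\<And>l b j k. j < n \<Longrightarrow> k < n \<Longrightarrow> G l b j k = F l b j k"
  shows "sym_rep n G"
  using assms by (simp add: sym_rep_def)

lemma sym_rep_poly_fun:
  assumes g: "poly_fun g" and n: "0 < n"
  shows "sym_rep n (\<lambda>l b j k. g (sym_map n l, sym_map n b))"
proof -
  have pf: "poly_fun (\<lambda>x. if i = 0 \<and> m = 0 then g x else 0)" for i m :: nat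
    using g by (cases "i = 0 \<and> m = 0") (auto intro: poly_fun_const)
  have e: "x ^ i * (if i = 0 \<and> m = 0 then g s else 0) * y ^ m = (if m = 0 then if i = 0 then g s else 0 else 0)"
    for x y s and i m :: nat
    by auto
  have "(\<Sum>i<n. \<Sum>m<n. x ^ i * (if i = 0 \<and> m = 0 then g s else 0) * y ^ m) = g s" for x y s
    unfolding e using n by (simp add: sum.delta)
  with pf show ?thesis
    unfolding sym_rep_def
    by (intro exI[of _ "\<lambda>i m x. if i = 0 \<and> m = 0 then g x else 0"]) auto
qed

lemma sym_rep_add:
  assumes "sym_rep n F" "sym_rep n G"
  shows "sym_rep n (\<lambda>l b j k. F l b j k + G l b j k)"
proof -
  obtain M where M: "\<And>i m. poly_fun (M i m)" "\<And>l b j k. j < n \<Longrightarrow> k < n \<Longrightarrow> F l b j k =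
      (\<Sum>i<n. \<Sum>m<n. l j ^ i * M i m (sym_map n l, sym_map n b) * b k ^ m)"
    using sym_repE[OF assms(1)] by blast
  obtain N where N: "\<And>i m. poly_fun (N i m)" "\<And>l b j k. j < n \<Longrightarrow> k < n \<Longrightarrow> G l b j k =
      (\<Sum>i<n. \<Sum>m<n. l j ^ i * N i m (sym_map n l, sym_map n b) * b k ^ m)"
    using sym_repE[OF assms(2)] by blast
  have "F l b j k + G l b j k = (\<Sum>i<n. \<Sum>m<n. l j ^ i *
      (M i m (sym_map n l, sym_map n b) + N i m (sym_map n l, sym_map n b)) * b k ^ m)"
    if "j < n" "k < n" for l b j k
    unfolding M(2)[OF that] N(2)[OF that] by (simp add: distrib_left distrib_right sum.distrib)
  then show ?thesis
    unfolding sym_rep_def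
    by (intro exI[of _ "\<lambda>i m x. M i m x + N i m x"]) (simp add: poly_fun_add M(1) N(1))
qed

lemma sym_rep_scale:
  assumes "sym_rep n F" "poly_fun g"
  shows "sym_rep n (\<lambda>l b j k. g (sym_map n l, sym_map n b) * F l b j k)"
proof -
  obtain M where M: "\<And>i m. poly_fun (M i m)" "\<And>l b j k. j < n \<Longrightarrow> k < n \<Longrightarrow> F l b j k =
      (\<Sum>i<n. \<Sum>m<n. l j ^ i * M i m (sym_map n l, sym_map n b) * b k ^ m)"
    using sym_repE[OF assms(1)] by blast
  have "g (sym_map n l, sym_map n b) * F l b j k = (\<Sum>i<n. \<Sum>m<n. l j ^ i *
      (g (sym_map n l, sym_map n b) * M i m (sym_map n l, sym_map n b)) * b k ^ m)"
    if "j < n" "k < n" for l b j k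
    unfolding M(2)[OF that] sum_distrib_left by (simp add: mult_ac)
  then show ?thesis
    unfolding sym_rep_def
    by (intro exI[of _ "\<lambda>i m x. g x * M i m x"]) (simp add: poly_fun_mult M(1) assms(2))
qed

lemma sym_rep_sum:
  assumes "\<And>a. a \<in> A \<Longrightarrow> sym_rep n (F a)" "finite A" "0 < n"
  shows "sym_rep n (\<lambda>l b j k. \<Sum>a\<in>A. F a l b j k)"
  using assms(2,1)
proof (induction rule: finite_induct)
  case empty
  show ?case using sym_rep_poly_fun[OF poly_fun_const[of 0] assms(3)] by simp
next
  case (insert a A)
  then have "sym_rep n (\<lambda>l b j k. F a l b j k + (\<Sum>a\<in>A. F a l b j k))"
    by (intro sym_rep_add) auto
  then show ?case using insert by simp
qed

text \<open>The companion matrix acting on coefficients: the subtracted term rewrites the overflow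
  \<open>t ^ n\<close> by means of the characteristic equation.\<close>

definition shift_coeff :: "nat \<Rightarrow> (nat \<Rightarrow> complex) \<Rightarrow> (nat \<Rightarrow> complex) \<Rightarrow> nat \<Rightarrow> complex" where
  "shift_coeff n s c i = (if i = 0 then 0 else c (i - 1)) - (- 1) ^ (n - i) * s (n - Suc i) * c (n - 1)"

lemma shift_coeff:
  assumes t: "char_poly n t s = 0" and n: "0 < n"
  shows "t * (\<Sum>i<n. t ^ i * c i) = (\<Sum>i<n. t ^ i * shift_coeff n s c i)"
proof -
  obtain p where p: "n = Suc p" using n by (cases n) auto
  have "char_poly n t s = t ^ n + (\<Sum>k\<le>p. (- 1) ^ Suc k * s k * t ^ (p - k))"
    unfolding char_poly_def p by (subst sum.atMost_Suc_shift) simp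
  also have "(\<Sum>k\<le>p. (- 1) ^ Suc k * s k * t ^ (p - k)) = (\<Sum>k<n. (- 1) ^ Suc k * s k * t ^ (n - Suc k))"
    by (simp add: p lessThan_Suc_atMost)
  also have "\<dots> = (\<Sum>i<n. (- 1) ^ (n - i) * s (n - Suc i) * t ^ i)"
    by (subst sum.nat_diff_reindex[symmetric]) (auto intro!: sum.cong simp: Suc_diff_Suc)
  finally have e: "t ^ n = - (\<Sum>i<n. (- 1) ^ (n - i) * s (n - Suc i) * t ^ i)"
    using t by (simp only: eq_neg_iff_add_eq_0)
  have "t * (\<Sum>i<n. t ^ i * c i) = (\<Sum>i<p. t ^ Suc i * c i) + t ^ n * c (n - 1)"
    by (simp add: p sum_distrib_left algebra_simps)
  also have "(\<Sum>i<p. t ^ Suc i * c i) = (\<Sum>i<n. t ^ i * (if i = 0 then 0 else c (i - 1)))"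
    unfolding p by (subst sum.lessThan_Suc_shift) simp
  also have "t ^ n * c (n - 1) = - (\<Sum>i<n. t ^ i * ((- 1) ^ (n - i) * s (n - Suc i) * c (n - 1)))"
    unfolding e by (simp add: sum_distrib_left sum_distrib_right mult_ac)
  finally show ?thesis
    by (simp add: shift_coeff_def right_diff_distrib sum_subtractf)
qed

lemma char_poly_root: "j < n \<Longrightarrow> char_poly n (l j) (sym_map n l) = 0"
  unfolding char_poly_sym_map by auto

lemma sym_rep_mult_fst:
  assumes "sym_rep n F"
  shows "sym_rep n (\<lambda>l b j k. l j * F l b j k)"
proof -
  obtain M where M: "\<And>i m. poly_fun (M i m)" "\<And>l b j k. j < n \<Longrightarrow> k < n \<Longrightarrow> F l b j k =
      (\<Sum>i<n. \<Sum>m<n. l j ^ i * M i m (sym_map n l, sym_map n b) * b k ^ m)"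
    using sym_repE[OF assms] by blast
  define N where "N = (\<lambda>i m x. shift_coeff n (fst x) (\<lambda>i. M i m x) i)"
  have "poly_fun (\<lambda>x. (if i = 0 then (\<lambda>_. 0) else M (i - 1) m) x
      + (- ((- 1) ^ (n - i))) * (fst x (n - Suc i) * M (n - 1) m x))" for i m
    by (intro poly_fun_add poly_fun_mult poly_fun_const poly_fun_fst M(1)) (auto intro: M(1) poly_fun_const)
  also have "(\<lambda>x. (if i = 0 then (\<lambda>_. 0) else M (i - 1) m) x
      + (- ((- 1) ^ (n - i))) * (fst x (n - Suc i) * M (n - 1) m x)) = N i m" for i m
    by (auto simp: N_def shift_coeff_def fun_eq_iff)
  finally have "poly_fun (N i m)" for i m .
  moreover have "l j * F l b j k = (\<Sum>i<n. \<Sum>m<n. l j ^ i * N i m (sym_map n l, sym_map n b) * b k ^ m)"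
    if "j < n" "k < n" for l b j k
  proof -
    let ?x = "(sym_map n l, sym_map n b)"
    have "F l b j k = (\<Sum>m<n. (\<Sum>i<n. l j ^ i * M i m ?x) * b k ^ m)"
      unfolding M(2)[OF that] sum_distrib_right by (rule sum.swap)
    moreover have "l j * (\<Sum>m<n. X m * b k ^ m) = (\<Sum>m<n. l j * X m * b k ^ m)" for X
      by (simp add: sum_distrib_left mult.assoc)
    ultimately have "l j * F l b j k = (\<Sum>m<n. l j * (\<Sum>i<n. l j ^ i * M i m ?x) * b k ^ m)"
      by simp
    also have "\<dots> = (\<Sum>m<n. (\<Sum>i<n. l j ^ i * N i m ?x) * b k ^ m)"
    proof -
      have "0 < n" using that by simp
      show ?thesis
        unfolding shift_coeff[OF char_poly_root[OF that(1), of l] \<open>0 < n\<close>] N_def fst_conv ..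
    qed
    also have "\<dots> = (\<Sum>i<n. \<Sum>m<n. l j ^ i * N i m ?x * b k ^ m)"
      unfolding sum_distrib_right by (rule sum.swap)
    finally show ?thesis .
  qed
  ultimately show ?thesis unfolding sym_rep_def by blast
qed

lemma poly_fun_swap: "poly_fun f \<Longrightarrow> poly_fun (\<lambda>x. f (snd x, fst x))"
  by (induction rule: poly_fun.induct) (auto intro: poly_fun.intros)

lemma sym_rep_swap:
  assumes "sym_rep n F"
  shows "sym_rep n (\<lambda>l b j k. F b l k j)"
proof -
  obtain M where M: "\<And>i m. poly_fun (M i m)" "\<And>l b j k. j < n \<Longrightarrow> k < n \<Longrightarrow> F l b j k =
      (\<Sum>i<n. \<Sum>m<n. l j ^ i * M i m (sym_map n l, sym_map n b) * b k ^ m)"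
    using sym_repE[OF assms] by blast
  have "F b l k j = (\<Sum>i<n. \<Sum>m<n. l j ^ i * M m i (sym_map n b, sym_map n l) * b k ^ m)"
    if "j < n" "k < n" for l b j k
    unfolding M(2)[OF that(2,1)] by (subst sum.swap) (simp add: mult_ac)
  then show ?thesis
    unfolding sym_rep_def
    by (intro exI[of _ "\<lambda>i m x. M m i (snd x, fst x)"]) (auto intro: poly_fun_swap M(1))
qed

lemma sym_rep_mult_snd:
  assumes "sym_rep n F"
  shows "sym_rep n (\<lambda>l b j k. b k * F l b j k)"
  using sym_rep_swap[OF sym_rep_mult_fst[OF sym_rep_swap[OF assms]]] .

lemma sym_rep_mult_powers:
  assumes "sym_rep n F"
  shows "sym_rep n (\<lambda>l b j k. l j ^ i * (b k ^ m * F l b j k))"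
proof -
  have 1: "sym_rep n (\<lambda>l b j k. b k ^ m * F l b j k)"
  proof (induction m)
    case (Suc m)
    show ?case using sym_rep_mult_snd[OF Suc] by (simp add: mult.assoc)
  qed (use assms in simp)
  show ?thesis
  proof (induction i)
    case (Suc i)
    show ?case using sym_rep_mult_fst[OF Suc] by (simp add: mult.assoc)
  qed (use 1 in simp)
qed

text \<open>Expand one factor into monomials in \<open>l j\<close> and \<open>b k\<close> with
  symmetric coefficients; the other factor absorbs the powers by repeated reduction.\<close>

lemma sym_rep_mult:
  assumes "sym_rep n F" "sym_rep n G" and n: "0 < n"
  shows "sym_rep n (\<lambda>l b j k. F l b j k * G l b j k)"
proof -
  obtain M where M: "\<And>i m. poly_fun (M i m)" "\<And>l b j k. j < n \<Longrightarrow> k < n \<Longrightarrow> F l b j k =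
      (\<Sum>i<n. \<Sum>m<n. l j ^ i * M i m (sym_map n l, sym_map n b) * b k ^ m)"
    using sym_repE[OF assms(1)] by blast
  have "sym_rep n (\<lambda>l b j k. \<Sum>i<n. \<Sum>m<n. M i m (sym_map n l, sym_map n b) * (l j ^ i * (b k ^ m * G l b j k)))"
    by (intro sym_rep_sum sym_rep_scale sym_rep_mult_powers assms M(1) n) auto
  then show ?thesis
    by (rule sym_rep_cong) (simp add: M(2) sum_distrib_left sum_distrib_right mult_ac)
qed

text \<open>The reversed characteristic polynomial, written through coefficients so that it is
  defined for every \<open>s\<close>. At a symmetrization it is the common denominator of one column
  of the Cauchy matrix.\<close>

definition root_prod :: "nat \<Rightarrow> complex \<Rightarrow> (nat \<Rightarrow> complex) \<Rightarrow> complex" where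
  "root_prod n b s = (\<Sum>i\<le>n. (- 1) ^ i * esc s i * b ^ i)"

lemma root_prod_sym_map: "root_prod n b (sym_map n l) = (\<Prod>j<n. 1 - l j * b)"
  using prod_diff_eq_sum_elem_sym[of 1 l b n] by (simp add: root_prod_def esc_sym_map)

text \<open>The Horner recursion telescopes. At a root \<open>t\<close> of the characteristic
  polynomial the last term vanishes, so the sum is an explicit polynomial quotient of
  \<open>root_prod\<close> by \<open>1 - t * b\<close>.\<close>

lemma root_prod_eq:
  "(1 - t * b) * (\<Sum>m<n. b ^ m * char_poly m t s) = root_prod n b s - b ^ n * char_poly n t s"
proof (induction n)
  case (Suc n)
  have "(1 - t * b) * (\<Sum>m<Suc n. b ^ m * char_poly m t s)
      = (1 - t * b) * (\<Sum>m<n. b ^ m * char_poly m t s) + (1 - t * b) * (b ^ n * char_poly n t s)"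
    by (simp add: distrib_left)
  also have "\<dots> = root_prod n b s - b ^ n * char_poly n t s + (1 - t * b) * (b ^ n * char_poly n t s)"
    unfolding Suc.IH ..
  also have "\<dots> = root_prod (Suc n) b s - b ^ Suc n * char_poly (Suc n) t s"
    by (simp add: root_prod_def char_poly_Suc algebra_simps)
  finally show ?case .
qed (simp add: root_prod_def char_poly_def)

text \<open>The Cauchy matrix entry \<open>1 / (1 - l j * b k)\<close> after multiplication by the
  common denominator of column \<open>k\<close>, in polynomial form.\<close>

definition cauchy_sum :: "nat \<Rightarrow> (nat \<Rightarrow> complex) \<Rightarrow> (nat \<Rightarrow> complex) \<Rightarrow> nat \<Rightarrow> nat \<Rightarrow> complex" where
  "cauchy_sum n l b j k = (\<Sum>m<n. b k ^ m * char_poly m (l j) (sym_map n l))"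

lemma cauchy_sum_eq: "j < n \<Longrightarrow> (1 - l j * b k) * cauchy_sum n l b j k = root_prod n (b k) (sym_map n l)"
  by (simp add: cauchy_sum_def root_prod_eq char_poly_root)

lemma sym_rep_cauchy_sum:
  assumes n: "0 < n"
  shows "sym_rep n (cauchy_sum n)"
proof -
  have "sym_rep n (\<lambda>l b j k. \<Sum>m<n. \<Sum>i\<le>m. ((\<lambda>x. (- 1) ^ i * esc (fst x) i) (sym_map n l, sym_map n b)) *
      (l j ^ (m - i) * (b k ^ m * (\<lambda>_. 1) (sym_map n l, sym_map n b))))"
    by (intro sym_rep_sum sym_rep_scale sym_rep_mult_powers sym_rep_poly_fun n
        poly_fun_mult poly_fun_const poly_fun_esc) auto
  then show ?thesis
    by (rule sym_rep_cong) (simp add: cauchy_sum_def char_poly_def sum_distrib_left mult_ac)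
qed

text \<open>A column operation, encoded by the unit triangular matrix \<open>U\<close>, replaces the
  last power by the monic polynomial with roots \<open>x 0\<close>, ..., \<open>x (n - 1)\<close>.
  It vanishes in every row except the last, and Laplace expansion along that column gives the
  recursion.\<close>

lemma det_vandermonde:
  "Determinant.det (Matrix.mat n n (\<lambda>(j, i). x j ^ i)) = vandermonde n x"
proof (induction n)
  case 0
  then show ?case by (simp add: vandermonde_def)
next
  case (Suc n)
  let ?N = "Suc n"
  let ?A = "Matrix.mat ?N ?N (\<lambda>(j, i). x j ^ i)"
  define U where "U = Matrix.mat ?N ?N (\<lambda>(i, c). if i = c then 1 else if c = n then (- 1) ^ (n - i) * elem_sym n (n - i) x else 0)"
  define B where "B = Matrix.mat ?N ?N (\<lambda>(j, c). if c = n then (\<Prod>i<n. x j - x i) else x j ^ c)"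
  have U: "U \<in> carrier_mat ?N ?N" and A: "?A \<in> carrier_mat ?N ?N" and B: "B \<in> carrier_mat ?N ?N"
    by (auto simp: U_def B_def)
  have "upper_triangular U" by (auto simp: U_def upper_triangular_def)
  then have "Determinant.det U = prod_list (diag_mat U)" using U by (rule det_upper_triangular)
  also have "\<dots> = 1" by (simp add: prod_list_diag_prod U_def)
  finally have dU: "Determinant.det U = 1" .
  have "?A * U = B"
  proof (rule eq_matI)
    fix j c assume "j < dim_row B" "c < dim_col B"
    then have jc: "j < ?N" "c < ?N" by (auto simp: B_def)
    have "(?A * U) $$ (j, c) = (\<Sum>i<?N. x j ^ i * (if i = c then 1 else if c = n then (- 1) ^ (n - i) * elem_sym n (n - i) x else 0))"
      using jc by (simp add: scalar_prod_def U_def atLeast0LessThan)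
    also have "\<dots> = (if c = n then (\<Prod>i<n. x j - x i) else x j ^ c)"
    proof (cases "c = n")
      case True
      have "(\<Sum>i<?N. x j ^ i * (if i = c then 1 else if c = n then (- 1) ^ (n - i) * elem_sym n (n - i) x else 0))
          = (\<Sum>i\<le>n. (- 1) ^ (n - i) * elem_sym n (n - i) x * x j ^ i)"
        using True by (auto intro!: sum.cong simp: lessThan_Suc_atMost)
      also have "\<dots> = (\<Sum>k\<le>n. (- 1) ^ k * elem_sym n k x * x j ^ (n - k))"
        by (rule sum.reindex_bij_witness[of _ "\<lambda>k. n - k" "\<lambda>k. n - k"]) auto
      also have "\<dots> = (\<Prod>i<n. x j - x i)"
        using prod_diff_eq_sum_elem_sym[of "x j" x 1 n] by simp
      finally show ?thesis using True by simp
    next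
      case False
      then have "(\<Sum>i<?N. x j ^ i * (if i = c then 1 else if c = n then (- 1) ^ (n - i) * elem_sym n (n - i) x else 0))
          = (\<Sum>i<?N. if i = c then x j ^ c else 0)"
        by (intro sum.cong) auto
      then show ?thesis using False jc by (simp add: sum.delta del: sum.lessThan_Suc)
    qed
    finally show "(?A * U) $$ (j, c) = B $$ (j, c)" using jc by (simp add: B_def)
  qed (use A U B in auto)
  then have "Determinant.det ?A = Determinant.det B"
    using det_mult[OF A U] dU by simp
  also have "\<dots> = (\<Sum>j<?N. B $$ (j, n) * cofactor B j n)"
    using laplace_expansion_column[OF B, of n] by simp
  also have "\<dots> = B $$ (n, n) * cofactor B n n"
  proof -
    have "(\<Sum>j<n. B $$ (j, n) * cofactor B j n) = 0"
      by (rule sum.neutral) (auto simp: B_def)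
    then show ?thesis by simp
  qed
  also have "cofactor B n n = vandermonde n x"
  proof -
    have "mat_delete B n n = Matrix.mat n n (\<lambda>(j, i). x j ^ i)"
      by (rule eq_matI) (auto simp: mat_delete_def B_def)
    then show ?thesis using Suc.IH by (simp add: cofactor_def)
  qed
  also have "B $$ (n, n) = (\<Prod>i<n. x n - x i)" by (simp add: B_def)
  finally show ?case by (simp only: vandermonde_Suc mult.commute)
qed

text \<open>Scaling column \<open>k\<close> by the square of its common denominator turns the
  entries into squares of \<open>cauchy_sum\<close>. By reduction modulo the characteristic
  polynomials the scaled matrix is a Vandermonde matrix in \<open>l\<close>, times a matrix of
  symmetric coefficients, times a transposed Vandermonde matrix in \<open>b\<close>. \<Delta> is the
  determinant of the middle factor, so it is available also where roots coincide.\<close>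

theorem bergman_det_factorization:
  assumes n: "0 < n"
  obtains \<Delta> where "poly_fun \<Delta>"
    "\<And>l b. (\<And>j k. j < n \<Longrightarrow> k < n \<Longrightarrow> 1 - l j * b k \<noteq> 0) \<Longrightarrow>
      Determinant.det (Matrix.mat n n (\<lambda>(j, k). 1 / (1 - l j * b k)\<^sup>2))
      = vandermonde n l * (\<Delta> (sym_map n l, sym_map n b) / (\<Prod>k<n. (root_prod n (b k) (sym_map n l))\<^sup>2)) * vandermonde n b"
proof -
  have "sym_rep n (\<lambda>l b j k. cauchy_sum n l b j k * cauchy_sum n l b j k)"
    using n by (intro sym_rep_mult sym_rep_cauchy_sum)
  then obtain M where M: "\<And>i m. poly_fun (M i m)" "\<And>l b j k. j < n \<Longrightarrow> k < n \<Longrightarrow>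
      cauchy_sum n l b j k * cauchy_sum n l b j k =
      (\<Sum>i<n. \<Sum>m<n. l j ^ i * M i m (sym_map n l, sym_map n b) * b k ^ m)"
    unfolding sym_rep_def by blast
  define \<Delta> where "\<Delta> = (\<lambda>x. Determinant.det (Matrix.mat n n (\<lambda>(i, m). M i m x)))"
  have "poly_fun \<Delta>" unfolding \<Delta>_def by (rule poly_fun_det) (rule M(1))
  moreover have "Determinant.det (Matrix.mat n n (\<lambda>(j, k). 1 / (1 - l j * b k)\<^sup>2))
      = vandermonde n l * (\<Delta> (sym_map n l, sym_map n b) / (\<Prod>k<n. (root_prod n (b k) (sym_map n l))\<^sup>2)) * vandermonde n b"
    if nz: "\<And>j k. j < n \<Longrightarrow> k < n \<Longrightarrow> 1 - l j * b k \<noteq> 0" for l b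
  proof -
    let ?x = "(sym_map n l, sym_map n b)"
    define d where "d = (\<lambda>k. (root_prod n (b k) (sym_map n l))\<^sup>2)"
    have d0: "d k \<noteq> 0" if "k < n" for k
      using nz that by (simp add: d_def root_prod_sym_map)
    define A where "A = Matrix.mat n n (\<lambda>(j, i). l j ^ i)"
    define C where "C = Matrix.mat n n (\<lambda>(i, m). M i m ?x)"
    define B where "B = Matrix.mat n n (\<lambda>(k, m). b k ^ m)"
    define D where "D = Matrix.mat n n (\<lambda>(i, k). if i = k then d k else 0)"
    define G where "G = Matrix.mat n n (\<lambda>(j, k). 1 / (1 - l j * b k)\<^sup>2)"
    note carr = A_def B_def C_def D_def G_def
    have [simp]: "A \<in> carrier_mat n n" "B \<in> carrier_mat n n" "C \<in> carrier_mat n n" "D \<in> carrier_mat n n"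
      "G \<in> carrier_mat n n" by (auto simp: carr)
    have "G * D = A * (C * transpose_mat B)"
    proof (rule eq_matI)
      fix j k assume "j < dim_row (A * (C * transpose_mat B))" "k < dim_col (A * (C * transpose_mat B))"
      then have jk: "j < n" "k < n" by (auto simp: carr)
      have "(G * D) $$ (j, k) = (\<Sum>i<n. 1 / (1 - l j * b i)\<^sup>2 * (if i = k then d k else 0))"
        using jk by (simp add: scalar_prod_def G_def D_def atLeast0LessThan)
      also have "\<dots> = (\<Sum>i<n. if i = k then d k / (1 - l j * b k)\<^sup>2 else 0)"
        by (intro sum.cong) auto
      also have "\<dots> = d k / (1 - l j * b k)\<^sup>2" using jk by (simp add: sum.delta)
      also have "\<dots> = cauchy_sum n l b j k * cauchy_sum n l b j k"
        using nz[OF jk] cauchy_sum_eq[OF jk(1), of l b k]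
        by (simp add: d_def power2_eq_square flip: cauchy_sum_eq[OF jk(1), of l b k])
      also have "\<dots> = (\<Sum>i<n. l j ^ i * (\<Sum>m<n. M i m ?x * b k ^ m))"
        unfolding M(2)[OF jk] by (simp add: sum_distrib_left mult.assoc)
      also have "\<dots> = (A * (C * transpose_mat B)) $$ (j, k)"
        using jk by (simp add: scalar_prod_def A_def B_def C_def atLeast0LessThan)
      finally show "(G * D) $$ (j, k) = (A * (C * transpose_mat B)) $$ (j, k)" .
    qed (auto simp: carr)
    then have "Determinant.det (G * D) = Determinant.det (A * (C * transpose_mat B))" by simp
    then have "Determinant.det G * Determinant.det D = Determinant.det A * (Determinant.det C * Determinant.det B)"
      using det_mult[of G n D] det_mult[of A n "C * transpose_mat B"] det_mult[of C n "transpose_mat B"]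
        det_transpose[of B n] mult_carrier_mat[of C n n "transpose_mat B" n] by simp
    moreover have "Determinant.det D = (\<Prod>k<n. d k)"
    proof -
      have Dc: "D \<in> carrier_mat n n" by simp
      have "upper_triangular D" by (auto simp: D_def upper_triangular_def)
      then have "Determinant.det D = prod_list (diag_mat D)" by (rule det_upper_triangular[OF _ Dc])
      also have "\<dots> = (\<Prod>k<n. d k)"
        by (simp add: prod_list_diag_prod D_def atLeast0LessThan)
      finally show ?thesis .
    qed
    moreover have "(\<Prod>k<n. d k) \<noteq> 0" using d0 by simp
    moreover have "Determinant.det A = vandermonde n l" "Determinant.det B = vandermonde n b" "Determinant.det C = \<Delta> ?x"
      by (simp_all add: A_def B_def C_def det_vandermonde \<Delta>_def)
    ultimately have "Determinant.det G = vandermonde n l * (\<Delta> ?x / (\<Prod>k<n. d k)) * vandermonde n b"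
      by (simp add: field_simps)
    then show ?thesis
      unfolding G_def d_def .
  qed
  ultimately show ?thesis using that by blast
qed

section \<open>Roots of unity, permutations and integration over the symmetrized polydisc\<close>

text \<open>Geometric sums vanish unless \<open>n\<close> divides the exponent. The exponents of
  interest are sums of two numbers below \<open>n\<close>, so 0 and \<open>n\<close> are the only
  multiples in range.\<close>

lemma sum_primitive_root_powers:
  assumes "r < 2 * n"
  defines "\<omega> \<equiv> cis (2 * pi / real n)"
  shows "(\<Sum>k<n. (\<omega> ^ k) ^ r) = (if r = 0 \<or> r = n then of_nat n else 0)"
proof -
  have n: "n > 0" using assms by auto
  have \<omega>n: "\<omega> ^ n = 1"
    using n Complex.DeMoivre[of "2 * pi / real n" n] by (simp add: \<omega>_def)
  have inj: "inj_on (\<lambda>k. \<omega> ^ k) {..<n}"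
  proof -
    have "\<omega> ^ k = cis (2 * pi * real k / real n)" for k
      unfolding \<omega>_def Complex.DeMoivre by (simp add: mult_ac)
    then show ?thesis
      using bij_betw_imp_inj_on[OF Complex.bij_betw_roots_unity[OF n]] by simp
  qed
  have ne: "\<omega> ^ r \<noteq> 1" if "0 < r" "r < n" for r
    using inj_onD[OF inj, of r 0] that by auto
  show ?thesis
  proof (cases "r = 0 \<or> r = n")
    case True
    moreover have "(\<omega> ^ k) ^ n = (\<omega> ^ n) ^ k" for k
      by (simp only: power_mult[symmetric] mult.commute)
    ultimately have "(\<omega> ^ k) ^ r = 1" for k
      using \<omega>n by auto
    then show ?thesis using True by simp
  next
    case False
    have "\<omega> ^ r \<noteq> 1"
    proof (cases "r < n")
      case False
      then have "\<omega> ^ r = \<omega> ^ n * \<omega> ^ (r - n)" by (simp flip: power_add)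
      then show ?thesis using \<omega>n ne[of "r - n"] False \<open>\<not> (r = 0 \<or> r = n)\<close> assms(1) by auto
    qed (use False ne in auto)
    then have "(\<Sum>k<n. (\<omega> ^ r) ^ k) = ((\<omega> ^ r) ^ n - 1) / (\<omega> ^ r - 1)" by (rule geometric_sum)
    also have "(\<omega> ^ r) ^ n = (\<omega> ^ n) ^ r"
      by (simp only: power_mult[symmetric] mult.commute)
    finally have "(\<Sum>k<n. (\<omega> ^ r) ^ k) = 0" using \<omega>n by simp
    moreover have "(\<omega> ^ k) ^ r = (\<omega> ^ r) ^ k" for k
      by (simp only: power_mult[symmetric] mult.commute)
    ultimately show ?thesis using False by simp
  qed
qed

text \<open>With \<open>y = c * \<omega> ^ k\<close> the power \<open>y ^ n = c ^ n\<close> does not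
  depend on \<open>k\<close>, so \<open>1 / (1 - y)\<close> is a finite geometric sum over a fixed
  denominator. After squaring and summing over \<open>k\<close>, only the exponent pairs with sum 0
  or \<open>n\<close> survive: one pair and \<open>n - 1\<close> pairs.\<close>

lemma sum_inverse_squares_roots:
  fixes c :: complex
  assumes n: "n > 0" and c: "c ^ n \<noteq> 1"
  defines "\<omega> \<equiv> cis (2 * pi / real n)"
  shows "(\<Sum>k<n. 1 / (1 - c * \<omega> ^ k)\<^sup>2) = of_nat n * (1 + (of_nat n - 1) * c ^ n) / (1 - c ^ n)\<^sup>2"
proof -
  obtain p where p: "n = Suc p" using n by (cases n) auto
  have \<omega>n: "\<omega> ^ n = 1"
    using n Complex.DeMoivre[of "2 * pi / real n" n] by (simp add: \<omega>_def)
  have u: "1 - c ^ n \<noteq> 0" using c by simp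
  have t: "1 / (1 - c * \<omega> ^ k)\<^sup>2 = (\<Sum>m<n. \<Sum>m'<n. c ^ (m + m') * (\<omega> ^ k) ^ (m + m')) / (1 - c ^ n)\<^sup>2" for k
  proof -
    let ?y = "c * \<omega> ^ k"
    have yn: "?y ^ n = c ^ n"
    proof -
      have "(\<omega> ^ k) ^ n = (\<omega> ^ n) ^ k"
        by (simp only: power_mult[symmetric] mult.commute)
      then show ?thesis using \<omega>n by (simp add: power_mult_distrib)
    qed
    have e: "1 - c ^ n = (1 - ?y) * (\<Sum>m<n. ?y ^ m)"
      using one_diff_power_eq[of ?y n] yn by simp
    then have y: "1 - ?y \<noteq> 0" using u by auto
    have "1 / (1 - ?y)\<^sup>2 = (\<Sum>m<n. ?y ^ m)\<^sup>2 / (1 - c ^ n)\<^sup>2"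
      unfolding e using y u e by (simp add: power_mult_distrib)
    also have "(\<Sum>m<n. ?y ^ m)\<^sup>2 = (\<Sum>m<n. \<Sum>m'<n. c ^ (m + m') * (\<omega> ^ k) ^ (m + m'))"
      unfolding power2_eq_square sum_product
      by (intro sum.cong refl) (simp only: power_mult_distrib power_add mult_ac)
    finally show ?thesis .
  qed
  have "(\<Sum>k<n. \<Sum>m<n. \<Sum>m'<n. c ^ (m + m') * (\<omega> ^ k) ^ (m + m'))
      = (\<Sum>m<n. \<Sum>k<n. \<Sum>m'<n. c ^ (m + m') * (\<omega> ^ k) ^ (m + m'))"
    by (rule sum.swap)
  also have "\<dots> = (\<Sum>m<n. \<Sum>m'<n. \<Sum>k<n. c ^ (m + m') * (\<omega> ^ k) ^ (m + m'))"
    by (rule sum.cong[OF refl], rule sum.swap)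
  also have "\<dots> = (\<Sum>m<n. \<Sum>m'<n. c ^ (m + m') * (if m + m' = 0 \<or> m + m' = n then of_nat n else 0))"
    by (intro sum.cong refl)
       (simp add: sum_distrib_left[symmetric] \<omega>_def sum_primitive_root_powers)
  also have "\<dots> = (\<Sum>m<n. if m = 0 then of_nat n else of_nat n * c ^ n)"
  proof (intro sum.cong refl)
    fix m assume m: "m \<in> {..<n}"
    show "(\<Sum>m'<n. c ^ (m + m') * (if m + m' = 0 \<or> m + m' = n then of_nat n else 0))
        = (if m = 0 then of_nat n else of_nat n * c ^ n)"
    proof (cases "m = 0")
      case True
      then have "(\<Sum>m'<n. c ^ (m + m') * (if m + m' = 0 \<or> m + m' = n then of_nat n else 0))
          = (\<Sum>m'<n. if m' = 0 then of_nat n else 0)"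
        by (intro sum.cong) auto
      then show ?thesis using True n by (simp add: sum.delta)
    next
      case False
      then have "(\<Sum>m'<n. c ^ (m + m') * (if m + m' = 0 \<or> m + m' = n then of_nat n else 0))
          = (\<Sum>m'<n. if m' = n - m then of_nat n * c ^ n else 0)"
        using m by (intro sum.cong) auto
      then show ?thesis using False m by (simp add: sum.delta)
    qed
  qed
  also have "\<dots> = of_nat n + of_nat p * (of_nat n * c ^ n)"
    unfolding p by (subst sum.lessThan_Suc_shift) simp
  also have "\<dots> = of_nat n * (1 + (of_nat n - 1) * c ^ n)"
    by (simp add: p algebra_simps)
  finally show ?thesis
    unfolding t sum_divide_distrib[symmetric] by simp
qed

section \<open>Behaviour under permutations, finite volume, and substitution for complex
  integrals\<close>

lemma vandermonde_nonzero:
  assumes "inj_on l {..<n}"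
  shows "vandermonde n l \<noteq> 0"
proof -
  have "l j - l i \<noteq> 0" if "j < n" "i < j" for i j
    using inj_onD[OF assms, of j i] that by auto
  then show ?thesis by (simp add: vandermonde_def)
qed

lemma elem_sym_permute:
  assumes "p permutes {..<n}"
  shows "elem_sym n k (\<lambda>i. l (p i)) = elem_sym n k l"
proof -
  let ?A = "{S. S \<subseteq> {..<n} \<and> card S = k}"
  have inj: "inj_on p S" for S using permutes_inj_on[OF assms] .
  have invp: "inv_into UNIV p permutes {..<n}" by (rule permutes_inv[OF assms])
  have "(\<Sum>S\<in>?A. \<Prod>j\<in>S. l (p j)) = (\<Sum>S\<in>?A. \<Prod>j\<in>S. l j)"
  proof (rule sum.reindex_bij_witness[of _ "\<lambda>S. inv_into UNIV p ` S" "\<lambda>S. p ` S"])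
    fix S assume S: "S \<in> ?A"
    show "inv_into UNIV p ` p ` S = S" using permutes_inverses(2)[OF assms] by (force simp: image_iff)
    show "p ` inv_into UNIV p ` S = S" using permutes_inverses(1)[OF assms] by (force simp: image_iff)
    show "p ` S \<in> ?A" using S inj permutes_in_image[OF assms] by (auto simp: card_image)
    show "inv_into UNIV p ` S \<in> ?A"
      using S permutes_in_image[OF invp] permutes_inj_on[OF invp] by (auto simp: card_image)
    show "(\<Prod>j\<in>p ` S. l j) = (\<Prod>j\<in>S. l (p j))" using inj by (simp add: prod.reindex)
  qed
  then show ?thesis by (simp add: elem_sym_def)
qed

lemma sym_map_permute: "p permutes {..<n} \<Longrightarrow> sym_map n (\<lambda>i. l (p i)) = sym_map n l"
  by (simp add: sym_map_def elem_sym_permute)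

text \<open>Permuting the variables permutes the rows of the Vandermonde matrix, so the sign comes
  from the determinant.\<close>

lemma vandermonde_permute:
  assumes p: "p permutes {..<n}"
  shows "vandermonde n (\<lambda>i. l (p i)) = signof p * vandermonde n l"
proof -
  let ?A = "Matrix.mat n n (\<lambda>(j, i). l j ^ i)"
  have p': "p permutes {0..<n}" using p by (simp add: atLeast0LessThan)
  have "Matrix.mat n n (\<lambda>(i, j). ?A $$ (p i, j)) = Matrix.mat n n (\<lambda>(j, i). l (p j) ^ i)"
    using permutes_in_image[OF p] by (intro eq_matI) auto
  then show ?thesis
    using det_permute_rows[of ?A n p] p' by (simp add: det_vandermonde)
qed

lemma emeasure_lebesgue_Cn_finite:
  assumes A: "A \<in> sets (lebesgue_Cn n)" and b: "\<And>z i. z \<in> A \<Longrightarrow> i < n \<Longrightarrow> cmod (z i) \<le> R"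
  shows "emeasure (lebesgue_Cn n) A < \<infinity>"
proof -
  have "A \<subseteq> PiE {..<n} (\<lambda>_. cball 0 R)"
    using b sets.sets_into_space[OF A] by (force simp: space_lebesgue_Cn PiE_def)
  then have "emeasure (lebesgue_Cn n) A \<le> emeasure (lebesgue_Cn n) (PiE {..<n} (\<lambda>_. cball 0 R))"
    by (intro emeasure_mono) (auto simp: lebesgue_Cn_def intro!: sets_PiM_I_finite)
  also have "\<dots> = (\<Prod>i<n. emeasure lborel (cball 0 R :: complex set))"
    unfolding lebesgue_Cn_def by (subst Cn_product.emeasure_PiM) auto
  also have "\<dots> < \<infinity>"
    using emeasure_lborel_cball_finite[of "0 :: complex" R] by (simp add: power_less_top_ennreal)
  finally show ?thesis .
qed

lemma emeasure_unit_polydisc_finite: "emeasure (lebesgue_Cn n) (unit_polydisc n) < \<infinity>"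
  by (rule emeasure_lebesgue_Cn_finite[OF sets_unit_polydisc, of _ 1]) (auto simp: unit_polydisc_def)

lemma emeasure_symmetrized_polydisc_finite: "emeasure (lebesgue_Cn n) (symmetrized_polydisc n) < \<infinity>"
proof (rule emeasure_lebesgue_Cn_finite[OF sets_symmetrized_polydisc])
  fix z i assume "z \<in> symmetrized_polydisc n" "i < n"
  then obtain l where l: "l \<in> unit_polydisc n" "z i = elem_sym n (Suc i) l"
    by (auto simp: symmetrized_polydisc_def sym_map_def)
  let ?A = "{S. S \<subseteq> {..<n} \<and> card S = Suc i}"
  have "cmod (z i) \<le> (\<Sum>S\<in>?A. 1)"
    unfolding l(2) elem_sym_def
  proof (rule sum_norm_le)
    fix S assume "S \<in> ?A"
    then show "cmod (\<Prod>j\<in>S. l j) \<le> 1"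
      unfolding prod_norm[symmetric] using l(1)
      by (intro prod_le_1) (auto simp: unit_polydisc_def less_imp_le subset_iff)
  qed
  also have "\<dots> \<le> real (card (Pow {..<n}))"
    by (simp, rule card_mono) auto
  finally show "cmod (z i) \<le> real (card (Pow {..<n}))" .
qed

text \<open>On finite measure \<open>cmod f <= 1 + (cmod f)^2\<close> suffices. It brings Bergman
  space functions within reach of the reproducing formulas, which assume integrability.\<close>

lemma set_integrable_of_square:
  fixes f :: "'a \<Rightarrow> complex"
  assumes A: "A \<in> sets M" "emeasure M A < \<infinity>" and f: "set_borel_measurable M A f"
    and sq: "set_integrable M A (\<lambda>x. (cmod (f x))\<^sup>2)"
  shows "set_integrable M A f"
proof -
  have "set_integrable M A (\<lambda>x. (1::real) + (cmod (f x))\<^sup>2)"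
    using A sq by (intro set_integral_add) (auto simp: set_integrable_def)
  then show ?thesis
  proof (rule set_integrable_bound)
    show "AE x in M. x \<in> A \<longrightarrow> norm (f x) \<le> norm (1 + (cmod (f x))\<^sup>2)"
    proof (intro AE_I2 impI)
      fix x
      have "0 \<le> (cmod (f x) - 1)\<^sup>2" by simp
      then have "2 * cmod (f x) \<le> 1 + (cmod (f x))\<^sup>2"
        by (simp add: power2_eq_square algebra_simps)
      then have "cmod (f x) \<le> 1 + (cmod (f x))\<^sup>2"
        using norm_ge_zero[of "f x"] by linarith
      then show "norm (f x) \<le> norm (1 + (cmod (f x))\<^sup>2)"
        by simp
    qed
  qed (rule f)
qed

text \<open>The substitution formula as an identity of measures, which makes it available for
  complex-valued integrands.\<close>

lemma distr_sym_map:
  "distr (density (lebesgue_Cn n) (\<lambda>l. ennreal ((cmod (vandermonde n l))\<^sup>2))) (lebesgue_Cn n) (sym_map n)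
    = density (lebesgue_Cn n) (\<lambda>_. ennreal (fact n))" (is "?M = ?N")
proof (rule measure_eqI)
  fix A assume "A \<in> sets ?M"
  then have A: "A \<in> sets (lebesgue_Cn n)" by simp
  note [measurable] = measurable_vandermonde measurable_sym_map
  have vm: "(\<lambda>l. ennreal ((cmod (vandermonde n l))\<^sup>2)) \<in> borel_measurable (lebesgue_Cn n)" by measurable
  have "emeasure ?M A = (\<integral>\<^sup>+l. ennreal ((cmod (vandermonde n l))\<^sup>2) *
      indicator (sym_map n -` A \<inter> space (lebesgue_Cn n)) l \<partial>lebesgue_Cn n)"
    using A vm measurable_sets[OF measurable_sym_map A]
    by (simp add: emeasure_distr emeasure_density)
  also have "\<dots> = (\<integral>\<^sup>+l. indicator A (sym_map n l) * ennreal ((cmod (vandermonde n l))\<^sup>2) \<partial>lebesgue_Cn n)"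
    by (intro nn_integral_cong) (auto simp: indicator_def)
  also have "\<dots> = fact n * emeasure (lebesgue_Cn n) A"
    using A by (subst nn_integral_sym_map) auto
  also have "\<dots> = emeasure ?N A"
    using A by (simp add: emeasure_density nn_integral_cmult_indicator flip: ennreal_fact)
  finally show "emeasure ?M A = emeasure ?N A" .
qed simp

lemma integral_sym_map:
  fixes h :: "(nat \<Rightarrow> complex) \<Rightarrow> 'b::{banach, second_countable_topology}"
  assumes h: "integrable (lebesgue_Cn n) h"
  shows "integrable (lebesgue_Cn n) (\<lambda>l. (cmod (vandermonde n l))\<^sup>2 *\<^sub>R h (sym_map n l))"
    and "(LINT l|lebesgue_Cn n. (cmod (vandermonde n l))\<^sup>2 *\<^sub>R h (sym_map n l)) = fact n *\<^sub>R (LINT z|lebesgue_Cn n. h z)"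
proof -
  have hm [measurable]: "h \<in> borel_measurable (lebesgue_Cn n)" using h by simp
  note [measurable] = measurable_vandermonde measurable_sym_map
  have "integrable (density (lebesgue_Cn n) (\<lambda>_. ennreal (fact n))) h"
    using h by (subst integrable_density) auto
  then have "integrable (density (lebesgue_Cn n) (\<lambda>l. ennreal ((cmod (vandermonde n l))\<^sup>2))) (\<lambda>l. h (sym_map n l))"
    unfolding distr_sym_map[symmetric] by (subst (asm) integrable_distr_eq) auto
  then show "integrable (lebesgue_Cn n) (\<lambda>l. (cmod (vandermonde n l))\<^sup>2 *\<^sub>R h (sym_map n l))"
    by (subst (asm) integrable_density) auto
  have "fact n *\<^sub>R (LINT z|lebesgue_Cn n. h z) = (LINT z|density (lebesgue_Cn n) (\<lambda>_. ennreal (fact n)). h z)"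
    by (subst integral_density) auto
  also have "\<dots> = (LINT l|density (lebesgue_Cn n) (\<lambda>l. ennreal ((cmod (vandermonde n l))\<^sup>2)). h (sym_map n l))"
    unfolding distr_sym_map[symmetric] by (subst integral_distr) auto
  also have "\<dots> = (LINT l|lebesgue_Cn n. (cmod (vandermonde n l))\<^sup>2 *\<^sub>R h (sym_map n l))"
    by (subst integral_density) auto
  finally show "(LINT l|lebesgue_Cn n. (cmod (vandermonde n l))\<^sup>2 *\<^sub>R h (sym_map n l)) = fact n *\<^sub>R (LINT z|lebesgue_Cn n. h z)" ..
qed

lemma set_integral_sym_map:
  fixes h :: "(nat \<Rightarrow> complex) \<Rightarrow> 'b::{banach, second_countable_topology}"
  assumes h: "set_integrable (lebesgue_Cn n) (symmetrized_polydisc n) h"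
  shows "set_integrable (lebesgue_Cn n) (unit_polydisc n) (\<lambda>l. (cmod (vandermonde n l))\<^sup>2 *\<^sub>R h (sym_map n l))"
    and "(LINT l:unit_polydisc n|lebesgue_Cn n. (cmod (vandermonde n l))\<^sup>2 *\<^sub>R h (sym_map n l))
      = fact n *\<^sub>R (LINT z:symmetrized_polydisc n|lebesgue_Cn n. h z)"
proof -
  have e: "(cmod (vandermonde n l))\<^sup>2 *\<^sub>R (indicator (symmetrized_polydisc n) (sym_map n l) *\<^sub>R h (sym_map n l))
      = indicator (unit_polydisc n) l *\<^sub>R ((cmod (vandermonde n l))\<^sup>2 *\<^sub>R h (sym_map n l))"
    if "l \<in> space (lebesgue_Cn n)" for l
    using sym_map_mem_iff[of l n] that by (simp add: Cn_eq_space indicator_def)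
  note T = integral_sym_map[OF h[unfolded set_integrable_def]]
  show "set_integrable (lebesgue_Cn n) (unit_polydisc n) (\<lambda>l. (cmod (vandermonde n l))\<^sup>2 *\<^sub>R h (sym_map n l))"
    unfolding set_integrable_def using T(1) by (subst (asm) Bochner_Integration.integrable_cong[OF refl e]) auto
  show "(LINT l:unit_polydisc n|lebesgue_Cn n. (cmod (vandermonde n l))\<^sup>2 *\<^sub>R h (sym_map n l))
      = fact n *\<^sub>R (LINT z:symmetrized_polydisc n|lebesgue_Cn n. h z)"
    unfolding set_lebesgue_integral_def T(2)[symmetric]
    by (intro Bochner_Integration.integral_cong refl e[symmetric])
qed

lemma continuous_on_vandermonde: "continuous_on A (vandermonde n)"
  unfolding vandermonde_def
  by (intro continuous_on_prod continuous_on_diff) (auto intro: continuous_on_subset[OF continuous_on_product_coordinates])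

lemma holomorphic_n_vandermonde: "holomorphic_n n (vandermonde n) A"
  unfolding holomorphic_n_def
proof (intro conjI continuous_on_vandermonde ballI allI impI)
  fix z :: "nat \<Rightarrow> complex" and j
  have "(\<lambda>t. (z(j := t)) i) holomorphic_on B" for i B
    by (cases "i = j") (auto intro: holomorphic_intros)
  then show "(\<lambda>t. vandermonde n (z(j := t))) holomorphic_on {t. z(j := t) \<in> A}"
    unfolding vandermonde_def by (intro holomorphic_on_prod holomorphic_on_diff)
qed

lemma holomorphic_n_mult:
  "holomorphic_n n f A \<Longrightarrow> holomorphic_n n g A \<Longrightarrow> holomorphic_n n (\<lambda>z. f z * g z) A"
  unfolding holomorphic_n_def by (auto intro!: continuous_on_mult holomorphic_on_mult)

section \<open>The Bergman kernel of the symmetrized polydisc\<close>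

text \<open>Fixes one \<Delta> as delivered by \<open>bergman_det_factorization\<close>, so that the
  kernel can be a definition instead of an obtained object.\<close>

locale symmetrized_kernel =
  fixes n :: nat and \<Delta> :: "(nat \<Rightarrow> complex) \<times> (nat \<Rightarrow> complex) \<Rightarrow> complex"
  assumes n_pos: "0 < n"
    and poly_fun_\<Delta>: "poly_fun \<Delta>"
    and factorization: "(\<And>j k. j < n \<Longrightarrow> k < n \<Longrightarrow> 1 - l j * b k \<noteq> 0) \<Longrightarrow>
      Determinant.det (Matrix.mat n n (\<lambda>(j, k). 1 / (1 - l j * b k)\<^sup>2))
      = vandermonde n l * (\<Delta> (sym_map n l, sym_map n b) / (\<Prod>k<n. (root_prod n (b k) (sym_map n l))\<^sup>2)) * vandermonde n b"
begin

text \<open>For \<open>b = conj_pt m\<close> this is the Bergman kernel at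
  \<open>(z, sym_map n m)\<close>. The second point enters through a tuple of roots, while the
  dependence on \<open>z\<close> involves only its coordinates, so holomorphy in \<open>z\<close> is
  visible.\<close>

definition kernel :: "(nat \<Rightarrow> complex) \<Rightarrow> (nat \<Rightarrow> complex) \<Rightarrow> complex" where
  "kernel b z = \<Delta> (z, sym_map n b) / (\<Prod>k<n. (root_prod n (b k) z)\<^sup>2) / of_real pi ^ n"

definition conj_pt :: "(nat \<Rightarrow> complex) \<Rightarrow> nat \<Rightarrow> complex" where
  "conj_pt m = restrict (\<lambda>i. cnj (m i)) {..<n}"

abbreviation "G \<equiv> symmetrized_polydisc n"
abbreviation "D \<equiv> unit_polydisc n"
abbreviation "L \<equiv> lebesgue_Cn n"

definition closed_polydisc :: "real \<Rightarrow> (nat \<Rightarrow> complex) set" where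
  "closed_polydisc r = {l \<in> Cn n. \<forall>j<n. cmod (l j) \<le> r}"

lemma compact_closed_polydisc': "compact (closed_polydisc r)"
  unfolding closed_polydisc_def by (rule compact_closed_polydisc)

lemma G_subset: "G \<subseteq> sym_map n ` closed_polydisc 1"
  by (auto simp: symmetrized_polydisc_def unit_polydisc_def closed_polydisc_def less_imp_le)

lemma closed_polydisc_subset: "r < 1 \<Longrightarrow> closed_polydisc r \<subseteq> D"
  by (auto simp: closed_polydisc_def unit_polydisc_def)

lemma root_prod_nonzero:
  assumes "z \<in> sym_map n ` closed_polydisc 1" "cmod c < 1"
  shows "root_prod n c z \<noteq> 0"
proof -
  obtain l where l: "l \<in> closed_polydisc 1" "z = sym_map n l" using assms(1) by auto
  have "1 - l j * c \<noteq> 0" if "j < n" for j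
  proof
    assume "1 - l j * c = 0"
    then have "cmod (l j * c) = 1" by (metis eq_iff_diff_eq_0 norm_one)
    moreover have "cmod (l j * c) \<le> cmod c"
      using l(1) that by (simp add: closed_polydisc_def norm_mult mult_left_le_one_le)
    ultimately show False using assms(2) by simp
  qed
  then show ?thesis by (simp add: l(2) root_prod_sym_map)
qed

lemma continuous_on_kernel:
  assumes "r < 1"
  shows "continuous_on (sym_map n ` closed_polydisc 1 \<times> closed_polydisc r) (\<lambda>(z, b). kernel b z)"
proof -
  let ?S = "sym_map n ` closed_polydisc 1 \<times> closed_polydisc r"
  have 1: "continuous_on ?S (\<lambda>x. \<Delta> (fst x, sym_map n (snd x)))"
    by (rule continuous_on_compose2[OF poly_fun_continuous[OF poly_fun_\<Delta>, of UNIV]])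
       (intro continuous_on_Pair continuous_on_fst continuous_on_snd continuous_on_id subset_UNIV
         continuous_on_compose2[OF continuous_on_sym_map[of UNIV]])+
  have fc: "continuous_on ?S (\<lambda>x. fst x i)" "continuous_on ?S (\<lambda>x. snd x i)" for i
    by (rule continuous_on_product_then_coordinatewise, intro continuous_intros)+
  have "continuous_on ?S (\<lambda>x. esc (fst x) i)" for i
    by (cases i) (auto intro: fc)
  then have 2: "continuous_on ?S (\<lambda>x. root_prod n (snd x k) (fst x))" for k
    unfolding root_prod_def by (intro continuous_on_sum continuous_on_mult continuous_on_power continuous_on_const fc)
  have 3: "root_prod n (snd x k) (fst x) \<noteq> 0" if "x \<in> ?S" "k < n" for x k
    using that assms by (intro root_prod_nonzero) (auto simp: closed_polydisc_def)
  show ?thesis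
    unfolding kernel_def case_prod_beta'
    by (intro continuous_on_divide continuous_on_prod continuous_on_power continuous_on_const 1 2)
       (use 3 in auto)
qed

text \<open>A continuous function on a compact product is bounded. Uniformity in \<open>b\<close> is
  what later provides a dominating function when \<open>b\<close> varies.\<close>

lemma kernel_bounded:
  assumes "r < 1"
  obtains C where "0 \<le> C" "\<And>z b. z \<in> G \<Longrightarrow> b \<in> closed_polydisc r \<Longrightarrow> cmod (kernel b z) \<le> C"
proof -
  have "compact (sym_map n ` closed_polydisc 1 \<times> closed_polydisc r)"
    by (intro compact_Times compact_continuous_image continuous_on_sym_map compact_closed_polydisc')
  from compact_imp_bounded[OF compact_continuous_image[OF continuous_on_kernel[OF assms] this]]
  obtain C where C: "\<forall>y\<in>(\<lambda>(z, b). kernel b z) ` (sym_map n ` closed_polydisc 1 \<times> closed_polydisc r). cmod y \<le> C"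
    unfolding bounded_iff by blast
  have "cmod (kernel b z) \<le> max C 0" if "z \<in> G" "b \<in> closed_polydisc r" for z b
  proof -
    have "(z, b) \<in> sym_map n ` closed_polydisc 1 \<times> closed_polydisc r"
      using that G_subset by blast
    from bspec[OF C imageI[OF this]] show ?thesis by simp
  qed
  then show ?thesis using that[of "max C 0"] by auto
qed

lemma exists_radius:
  assumes "m \<in> D"
  obtains r where "0 \<le> r" "r < 1" "m \<in> closed_polydisc r"
proof
  let ?r = "Max (insert 0 ((\<lambda>j. cmod (m j)) ` {..<n}))"
  show "0 \<le> ?r" by (intro Max_ge) auto
  show "?r < 1" using assms by (subst Max_less_iff) (auto simp: unit_polydisc_def)
  show "m \<in> closed_polydisc ?r"
    using assms by (auto simp: closed_polydisc_def unit_polydisc_def intro!: Max_ge)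
qed

lemma conj_pt_closed_polydisc: "m \<in> closed_polydisc r \<Longrightarrow> conj_pt m \<in> closed_polydisc r"
  by (auto simp: conj_pt_def closed_polydisc_def Cn_eq_extensional)

lemma continuous_on_kernel_fst:
  assumes "b \<in> D"
  shows "continuous_on G (kernel b)"
proof -
  obtain r where r: "r < 1" "b \<in> closed_polydisc r" using exists_radius[OF assms] by metis
  have "continuous_on G (\<lambda>z. (\<lambda>(z, b). kernel b z) (z, b))"
    by (rule continuous_on_compose2[OF continuous_on_kernel[OF r(1)]])
       (use G_subset r(2) in \<open>auto intro!: continuous_intros\<close>)
  then show ?thesis by simp
qed

lemma conj_pt_D: "m \<in> D \<Longrightarrow> conj_pt m \<in> D"
  by (auto simp: conj_pt_def unit_polydisc_def Cn_eq_extensional)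

lemma kernel_bergman:
  assumes b: "b \<in> D"
  shows "kernel b \<in> bergman_space n G"
  unfolding bergman_space_def holomorphic_n_def mem_Collect_eq
proof (intro conjI ballI allI impI continuous_on_kernel_fst[OF b])
  fix z j assume "z \<in> G" "j < n"
  have "poly_fun (\<lambda>x. root_prod n c (fst x))" for c
    unfolding root_prod_def by (intro poly_fun_sum poly_fun_mult poly_fun_const poly_fun_esc)
  then have 1: "(\<lambda>t. root_prod n c (z(j := t))) holomorphic_on A" for c A
    using poly_fun_holomorphic[of "\<lambda>x. root_prod n c (fst x)" z j undefined A] by simp
  show "(\<lambda>t. kernel b (z(j := t))) holomorphic_on {t. z(j := t) \<in> G}"
    unfolding kernel_def
    by (intro holomorphic_on_divide holomorphic_on_prod holomorphic_on_power holomorphic_on_const 1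
        poly_fun_holomorphic[OF poly_fun_\<Delta>])
       (use root_prod_nonzero G_subset b in \<open>auto simp: unit_polydisc_def\<close>)
next
  obtain r where r: "r < 1" "b \<in> closed_polydisc r" using exists_radius[OF b] by metis
  obtain C where C: "0 \<le> C" "\<And>z. z \<in> G \<Longrightarrow> cmod (kernel b z) \<le> C"
    using kernel_bounded[OF r(1)] r(2) by metis
  have "set_integrable L G (\<lambda>_. C\<^sup>2)"
    using emeasure_symmetrized_polydisc_finite sets_symmetrized_polydisc by (simp add: set_integrable_def)
  then show "set_integrable L G (\<lambda>z. (cmod (kernel b z))\<^sup>2)"
  proof (rule set_integrable_bound)
    show "set_borel_measurable L G (\<lambda>z. (cmod (kernel b z))\<^sup>2)"
      by (intro set_borel_measurable_continuous_on sets_symmetrized_polydisc continuous_on_power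
          continuous_on_norm continuous_on_kernel_fst b)
    show "AE z in L. z \<in> G \<longrightarrow> norm ((cmod (kernel b z))\<^sup>2) \<le> norm (C\<^sup>2)"
      using C by (intro AE_I2) (auto intro!: power_mono)
  qed
qed

lemma bergman_space_integrable:
  assumes f: "f \<in> bergman_space n G"
  shows "continuous_on G f" "set_integrable L G f"
proof -
  show c: "continuous_on G f" using f by (simp add: bergman_space_def holomorphic_n_def)
  show "set_integrable L G f"
    using f by (intro set_integrable_of_square sets_symmetrized_polydisc emeasure_symmetrized_polydisc_finite
        set_borel_measurable_continuous_on c) (simp add: bergman_space_def)
qed

lemma integrable_mult_kernel:
  assumes f: "f \<in> bergman_space n G" and b: "b \<in> D"
  shows "set_integrable L G (\<lambda>z. f z * cnj (kernel b z))"
proof -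
  obtain r where r: "r < 1" "b \<in> closed_polydisc r" using exists_radius[OF b] by metis
  obtain C where C: "0 \<le> C" "\<And>z. z \<in> G \<Longrightarrow> cmod (kernel b z) \<le> C"
    using kernel_bounded[OF r(1)] r(2) by metis
  have "set_integrable L G (\<lambda>z. C *\<^sub>R f z)"
    using bergman_space_integrable(2)[OF f] by (intro set_integrable_scaleR_right) auto
  then show ?thesis
  proof (rule set_integrable_bound)
    show "set_borel_measurable L G (\<lambda>z. f z * cnj (kernel b z))"
      by (intro set_borel_measurable_continuous_on sets_symmetrized_polydisc continuous_on_mult
          continuous_on_cnj continuous_on_kernel_fst b bergman_space_integrable(1) f)
    show "AE z in L. z \<in> G \<longrightarrow> norm (f z * cnj (kernel b z)) \<le> norm (C *\<^sub>R f z)"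
      using C by (intro AE_I2) (auto simp: norm_mult mult.commute[of "cmod (f _)"] intro!: mult_right_mono)
  qed
qed

lemma kernel_det:
  assumes l: "l \<in> D" and m: "m \<in> D"
  shows "vandermonde n l * kernel (conj_pt m) (sym_map n l) * cnj (vandermonde n m) * of_real pi ^ n
    = Determinant.det (Matrix.mat n n (\<lambda>(j, k). 1 / (1 - l j * cnj (m k))\<^sup>2))"
proof -
  have nz: "1 - l j * conj_pt m k \<noteq> 0" if "j < n" "k < n" for j k
    using that l m by (intro one_minus_mult_nonzero) (auto simp: conj_pt_def unit_polydisc_def)
  have "vandermonde n (conj_pt m) = vandermonde n (\<lambda>i. cnj (m i))"
    by (rule vandermonde_cong) (simp add: conj_pt_def)
  also have "\<dots> = cnj (vandermonde n m)" by (simp add: vandermonde_def)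
  finally have v: "vandermonde n (conj_pt m) = cnj (vandermonde n m)" .
  have "Matrix.mat n n (\<lambda>(j, k). 1 / (1 - l j * cnj (m k))\<^sup>2) = Matrix.mat n n (\<lambda>(j, k). 1 / (1 - l j * conj_pt m k)\<^sup>2)"
    by (rule eq_matI) (auto simp: conj_pt_def)
  then have "Determinant.det (Matrix.mat n n (\<lambda>(j, k). 1 / (1 - l j * cnj (m k))\<^sup>2))
      = Determinant.det (Matrix.mat n n (\<lambda>(j, k). 1 / (1 - l j * conj_pt m k)\<^sup>2))" by simp
  also have "\<dots> = vandermonde n l * (\<Delta> (sym_map n l, sym_map n (conj_pt m)) /
      (\<Prod>k<n. (root_prod n (conj_pt m k) (sym_map n l))\<^sup>2)) * cnj (vandermonde n m)"
    using factorization[of l "conj_pt m"] nz v by simp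
  finally show ?thesis by (simp add: kernel_def)
qed

text \<open>Leibniz' formula exhibits the conjugated determinant as the antisymmetrization of
  polydisc kernels over all rearrangements of \<open>m\<close>.\<close>

lemma cnj_det_expand:
  "cnj (Determinant.det (Matrix.mat n n (\<lambda>(j, k). 1 / (1 - l j * cnj (m k))\<^sup>2)))
    = (\<Sum>p | p permutes {..<n}. signof p * bergman_prod n (\<lambda>i. m (p i)) l)"
proof -
  have s: "cnj (signof p) = signof p" for p by (cases p rule: sign_cases) simp_all
  have "Determinant.det (Matrix.mat n n (\<lambda>(j, k). 1 / (1 - l j * cnj (m k))\<^sup>2))
    = (\<Sum>p | p permutes {0..<n}. signof p * (\<Prod>i = 0..<n. 1 / (1 - l i * cnj (m (p i)))\<^sup>2))"
    by (subst det_def'[of _ n]) (auto intro!: sum.cong prod.cong simp: permutes_in_image)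
  then show ?thesis
    by (simp add: s bergman_prod_def atLeast0LessThan mult.commute)
qed

text \<open>Pull the integral back to the polydisc, where the antisymmetric function
  \<open>F\<close> is paired with an antisymmetrized product kernel. The polydisc formula evaluates
  each summand, and distinct coordinates make the Vandermonde factor at \<open>m\<close>
  cancellable.\<close>

lemma reproducing_distinct:
  assumes f: "f \<in> bergman_space n G" and m: "m \<in> D" and inj: "inj_on m {..<n}"
  shows "f (sym_map n m) = (LINT z:G|L. f z * cnj (kernel (conj_pt m) z))"
proof -
  let ?V = "vandermonde n"
  define F where "F = (\<lambda>l. f (sym_map n l) * ?V l)"
  have hol: "holomorphic_n n F D"
    unfolding F_def using f
    by (intro holomorphic_n_mult holomorphic_n_comp_sym_map holomorphic_n_vandermonde)
       (simp add: bergman_space_def)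
  then have contF: "continuous_on D F" by (simp add: holomorphic_n_def)
  have "set_integrable L D (\<lambda>l. (cmod (?V l))\<^sup>2 *\<^sub>R (cmod (f (sym_map n l)))\<^sup>2)"
    using f by (intro set_integral_sym_map(1)) (simp add: bergman_space_def)
  then have "set_integrable L D (\<lambda>l. (cmod (F l))\<^sup>2)"
    by (simp add: F_def norm_mult power_mult_distrib mult.commute)
  then have intF: "set_integrable L D F"
    by (intro set_integrable_of_square sets_unit_polydisc emeasure_unit_polydisc_finite
        set_borel_measurable_continuous_on contF)
  have Vm: "?V m \<noteq> 0" by (rule vandermonde_nonzero[OF inj])
  have perm_D: "(\<lambda>i. m (p i)) \<in> D" if p: "p permutes {..<n}" for p
  proof -
    have "m (p i) = undefined" if "\<not> i < n" for i
      using m p that by (simp add: permutes_def unit_polydisc_def Cn_eq_extensional extensional_def)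
    then show ?thesis
      using m permutes_in_image[OF p] by (auto simp: unit_polydisc_def Cn_eq_extensional extensional_def)
  qed
  have sgn2: "signof p * signof p = (1 :: complex)" for p by (cases p rule: sign_cases) simp_all
  \<comment> \<open>The prefactor is the conjugate of the one in \<open>kernel_det\<close>, so it
    completes the integrand to \<open>F\<close> times the conjugated determinant.\<close>
  have "?V m * of_real pi ^ n * (fact n *\<^sub>R (LINT z:G|L. f z * cnj (kernel (conj_pt m) z)))
      = ?V m * of_real pi ^ n * (LINT l:D|L. (cmod (?V l))\<^sup>2 *\<^sub>R (f (sym_map n l) * cnj (kernel (conj_pt m) (sym_map n l))))"
    using integrable_mult_kernel[OF f conj_pt_D[OF m]] by (subst set_integral_sym_map(2)) auto
  also have "\<dots> = (LINT l:D|L. ?V m * of_real pi ^ n * ((cmod (?V l))\<^sup>2 *\<^sub>R (f (sym_map n l) * cnj (kernel (conj_pt m) (sym_map n l)))))"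
    by (rule set_integral_mult_right[symmetric])
  also have "\<dots> = (LINT l:D|L. \<Sum>p | p permutes {..<n}. signof p * (F l * bergman_prod n (\<lambda>i. m (p i)) l))"
  proof (intro set_lebesgue_integral_cong sets_unit_polydisc allI impI)
    fix l assume l: "l \<in> D"
    have "?V m * of_real pi ^ n * ((cmod (?V l))\<^sup>2 *\<^sub>R (f (sym_map n l) * cnj (kernel (conj_pt m) (sym_map n l))))
        = F l * cnj (?V l * kernel (conj_pt m) (sym_map n l) * cnj (?V m) * of_real pi ^ n)"
    proof -
      have "complex_of_real ((cmod (?V l))\<^sup>2) = ?V l * cnj (?V l)" by (rule complex_norm_square)
      then show ?thesis
        by (simp only: scaleR_conv_of_real F_def complex_cnj_mult complex_cnj_cnj complex_cnj_power
            complex_cnj_complex_of_real mult_ac)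
    qed
    also have "\<dots> = F l * (\<Sum>p | p permutes {..<n}. signof p * bergman_prod n (\<lambda>i. m (p i)) l)"
      unfolding kernel_det[OF l m] cnj_det_expand ..
    also have "\<dots> = (\<Sum>p | p permutes {..<n}. signof p * (F l * bergman_prod n (\<lambda>i. m (p i)) l))"
      by (simp add: sum_distrib_left mult_ac)
    finally show "?V m * of_real pi ^ n * ((cmod (?V l))\<^sup>2 *\<^sub>R (f (sym_map n l) * cnj (kernel (conj_pt m) (sym_map n l))))
        = (\<Sum>p | p permutes {..<n}. signof p * (F l * bergman_prod n (\<lambda>i. m (p i)) l))" .
  qed
  also have "\<dots> = (\<Sum>p | p permutes {..<n}. LINT l:D|L. signof p * (F l * bergman_prod n (\<lambda>i. m (p i)) l))"
    unfolding set_lebesgue_integral_def scaleR_sum_right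
  proof (rule Bochner_Integration.integral_sum)
    fix p assume "p \<in> {p. p permutes {..<n}}"
    then have "set_integrable L D (\<lambda>l. signof p * (F l * bergman_prod n (\<lambda>i. m (p i)) l))"
      using set_integrable_mult_bergman_prod[OF contF intF perm_D] by (intro set_integrable_mult_right) auto
    then show "integrable L (\<lambda>l. indicator D l *\<^sub>R (signof p * (F l * bergman_prod n (\<lambda>i. m (p i)) l)))"
      by (simp only: set_integrable_def)
  qed
  also have "\<dots> = (\<Sum>p | p permutes {..<n}. signof p * (of_real pi ^ n * F (\<lambda>i. m (p i))))"
  proof (rule sum.cong[OF refl])
    fix p assume "p \<in> {p. p permutes {..<n}}"
    then have p: "p permutes {..<n}" by simp
    show "(LINT l:D|L. signof p * (F l * bergman_prod n (\<lambda>i. m (p i)) l)) = signof p * (of_real pi ^ n * F (\<lambda>i. m (p i)))"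
      unfolding set_integral_mult_right polydisc_reproducing[OF hol intF perm_D[OF p]] ..
  qed
  \<comment> \<open>The sign of \<open>p\<close> occurs twice, from the determinant and from the
    antisymmetry of \<open>F\<close>; all n! summands are equal.\<close>
  also have "\<dots> = (\<Sum>p | p permutes {..<n}. of_real pi ^ n * (f (sym_map n m) * ?V m))"
  proof (rule sum.cong[OF refl])
    fix p assume "p \<in> {p. p permutes {..<n}}"
    then have p: "p permutes {..<n}" by simp
    have "signof p * (of_real pi ^ n * F (\<lambda>i. m (p i))) = (signof p * signof p) * (of_real pi ^ n * (f (sym_map n m) * ?V m))"
      unfolding F_def sym_map_permute[OF p] vandermonde_permute[OF p] by (simp only: mult_ac)
    then show "signof p * (of_real pi ^ n * F (\<lambda>i. m (p i))) = of_real pi ^ n * (f (sym_map n m) * ?V m)"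
      by (simp only: sgn2 mult_1)
  qed
  also have "\<dots> = ?V m * of_real pi ^ n * (fact n *\<^sub>R f (sym_map n m))"
    by (simp add: card_permutations[OF card_lessThan] scaleR_conv_of_real)
  finally have "?V m * of_real pi ^ n * (fact n *\<^sub>R (LINT z:G|L. f z * cnj (kernel (conj_pt m) z)))
      = ?V m * of_real pi ^ n * (fact n *\<^sub>R f (sym_map n m))" .
  then show ?thesis using Vm by simp
qed

text \<open>At a point with coinciding coordinates the reproducing property follows by continuity along a
  line on which the coordinates are distinct for all but finitely many parameters.\<close>

lemma reproducing:
  assumes f: "f \<in> bergman_space n G" and m: "m \<in> D"
  shows "f (sym_map n m) = (LINT z:G|L. f z * cnj (kernel (conj_pt m) z))"
proof -
  obtain r0 where r0: "0 \<le> r0" "r0 < 1" "m \<in> closed_polydisc r0" using exists_radius[OF m] .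
  \<comment> \<open>\<open>r\<close> is the midpoint between \<open>r0\<close> and 1, and
    \<open>e0\<close> is chosen so that \<open>r0 + e0 * n = r\<close>; the perturbed points stay in
    one closed polydisc of radius below 1.\<close>
  define r where "r = (1 + r0) / 2"
  define e0 where "e0 = (1 - r0) / (2 * real n)"
  have r: "r < 1" using r0 by (simp add: r_def)
  have e0: "0 < e0" using r0 n_pos by (simp add: e0_def)
  \<comment> \<open>Shifting coordinate \<open>i\<close> by \<open>e * i\<close> moves any two
    coordinates apart at different speeds, so each pair can collide for at most one
    \<open>e\<close>.\<close>
  define w where "w = (\<lambda>e::real. restrict (\<lambda>i. m i + of_real e * of_nat i) {..<n})"
  have w_in: "w e \<in> closed_polydisc r" if e: "e \<in> {0..e0}" for e
  proof -
    have "cmod (m i + of_real e * of_nat i) \<le> r" if "i < n" for i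
    proof -
      have "cmod (m i + of_real e * of_nat i) \<le> cmod (m i) + e * real i"
        using norm_triangle_ineq[of "m i" "of_real e * of_nat i"] e by (simp add: norm_mult)
      also have "\<dots> \<le> r0 + e0 * real n"
        using e that r0(3) by (intro add_mono mult_mono) (auto simp: closed_polydisc_def)
      also have "\<dots> = r" using n_pos by (simp add: e0_def r_def field_simps)
      finally show ?thesis .
    qed
    then show ?thesis by (simp add: w_def closed_polydisc_def Cn_eq_extensional)
  qed
  have w_D: "w e \<in> D" if "e \<in> {0..e0}" for e using w_in[OF that] closed_polydisc_subset[OF r] by blast
  have w_cont: "continuous_on A w" for A
    unfolding w_def
  proof (rule continuous_on_coordinatewise_then_product)
    fix i show "continuous_on A (\<lambda>e. restrict (\<lambda>i. m i + of_real e * of_nat i) {..<n} i)"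
      by (cases "i < n") (auto intro!: continuous_intros)
  qed
  have cw_cont: "continuous_on A (\<lambda>e. conj_pt (w e))" for A
    unfolding conj_pt_def
  proof (rule continuous_on_coordinatewise_then_product)
    fix i show "continuous_on A (\<lambda>e. restrict (\<lambda>i. cnj (w e i)) {..<n} i)"
      using continuous_on_product_then_coordinatewise[OF w_cont, of A i]
      by (cases "i < n") (auto intro!: continuous_on_cnj)
  qed
  obtain C where C: "0 \<le> C" "\<And>z b. z \<in> G \<Longrightarrow> b \<in> closed_polydisc r \<Longrightarrow> cmod (kernel b z) \<le> C"
    using kernel_bounded[OF r] by metis
  define I where "I = (\<lambda>e. LINT z:G|L. f z * cnj (kernel (conj_pt (w e)) z))"
  have kz_cont: "continuous_on {0..e0} (\<lambda>e. kernel (conj_pt (w e)) z)" if z: "z \<in> G" for z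
  proof -
    have "continuous_on {0..e0} (\<lambda>e. (\<lambda>(z, b). kernel b z) (z, conj_pt (w e)))"
    proof (rule continuous_on_compose2[OF continuous_on_kernel[OF r]])
      show "continuous_on {0..e0} (\<lambda>e. (z, conj_pt (w e)))"
        by (intro continuous_on_Pair continuous_on_const cw_cont)
      show "(\<lambda>e. (z, conj_pt (w e))) ` {0..e0} \<subseteq> sym_map n ` closed_polydisc 1 \<times> closed_polydisc r"
        using z G_subset w_in conj_pt_closed_polydisc by auto
    qed
    then show ?thesis by simp
  qed
  \<comment> \<open>Dominated convergence with majorant \<open>C\<close> times the modulus of
    \<open>f\<close>, since the kernel bound holds for all parameters at once.\<close>
  have I_cont: "continuous_on {0..e0} I"
    unfolding continuous_on_sequentially
  proof (intro allI impI ballI, elim conjE)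
    fix x a assume x: "\<forall>k. x k \<in> {0..e0}" and a: "a \<in> {0..e0}" and lim: "x \<longlonglongrightarrow> a"
    show "(I \<circ> x) \<longlonglongrightarrow> I a"
      unfolding I_def set_lebesgue_integral_def o_def
    proof (rule integral_dominated_convergence)
      show "integrable L (\<lambda>z. C * norm (indicator G z *\<^sub>R f z))"
        using bergman_space_integrable(2)[OF f]
        unfolding set_integrable_def by (intro integrable_mult_right integrable_norm)
      show "(\<lambda>z. indicator G z *\<^sub>R (f z * cnj (kernel (conj_pt (w a)) z))) \<in> borel_measurable L"
        using integrable_mult_kernel[OF f conj_pt_D[OF w_D[OF a]]]
        unfolding set_integrable_def by (rule borel_measurable_integrable)
      show "(\<lambda>z. indicator G z *\<^sub>R (f z * cnj (kernel (conj_pt (w (x k))) z))) \<in> borel_measurable L" for k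
        using integrable_mult_kernel[OF f conj_pt_D[OF w_D]] x
        unfolding set_integrable_def by (intro borel_measurable_integrable) blast
      show "AE z in L. (\<lambda>k. indicator G z *\<^sub>R (f z * cnj (kernel (conj_pt (w (x k))) z)))
          \<longlonglongrightarrow> indicator G z *\<^sub>R (f z * cnj (kernel (conj_pt (w a)) z))"
      proof (rule AE_I2)
        fix z
        show "(\<lambda>k. indicator G z *\<^sub>R (f z * cnj (kernel (conj_pt (w (x k))) z)))
          \<longlonglongrightarrow> indicator G z *\<^sub>R (f z * cnj (kernel (conj_pt (w a)) z))"
        proof (cases "z \<in> G")
          case True
          have "(\<lambda>k. kernel (conj_pt (w (x k))) z) \<longlonglongrightarrow> kernel (conj_pt (w a)) z"
            using kz_cont[OF True] x a lim unfolding continuous_on_sequentially o_def by blast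
          then show ?thesis by (intro tendsto_intros)
        qed simp
      qed
      show "AE z in L. norm (indicator G z *\<^sub>R (f z * cnj (kernel (conj_pt (w (x k))) z)))
          \<le> C * norm (indicator G z *\<^sub>R f z)" for k
      proof (rule AE_I2)
        fix z
        show "norm (indicator G z *\<^sub>R (f z * cnj (kernel (conj_pt (w (x k))) z))) \<le> C * norm (indicator G z *\<^sub>R f z)"
          using C(2)[of z "conj_pt (w (x k))"] conj_pt_closed_polydisc[OF w_in] x
          by (cases "z \<in> G") (auto simp: norm_mult mult.commute[of "cmod (f z)"] intro!: mult_right_mono)
      qed
    qed
  qed
  have f_cont: "continuous_on {0..e0} (\<lambda>e. f (sym_map n (w e)))"
  proof (rule continuous_on_compose2[OF bergman_space_integrable(1)[OF f]])
    show "continuous_on {0..e0} (\<lambda>e. sym_map n (w e))"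
      by (rule continuous_on_compose2[OF continuous_on_sym_map[of UNIV] w_cont]) auto
    show "(\<lambda>e. sym_map n (w e)) ` {0..e0} \<subseteq> G"
      using w_D by (auto simp: symmetrized_polydisc_def)
  qed
  define \<phi> where "\<phi> = (\<lambda>e. f (sym_map n (w e)) - I e)"
  have \<phi>_cont: "continuous_on {0..e0} \<phi>" unfolding \<phi>_def by (intro continuous_on_diff f_cont I_cont)
  \<comment> \<open>All possible collision parameters. The pairs with \<open>i = j\<close> divide by
    zero and merely contribute the value 0.\<close>
  define B where "B = (\<lambda>(i, j). Re ((m j - m i) / (of_nat i - of_nat j))) ` ({..<n} \<times> {..<n})"
  have "finite B" unfolding B_def by simp
  have zero: "\<phi> e = 0" if e: "e \<in> {0..e0}" "e \<notin> B" for e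
  proof -
    have "inj_on (w e) {..<n}"
    proof (rule inj_onI, rule ccontr)
      fix i j assume ij: "i \<in> {..<n}" "j \<in> {..<n}" "w e i = w e j" "i \<noteq> j"
      then have "of_real e * (of_nat i - of_nat j) = m j - m i"
        by (simp add: w_def algebra_simps)
      moreover have "of_nat i - of_nat j \<noteq> (0 :: complex)" using ij(4) by simp
      ultimately have "of_real e = (m j - m i) / (of_nat i - of_nat j)" by (simp add: field_simps)
      then have "e = Re ((m j - m i) / (of_nat i - of_nat j))" by (metis Re_complex_of_real)
      then show False using e(2) ij by (auto simp: B_def)
    qed
    then show ?thesis using reproducing_distinct[OF f w_D[OF e(1)]] by (simp add: \<phi>_def I_def)
  qed
  have "\<phi> 0 = 0"
  \<comment> \<open>A nonzero value at 0 would persist on an interval by continuity, but \<phi> can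
    be nonzero only on the finite set \<open>B\<close>.\<close>
  proof (rule ccontr)
    assume nz: "\<phi> 0 \<noteq> 0"
    have "0 \<in> {0..e0}" using e0 by simp
    then obtain d where d: "d > 0" "\<And>e. e \<in> {0..e0} \<Longrightarrow> dist e 0 < d \<Longrightarrow> dist (\<phi> e) (\<phi> 0) < cmod (\<phi> 0)"
      using \<phi>_cont nz unfolding continuous_on_iff by (metis zero_less_norm_iff)
    have "{0..<min d e0} \<subseteq> B"
    proof
      fix e assume e: "e \<in> {0..<min d e0}"
      then have "dist (\<phi> e) (\<phi> 0) < cmod (\<phi> 0)" by (intro d(2)) auto
      then have "\<phi> e \<noteq> 0" by (auto simp: dist_norm)
      then show "e \<in> B" using zero[of e] e by auto
    qed
    then have "finite {0..<min d e0}" using \<open>finite B\<close> finite_subset by blast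
    then show False using d(1) e0 by (simp add: infinite_Ico)
  qed
  moreover have "w 0 = m"
    using m by (auto simp: w_def unit_polydisc_def Cn_eq_extensional extensional_def fun_eq_iff)
  ultimately show ?thesis by (simp add: \<phi>_def I_def)
qed

text \<open>The second argument of a kernel is a point of the domain, whereas \<open>kernel\<close>
  takes a tuple of roots, so a preimage is chosen for each point.\<close>

lemma is_bergman_kernel_exists: "\<exists>K. is_bergman_kernel n G K"
proof -
  define pt where "pt = (\<lambda>w. SOME m. m \<in> D \<and> sym_map n m = w)"
  have pt: "pt w \<in> D" "sym_map n (pt w) = w" if "w \<in> G" for w
  proof -
    have "\<exists>m. m \<in> D \<and> sym_map n m = w" using that by (auto simp: symmetrized_polydisc_def)
    from someI_ex[OF this] show "pt w \<in> D" "sym_map n (pt w) = w" by (auto simp: pt_def)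
  qed
  have "is_bergman_kernel n G (\<lambda>z w. kernel (conj_pt (pt w)) z)"
    unfolding is_bergman_kernel_def
  proof (intro ballI conjI)
    fix w assume w: "w \<in> G"
    show "(\<lambda>z. kernel (conj_pt (pt w)) z) \<in> bergman_space n G"
      by (rule kernel_bergman[OF conj_pt_D[OF pt(1)[OF w]]])
    fix f assume f: "f \<in> bergman_space n G"
    show "f w = (LINT z:G|L. f z * cnj (kernel (conj_pt (pt w)) z))"
      using reproducing[OF f pt(1)[OF w]] pt(2)[OF w] by simp
  qed
  then show ?thesis by blast
qed

text \<open>Each of the two kernels reproduces the other, and Hermitian symmetry closes the circle.
  The zero found for \<open>kernel\<close> thereby becomes a zero of every \<open>K\<close>
  satisfying the definition.\<close>

lemma bergman_kernel_unique:
  assumes K: "is_bergman_kernel n G K" and z: "z \<in> G" and m: "m \<in> D"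
  shows "K z (sym_map n m) = kernel (conj_pt m) z"
proof -
  let ?w = "sym_map n m" and ?k = "kernel (conj_pt m)"
  have w: "?w \<in> G" using m by (simp add: symmetrized_polydisc_def)
  have k: "?k \<in> bergman_space n G" by (rule kernel_bergman[OF conj_pt_D[OF m]])
  have Kb: "(\<lambda>x. K x u) \<in> bergman_space n G" if "u \<in> G" for u
    using K that by (simp add: is_bergman_kernel_def)
  have rep: "f u = (LINT x:G|L. f x * cnj (K x u))" if "u \<in> G" "f \<in> bergman_space n G" for f u
    using K that by (simp add: is_bergman_kernel_def)
  have swap: "cnj (LINT x:G|L. a x * cnj (b x)) = (LINT x:G|L. b x * cnj (a x))" for a b
    unfolding set_lebesgue_integral_def
    by (subst Bochner_Integration.integral_cnj[symmetric])
       (intro Bochner_Integration.integral_cong refl, simp add: mult.commute)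
  have "cnj (?k z) = (LINT x:G|L. K x z * cnj (?k x))"
    unfolding rep[OF z k] swap ..
  also have "\<dots> = K ?w z"
    using reproducing[OF Kb[OF z] m] by simp
  also have "\<dots> = (LINT x:G|L. K x z * cnj (K x ?w))" by (rule rep[OF w Kb[OF z]])
  also have "\<dots> = cnj (LINT x:G|L. K x ?w * cnj (K x z))" by (rule swap[symmetric])
  also have "\<dots> = cnj (K z ?w)" using rep[OF z Kb[OF w]] by simp
  finally show ?thesis by simp
qed

lemma kernel_zero:
  assumes "3 \<le> n"
  obtains l m where "l \<in> D" "m \<in> D" "kernel (conj_pt m) (sym_map n l) = 0"
proof -
  define u where "u = - 1 / (of_nat n - 1 :: complex)"
  \<comment> \<open>The products of \<open>l j\<close> and \<open>cnj (m k)\<close> carry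
    \<open>a^2\<close>, so their n-th powers equal \<open>a ^ (2 * n)\<close>.\<close>
  obtain a where a: "a ^ (2 * n) = u"
    using exists_complex_root[of "2 * n" u] n_pos by auto
  have nu: "cmod u < 1"
  proof -
    have "cmod (of_nat n - 1) = real n - 1"
    proof -
      have "of_nat n - 1 = (of_nat (n - 1) :: complex)" using assms by (simp add: of_nat_diff)
      then show ?thesis using assms by (simp only: norm_of_nat)
    qed
    then show ?thesis using assms by (simp add: u_def norm_divide)
  qed
  have u0: "u \<noteq> 0" using assms by (auto simp: u_def)
  have na: "cmod a < 1"
  proof (rule ccontr)
    assume "\<not> cmod a < 1"
    then have "1 \<le> cmod a ^ (2 * n)" by (intro one_le_power) simp
    then show False using nu a by (metis norm_power not_le)
  qed
  \<comment> \<open>Since \<open>a\<close> is nonzero, the coordinates are distinct and the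
    Vandermonde products can be divided out at the end.\<close>
  have a0: "a \<noteq> 0" using a u0 n_pos by auto
  define \<omega> where "\<omega> = cis (2 * pi / real n)"
  have \<omega>n: "\<omega> ^ n = 1" using n_pos Complex.DeMoivre[of "2 * pi / real n" n] by (simp add: \<omega>_def)
  have n\<omega>: "cmod \<omega> = 1" by (simp add: \<omega>_def)
  have inj\<omega>: "inj_on (\<lambda>k. \<omega> ^ k) {..<n}"
  proof -
    have "\<omega> ^ k = cis (2 * pi * real k / real n)" for k
      unfolding \<omega>_def Complex.DeMoivre by (simp add: mult_ac)
    then show ?thesis
      using bij_betw_imp_inj_on[OF Complex.bij_betw_roots_unity[OF n_pos]] by simp
  qed
  define l where "l = restrict (\<lambda>j. a * \<omega> ^ j) {..<n}"
  define m where "m = restrict (\<lambda>j. cnj (a * \<omega> ^ j)) {..<n}"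
  have lD: "l \<in> D" and mD: "m \<in> D"
    using na n\<omega> by (auto simp: l_def m_def unit_polydisc_def Cn_eq_extensional norm_mult norm_power)
  have injl: "inj_on l {..<n}"
    using inj\<omega> a0 by (auto simp: l_def inj_on_def)
  have "m j = cnj (l j)" if "j < n" for j using that by (simp add: l_def m_def)
  then have injm: "inj_on m {..<n}"
    using injl by (simp add: inj_on_def)
  define M where "M = Matrix.mat n n (\<lambda>(j, k). 1 / (1 - l j * cnj (m k))\<^sup>2)"
  have row: "(\<Sum>k<n. 1 / (1 - l j * cnj (m k))\<^sup>2) = 0" if j: "j < n" for j
  proof -
    \<comment> \<open>The entries of row \<open>j\<close> have
      \<open>l j * cnj (m k) = ?c * \<omega> ^ k\<close>, and the n-th power of \<open>?c\<close>
      does not depend on the row.\<close>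
    let ?c = "a\<^sup>2 * \<omega> ^ j"
    have c: "?c ^ n = u"
    proof -
      have "(a\<^sup>2) ^ n = u" using a by (simp only: power_mult)
      moreover have "(\<omega> ^ j) ^ n = (\<omega> ^ n) ^ j"
        by (simp only: power_mult[symmetric] mult.commute)
      ultimately show ?thesis using \<omega>n by (simp add: power_mult_distrib)
    qed
    have "?c ^ n \<noteq> 1" using c nu by auto
    have "(\<Sum>k<n. 1 / (1 - l j * cnj (m k))\<^sup>2) = (\<Sum>k<n. 1 / (1 - ?c * \<omega> ^ k)\<^sup>2)"
      using j by (intro sum.cong) (auto simp: l_def m_def power2_eq_square mult_ac)
    also have "\<dots> = of_nat n * (1 + (of_nat n - 1) * ?c ^ n) / (1 - ?c ^ n)\<^sup>2"
      unfolding \<omega>_def by (rule sum_inverse_squares_roots[OF n_pos]) (use \<open>?c ^ n \<noteq> 1\<close> in \<open>simp add: \<omega>_def\<close>)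
    also have "1 + (of_nat n - 1) * ?c ^ n = 0"
      unfolding c u_def using assms by auto
    finally show ?thesis by simp
  qed
  have "Determinant.det M = 0"
  proof -
    have Mc: "M \<in> carrier_mat n n" by (simp add: M_def)
    \<comment> \<open>Vanishing row sums place the all-ones vector in the null space of
      \<open>M\<close>.\<close>
    have "M *\<^sub>v Matrix.vec n (\<lambda>_. 1) = 0\<^sub>v n"
      by (rule eq_vecI) (auto simp: M_def scalar_prod_def atLeast0LessThan row)
    moreover have "Matrix.vec n (\<lambda>_. 1 :: complex) \<noteq> 0\<^sub>v n"
    proof
      assume "Matrix.vec n (\<lambda>_. 1 :: complex) = 0\<^sub>v n"
      then have "vec_index (Matrix.vec n (\<lambda>_. 1 :: complex)) 0 = vec_index (0\<^sub>v n) 0" by simp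
      then show False using n_pos by simp
    qed
    ultimately show ?thesis
      using det_0_iff_vec_prod_zero[OF Mc] by (metis vec_carrier)
  qed
  then have "vandermonde n l * kernel (conj_pt m) (sym_map n l) * cnj (vandermonde n m) * of_real pi ^ n = 0"
    using kernel_det[OF lD mD] by (simp add: M_def)
  then have "kernel (conj_pt m) (sym_map n l) = 0"
    using vandermonde_nonzero[OF injl] vandermonde_nonzero[OF injm] by simp
  then show ?thesis using that lD mD by blast
qed

end

text \<open>The existence clause ensures that the assertion about every Bergman kernel is not
  vacuous.\<close>

theorem mainTheorem1:
  fixes n :: nat
  assumes "n \<ge> 3"
  shows "(\<exists>K. is_bergman_kernel n (symmetrized_polydisc n) K) \<and>
         (\<forall>K. is_bergman_kernel n (symmetrized_polydisc n) K \<longrightarrow>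
            (\<exists>z\<in>symmetrized_polydisc n. \<exists>w\<in>symmetrized_polydisc n. K z w = 0))"
proof -
  have n: "0 < n" using assms by simp
  obtain \<Delta> where "symmetrized_kernel n \<Delta>"
    using bergman_det_factorization[OF n] n unfolding symmetrized_kernel_def by metis
  then interpret symmetrized_kernel n \<Delta> .
  obtain l m where lm: "l \<in> D" "m \<in> D" "kernel (conj_pt m) (sym_map n l) = 0"
    using kernel_zero[OF assms] .
  have mem: "sym_map n l \<in> G" "sym_map n m \<in> G" using lm by (auto simp: symmetrized_polydisc_def)
  show ?thesis
  proof (intro conjI allI impI is_bergman_kernel_exists)
    fix K assume "is_bergman_kernel n G K"
    then have "K (sym_map n l) (sym_map n m) = 0"
      using bergman_kernel_unique mem(1) lm by simp
    then show "\<exists>z\<in>G. \<exists>w\<in>G. K z w = 0" using mem by blast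
  qed
qed

end
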